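(* Let $k$ be a field, $0\ne q\in k$, and $A_q=k\langle x_1,x_2\rangle/\langle x_1^2,\ x_2^2,\ x_1x_2+qx_2x_1\rangle$. (a) If $A_q$ admits a bi-Frobenius algebra structure, then $q=\pm1$. (b) Conversely, if $\sqrt{-1}\in k$ and $q=\pm1$, then $A_q$ admits a bi-Frobenius algebra structure. (c) Moreover, $A_q$ admits a Hopf algebra structure if and only if $\mathrm{char}\,k=2$.
   Context: Bi-Frobenius algebras. Let $A$ be a finite-dimensional algebra that is also a coalgebra over a field $k$ (no compatibility assumed), with comultiplication $\Delta$ and counit $\varepsilon$; let $t\in A$, $\phi\in A^*=\mathrm{Hom}_k(A,k)$, and let $S:A\to A$ be the linear map $S(a)=\sum\phi(t_1a)t_2$, where $\Delta(t)=\sum t_1\otimes t_2$. The quadruple $(A,\phi,t,S)$ is a bi-Frobenius algebra if: (i) $\varepsilon$ is an algebra homomorphism and $1_A$ is group-like; (ii) $(A,\phi)$ is a Frobenius algebra, i.e. $A^*=A\rightharpoonup\phi$ where $(a\rightharpoonup\phi)(x)=\phi(xa)$, and $(A,t)$ is a Frobenius coalgebra, i.e. $A=t\leftharpoonup A^*$ where $t\leftharpoonup f=\sum f(t_1)t_2$; (iii) $S$ is an algebra anti-homomorphism and a coalgebra anti-homomorphism (i.e. $\varepsilon\circ S=\varepsilon$ and $\Delta(S(a))=\sum S(a_2)\otimes S(a_1)$ for all $a\in A$). An algebra "admits a bi-Frobenius algebra structure" if there are $\Delta,\varepsilon,\phi,t$ making it a bi-Frobenius algebra; it "admits a Hopf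 algebra structure" if there are a comultiplication, counit and antipode making the given algebra a Hopf algebra.
   Formalization: In (c), "Hopf implies char k = 2" is proved for all q ≠ 0, but the full equivalence only for q = ±1: as stated it is false for char k = 2 and q ≠ 1 (e.g. k = F_4, q a primitive cube root of unity), since Δ(x_1x_2 + q x_2x_1) = 0 forces 1 + q = 0. *)

theory Defs
  imports Complex_Main "HOL-Algebra.QuotRing" "HOL-Algebra.Module" "HOL-Library.Poly_Mapping"
begin

text \<open>
  The ground field is a type of class \<open>field\<close>.  Vector spaces and algebras over it are
  HOL-Algebra records of type \<open>('k, 'a) module\<close>; the functions on them only matter on carriers.
  A plain vector space is never needed: every space below is an algebra.
\<close>

definition base_field :: "('k::field, 'k) module" where
  "base_field =
     \<lparr>carrier = UNIV, mult = (*), one = 1, zero = 0, add = (+), smult = (*)\<rparr>"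

definition k_algebra :: "('k::field, 'a) module \<Rightarrow> bool" where
  "k_algebra A \<longleftrightarrow> module base_field A \<and> ring A \<and>
     (\<forall>c. \<forall>x\<in>carrier A. \<forall>y\<in>carrier A.
        (c \<odot>\<^bsub>A\<^esub> x) \<otimes>\<^bsub>A\<^esub> y = c \<odot>\<^bsub>A\<^esub> (x \<otimes>\<^bsub>A\<^esub> y) \<and>
        x \<otimes>\<^bsub>A\<^esub> (c \<odot>\<^bsub>A\<^esub> y) = c \<odot>\<^bsub>A\<^esub> (x \<otimes>\<^bsub>A\<^esub> y))"

definition finite_dimensional :: "('k::field, 'a) module \<Rightarrow> bool" where
  "finite_dimensional A \<longleftrightarrow> (\<exists>B. finite B \<and> B \<subseteq> carrier A \<and>
     (\<forall>x\<in>carrier A. \<exists>c. x = (\<Oplus>\<^bsub>A\<^esub>b\<in>B. c b \<odot>\<^bsub>A\<^esub> b)))"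

definition linear_map ::
    "('k::field, 'a) module \<Rightarrow> ('k, 'b) module \<Rightarrow> ('a \<Rightarrow> 'b) \<Rightarrow> bool" where
  "linear_map V W f \<longleftrightarrow> f \<in> carrier V \<rightarrow> carrier W \<and>
     (\<forall>x\<in>carrier V. \<forall>y\<in>carrier V. f (x \<oplus>\<^bsub>V\<^esub> y) = f x \<oplus>\<^bsub>W\<^esub> f y) \<and>
     (\<forall>c. \<forall>x\<in>carrier V. f (c \<odot>\<^bsub>V\<^esub> x) = c \<odot>\<^bsub>W\<^esub> f x)"

abbreviation linear_functional :: "('k::field, 'a) module \<Rightarrow> ('a \<Rightarrow> 'k) \<Rightarrow> bool" where
  "linear_functional V f \<equiv> linear_map V base_field f"

definition algebra_hom ::
    "('k::field, 'a) module \<Rightarrow> ('k, 'b) module \<Rightarrow> ('a \<Rightarrow> 'b) \<Rightarrow> bool" where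
  "algebra_hom A B f \<longleftrightarrow> linear_map A B f \<and> f \<in> ring_hom A B"


section \<open>Monoid algebras, quotients, and the algebra \<open>A\<^sub>q\<close>\<close>

abbreviation pm_scale :: "'k::field \<Rightarrow> ('m \<Rightarrow>\<^sub>0 'k) \<Rightarrow> ('m \<Rightarrow>\<^sub>0 'k)" where
  "pm_scale c \<equiv> Poly_Mapping.map ((*) c)"

definition monoid_algebra :: "('m, 'r) monoid_scheme \<Rightarrow> ('k::field, 'm \<Rightarrow>\<^sub>0 'k) module" where
  "monoid_algebra M =
     \<lparr>carrier = {u. Poly_Mapping.keys u \<subseteq> carrier M},
      mult = (\<lambda>u v. \<Sum>a\<in>Poly_Mapping.keys u. \<Sum>b\<in>Poly_Mapping.keys v.
        Poly_Mapping.single (a \<otimes>\<^bsub>M\<^esub> b) (Poly_Mapping.lookup u a * Poly_Mapping.lookup v b)),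
      one = Poly_Mapping.single \<one>\<^bsub>M\<^esub> 1,
      zero = 0, add = (+), smult = pm_scale\<rparr>"

definition quotient_algebra ::
    "('k::field, 'a) module \<Rightarrow> 'a set \<Rightarrow> ('k, 'a set) module" where
  "quotient_algebra A I =
     \<lparr>carrier = carrier (A Quot I), mult = mult (A Quot I), one = one (A Quot I),
      zero = zero (A Quot I), add = add (A Quot I),
      smult = (\<lambda>c X. \<Union>x\<in>X. I +>\<^bsub>A\<^esub> (c \<odot>\<^bsub>A\<^esub> x))\<rparr>"

text \<open>The free algebra on a set of letters is the algebra of the monoid of words.\<close>

definition free_algebra :: "'x set \<Rightarrow> ('k::field, 'x list \<Rightarrow>\<^sub>0 'k) module" where
  "free_algebra X =
     monoid_algebra \<lparr>carrier = lists X, mult = (@), one = []\<rparr>"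

definition gen :: "'x \<Rightarrow> ('x list \<Rightarrow>\<^sub>0 'k::field)" where
  "gen i = Poly_Mapping.single [i] 1"

definition A_q :: "'k::field \<Rightarrow> ('k, (nat list \<Rightarrow>\<^sub>0 'k) set) module" where
  "A_q q =
     (let F = free_algebra {1, 2}; x1 = gen 1; x2 = gen 2 in
      quotient_algebra F (Idl\<^bsub>F\<^esub>
        {x1 \<otimes>\<^bsub>F\<^esub> x1, x2 \<otimes>\<^bsub>F\<^esub> x2, (x1 \<otimes>\<^bsub>F\<^esub> x2) \<oplus>\<^bsub>F\<^esub> (q \<odot>\<^bsub>F\<^esub> (x2 \<otimes>\<^bsub>F\<^esub> x1))}))"


section \<open>Tensor products\<close>

text \<open>
  \<open>A \<otimes> B\<close> is the free vector space on \<open>carrier A \<times> carrier B\<close> modulo the span of the bilinearity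
  relations.  That free space is the monoid algebra of the multiplicative monoid \<open>A \<times>\<times> B\<close> and the
  span is an ideal in it, so the quotient carries the product
  \<open>(a \<otimes> b) (a' \<otimes> b') = (a a') \<otimes> (b b')\<close>.
\<close>

definition tensor_relations ::
    "('k::field, 'a) module \<Rightarrow> ('k, 'b) module \<Rightarrow> ('a \<times> 'b \<Rightarrow>\<^sub>0 'k) set" where
  "tensor_relations A B =
     {Poly_Mapping.single (a \<oplus>\<^bsub>A\<^esub> a', b) 1 - Poly_Mapping.single (a, b) 1
        - Poly_Mapping.single (a', b) 1
      | a a' b. a \<in> carrier A \<and> a' \<in> carrier A \<and> b \<in> carrier B} \<union>
     {Poly_Mapping.single (a, b \<oplus>\<^bsub>B\<^esub> b') 1 - Poly_Mapping.single (a, b) 1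
        - Poly_Mapping.single (a, b') 1
      | a b b'. a \<in> carrier A \<and> b \<in> carrier B \<and> b' \<in> carrier B} \<union>
     {Poly_Mapping.single (c \<odot>\<^bsub>A\<^esub> a, b) 1 - Poly_Mapping.single (a, b) c
      | c a b. a \<in> carrier A \<and> b \<in> carrier B} \<union>
     {Poly_Mapping.single (a, c \<odot>\<^bsub>B\<^esub> b) 1 - Poly_Mapping.single (a, b) c
      | c a b. a \<in> carrier A \<and> b \<in> carrier B}"

abbreviation tensor_kernel ::
    "('k::field, 'a) module \<Rightarrow> ('k, 'b) module \<Rightarrow> ('a \<times> 'b \<Rightarrow>\<^sub>0 'k) set" where
  "tensor_kernel A B \<equiv> module.span pm_scale (tensor_relations A B)"

definition tensor ::
    "('k::field, 'a) module \<Rightarrow> ('k, 'b) module \<Rightarrow> ('k, ('a \<times> 'b \<Rightarrow>\<^sub>0 'k) set) module" where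
  "tensor A B = quotient_algebra (monoid_algebra (A \<times>\<times> B)) (tensor_kernel A B)"

definition pure_tensor ::
    "('k::field, 'a) module \<Rightarrow> ('k, 'b) module \<Rightarrow> 'a \<Rightarrow> 'b \<Rightarrow> ('a \<times> 'b \<Rightarrow>\<^sub>0 'k) set" where
  "pure_tensor A B a b =
     tensor_kernel A B +>\<^bsub>monoid_algebra (A \<times>\<times> B)\<^esub> Poly_Mapping.single (a, b) 1"

text \<open>
  Sweedler notation: for \<open>X = \<Sum> x\<^sub>1 \<otimes> x\<^sub>2\<close> and \<open>\<beta>\<close> bilinear into \<open>U\<close>, \<open>sweedler U \<beta> X\<close> is
  \<open>\<Sum> \<beta> x\<^sub>1 x\<^sub>2\<close>, i.e. the value at \<open>X\<close> of the linear map on the tensor product induced by \<open>\<beta>\<close>.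
  It is computed on a representative of the coset \<open>X\<close>; for bilinear \<open>\<beta>\<close> any one gives the same
  value.
\<close>

definition sweedler ::
    "('k::field, 'u) module \<Rightarrow> ('a \<Rightarrow> 'b \<Rightarrow> 'u) \<Rightarrow> ('a \<times> 'b \<Rightarrow>\<^sub>0 'k) set \<Rightarrow> 'u" where
  "sweedler U \<beta> X =
     (let u = (SOME u. u \<in> X) in
      \<Oplus>\<^bsub>U\<^esub>p\<in>Poly_Mapping.keys u. Poly_Mapping.lookup u p \<odot>\<^bsub>U\<^esub> \<beta> (fst p) (snd p))"


section \<open>Coalgebras, bi-Frobenius algebras, Hopf algebras\<close>

text \<open>
  Coassociativity is stated in \<open>A \<otimes> (A \<otimes> A)\<close>; the left-hand side is \<open>(\<Delta> \<otimes> id) (\<Delta> a)\<close>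
  transported along the associativity isomorphism.
\<close>

definition coalgebra ::
    "('k::field, 'a) module \<Rightarrow> ('a \<Rightarrow> ('a \<times> 'a \<Rightarrow>\<^sub>0 'k) set) \<Rightarrow> ('a \<Rightarrow> 'k) \<Rightarrow> bool" where
  "coalgebra A \<Delta> \<epsilon> \<longleftrightarrow>
     linear_map A (tensor A A) \<Delta> \<and> linear_functional A \<epsilon> \<and>
     (\<forall>a\<in>carrier A.
        sweedler (tensor A (tensor A A))
          (\<lambda>x y. sweedler (tensor A (tensor A A))
             (\<lambda>x1 x2. pure_tensor A (tensor A A) x1 (pure_tensor A A x2 y)) (\<Delta> x)) (\<Delta> a)
        = sweedler (tensor A (tensor A A)) (\<lambda>x y. pure_tensor A (tensor A A) x (\<Delta> y)) (\<Delta> a)) \<and>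
     (\<forall>a\<in>carrier A.
        sweedler A (\<lambda>x y. \<epsilon> x \<odot>\<^bsub>A\<^esub> y) (\<Delta> a) = a \<and>
        sweedler A (\<lambda>x y. \<epsilon> y \<odot>\<^bsub>A\<^esub> x) (\<Delta> a) = a)"

definition group_like ::
    "('k::field, 'a) module \<Rightarrow> ('a \<Rightarrow> ('a \<times> 'a \<Rightarrow>\<^sub>0 'k) set) \<Rightarrow> ('a \<Rightarrow> 'k) \<Rightarrow> 'a \<Rightarrow> bool" where
  "group_like A \<Delta> \<epsilon> g \<longleftrightarrow>
     g \<in> carrier A \<and> \<Delta> g = pure_tensor A A g g \<and> \<epsilon> g = 1"

text \<open>In the next two definitions the converse inclusions hold automatically.\<close>

definition frobenius_algebra :: "('k::field, 'a) module \<Rightarrow> ('a \<Rightarrow> 'k) \<Rightarrow> bool" where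
  "frobenius_algebra A \<phi> \<longleftrightarrow> linear_functional A \<phi> \<and>
     (\<forall>f. linear_functional A f \<longrightarrow>
        (\<exists>a\<in>carrier A. \<forall>x\<in>carrier A. f x = \<phi> (x \<otimes>\<^bsub>A\<^esub> a)))"

definition frobenius_coalgebra ::
    "('k::field, 'a) module \<Rightarrow> ('a \<Rightarrow> ('a \<times> 'a \<Rightarrow>\<^sub>0 'k) set) \<Rightarrow> 'a \<Rightarrow> bool" where
  "frobenius_coalgebra A \<Delta> t \<longleftrightarrow> t \<in> carrier A \<and>
     (\<forall>a\<in>carrier A. \<exists>f. linear_functional A f \<and>
        a = sweedler A (\<lambda>t1 t2. f t1 \<odot>\<^bsub>A\<^esub> t2) (\<Delta> t))"

definition algebra_antihom :: "('k::field, 'a) module \<Rightarrow> ('a \<Rightarrow> 'a) \<Rightarrow> bool" where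
  "algebra_antihom A S \<longleftrightarrow> linear_map A A S \<and> S \<one>\<^bsub>A\<^esub> = \<one>\<^bsub>A\<^esub> \<and>
     (\<forall>a\<in>carrier A. \<forall>b\<in>carrier A. S (a \<otimes>\<^bsub>A\<^esub> b) = S b \<otimes>\<^bsub>A\<^esub> S a)"

definition coalgebra_antihom ::
    "('k::field, 'a) module \<Rightarrow> ('a \<Rightarrow> ('a \<times> 'a \<Rightarrow>\<^sub>0 'k) set) \<Rightarrow> ('a \<Rightarrow> 'k) \<Rightarrow>
      ('a \<Rightarrow> 'a) \<Rightarrow> bool" where
  "coalgebra_antihom A \<Delta> \<epsilon> S \<longleftrightarrow> linear_map A A S \<and>
     (\<forall>a\<in>carrier A. \<epsilon> (S a) = \<epsilon> a) \<and>
     (\<forall>a\<in>carrier A.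
        \<Delta> (S a) = sweedler (tensor A A) (\<lambda>a1 a2. pure_tensor A A (S a2) (S a1)) (\<Delta> a))"

definition bi_frobenius_algebra ::
    "('k::field, 'a) module \<Rightarrow> ('a \<Rightarrow> ('a \<times> 'a \<Rightarrow>\<^sub>0 'k) set) \<Rightarrow> ('a \<Rightarrow> 'k) \<Rightarrow>
      ('a \<Rightarrow> 'k) \<Rightarrow> 'a \<Rightarrow> ('a \<Rightarrow> 'a) \<Rightarrow> bool" where
  "bi_frobenius_algebra A \<Delta> \<epsilon> \<phi> t S \<longleftrightarrow>
     k_algebra A \<and> finite_dimensional A \<and> coalgebra A \<Delta> \<epsilon> \<and>
     algebra_hom A base_field \<epsilon> \<and> group_like A \<Delta> \<epsilon> \<one>\<^bsub>A\<^esub> \<and>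
     frobenius_algebra A \<phi> \<and> frobenius_coalgebra A \<Delta> t \<and>
     (\<forall>a\<in>carrier A. S a = sweedler A (\<lambda>t1 t2. \<phi> (t1 \<otimes>\<^bsub>A\<^esub> a) \<odot>\<^bsub>A\<^esub> t2) (\<Delta> t)) \<and>
     algebra_antihom A S \<and> coalgebra_antihom A \<Delta> \<epsilon> S"

definition admits_bi_frobenius :: "('k::field, 'a) module \<Rightarrow> bool" where
  "admits_bi_frobenius A \<longleftrightarrow> (\<exists>\<Delta> \<epsilon> \<phi> t S. bi_frobenius_algebra A \<Delta> \<epsilon> \<phi> t S)"

definition hopf_algebra ::
    "('k::field, 'a) module \<Rightarrow> ('a \<Rightarrow> ('a \<times> 'a \<Rightarrow>\<^sub>0 'k) set) \<Rightarrow> ('a \<Rightarrow> 'k) \<Rightarrow>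
      ('a \<Rightarrow> 'a) \<Rightarrow> bool" where
  "hopf_algebra A \<Delta> \<epsilon> S \<longleftrightarrow>
     k_algebra A \<and> coalgebra A \<Delta> \<epsilon> \<and>
     algebra_hom A (tensor A A) \<Delta> \<and> algebra_hom A base_field \<epsilon> \<and> linear_map A A S \<and>
     (\<forall>a\<in>carrier A.
        sweedler A (\<lambda>x y. S x \<otimes>\<^bsub>A\<^esub> y) (\<Delta> a) = \<epsilon> a \<odot>\<^bsub>A\<^esub> \<one>\<^bsub>A\<^esub> \<and>
        sweedler A (\<lambda>x y. x \<otimes>\<^bsub>A\<^esub> S y) (\<Delta> a) = \<epsilon> a \<odot>\<^bsub>A\<^esub> \<one>\<^bsub>A\<^esub>)"

definition admits_hopf :: "('k::field, 'a) module \<Rightarrow> bool" where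
  "admits_hopf A \<longleftrightarrow> (\<exists>\<Delta> \<epsilon> S. hopf_algebra A \<Delta> \<epsilon> S)"

end

theory Submission
  imports Defs
begin

text \<open>
  In any bi-Frobenius algebra with \<open>S t\<close> proportional to \<open>t\<close> one has
  \<open>t\<^sub>1 b \<otimes> t\<^sub>2 = t\<^sub>1 \<otimes> t\<^sub>2 S(b)\<close> and, applying \<open>S\<close>, \<open>S\<^sup>2(b) t\<^sub>1 \<otimes> t\<^sub>2 = t\<^sub>1 \<otimes> S(b) t\<^sub>2\<close>; hence
  \<open>\<phi>(S\<^sup>2(b) d) = \<phi>(d b)\<close>.  In \<open>A\<^sub>q\<close> the element \<open>t\<close> spans the socle.  If \<open>q\<^sup>2 \<noteq> 1\<close>, then the
  antihomomorphism \<open>S\<close> must interchange the lines of \<open>x\<^sub>1\<close> and \<open>x\<^sub>2\<close> modulo the square of the radical,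
  so \<open>S\<^sup>2\<close> is scalar there, whereas the displayed identity makes it act on \<open>x\<^sub>1\<close> and \<open>x\<^sub>2\<close> by
  \<open>- 1 / q\<close> and \<open>- q\<close>: a contradiction.  For \<open>q\<^sup>2 = 1\<close> take \<open>x\<^sub>1\<close>, \<open>x\<^sub>2\<close> primitive and
  \<open>\<Delta>(x\<^sub>1 x\<^sub>2) = x\<^sub>1 x\<^sub>2 \<otimes> 1 + 1 \<otimes> x\<^sub>1 x\<^sub>2 + s (x\<^sub>1 \<otimes> x\<^sub>2 - q x\<^sub>2 \<otimes> x\<^sub>1)\<close> with \<open>s\<^sup>2 = - q\<close>.
  In a Hopf structure the coefficient of \<open>x\<^sub>1 \<otimes> x\<^sub>1\<close> in \<open>\<Delta>(x\<^sub>1)\<^sup>2 = 0\<close> is 2; conversely, in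
  characteristic 2 the above \<open>\<Delta>\<close> is multiplicative.
\<close>

section \<open>Algebras and linear maps\<close>

text \<open>The shaping obstacle is \<open>sweedler\<close>, which evaluates a coset through an
  arbitrarily chosen representative. Well-definedness is settled once; from then on linear maps on a
  tensor product are compared on pure tensors, and an identity in \<open>A \<otimes> A\<close> is
  reduced to scalar identities, one for each pair of functionals. The relations of
  \<open>A_q\<close> are likewise used once, to produce four coordinate functionals; their product
  formulas, in which \<open>- 1 / q\<close> records \<open>y x = - x y / q\<close>, carry the
  computations. That \<open>t\<close> spans the socle comes from
  \<open>\<phi> (t a) = \<epsilon> a\<close>. As \<open>S\<close> reverses products, it maps
  \<open>x y\<close> to a multiple \<open>D\<close> of itself, so \<open>S t = D t\<close>; once
  \<open>S\<close> interchanges the two lines, the same \<open>D\<close> is the scalar by which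
  \<open>S\<^sup>2\<close> acts modulo \<open>x y\<close>. The interchange has two sources:
  \<open>(a x + b y)\<^sup>2 = a b (1 - 1 / q) x y\<close> must vanish on the images of the
  generators, and the mixed relation, reversed by \<open>S\<close>, forces the product of the
  diagonal entries to vanish unless \<open>q\<^sup>2 = 1\<close>.\<close>

lemma base_field_simps [simp]:
  "carrier base_field = UNIV" "mult base_field = (*)" "one base_field = 1"
  "zero base_field = 0" "add base_field = (+)" "smult base_field = (*)"
  by (simp_all add: base_field_def)

lemma cring_base_field: "cring (base_field :: ('k::field, 'k) module)"
proof (rule cringI)
  show "abelian_group (base_field :: ('k, 'k) module)"
    by (rule abelian_groupI) (auto simp: algebra_simps intro: exI[of _ "- _"] left_minus)
  show "comm_monoid (base_field :: ('k, 'k) module)"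
    by (rule comm_monoidI) (auto simp: algebra_simps)
qed (simp add: algebra_simps)

lemma k_algebraI:
  fixes A :: "('k::field, 'a) module"
  assumes "ring A"
    and "\<And>c x. x \<in> carrier A \<Longrightarrow> c \<odot>\<^bsub>A\<^esub> x \<in> carrier A"
    and "\<And>c d x. x \<in> carrier A \<Longrightarrow> (c + d) \<odot>\<^bsub>A\<^esub> x = c \<odot>\<^bsub>A\<^esub> x \<oplus>\<^bsub>A\<^esub> d \<odot>\<^bsub>A\<^esub> x"
    and "\<And>c x y. x \<in> carrier A \<Longrightarrow> y \<in> carrier A \<Longrightarrow>
           c \<odot>\<^bsub>A\<^esub> (x \<oplus>\<^bsub>A\<^esub> y) = c \<odot>\<^bsub>A\<^esub> x \<oplus>\<^bsub>A\<^esub> c \<odot>\<^bsub>A\<^esub> y"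
    and "\<And>c d x. x \<in> carrier A \<Longrightarrow> (c * d) \<odot>\<^bsub>A\<^esub> x = c \<odot>\<^bsub>A\<^esub> (d \<odot>\<^bsub>A\<^esub> x)"
    and "\<And>x. x \<in> carrier A \<Longrightarrow> 1 \<odot>\<^bsub>A\<^esub> x = x"
    and "\<And>c x y. x \<in> carrier A \<Longrightarrow> y \<in> carrier A \<Longrightarrow>
           (c \<odot>\<^bsub>A\<^esub> x) \<otimes>\<^bsub>A\<^esub> y = c \<odot>\<^bsub>A\<^esub> (x \<otimes>\<^bsub>A\<^esub> y)"
    and "\<And>c x y. x \<in> carrier A \<Longrightarrow> y \<in> carrier A \<Longrightarrow>
           x \<otimes>\<^bsub>A\<^esub> (c \<odot>\<^bsub>A\<^esub> y) = c \<odot>\<^bsub>A\<^esub> (x \<otimes>\<^bsub>A\<^esub> y)"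
  shows "k_algebra A"
proof -
  interpret ring A by fact
  have "Module.module base_field A"
    by (rule Module.moduleI) (use assms in \<open>auto intro: cring_base_field abelian_group_axioms\<close>)
  then show ?thesis using assms by (simp add: k_algebra_def)
qed

lemma k_algebra_base_field: "k_algebra (base_field :: ('k::field, 'k) module)"
  using cring_base_field by (intro k_algebraI) (auto simp: algebra_simps dest: cring.axioms)

locale kalg =
  fixes A :: "('k::field, 'a) module" (structure)
  assumes k_algebra: "k_algebra A"

sublocale kalg \<subseteq> ring A
  using k_algebra by (simp add: k_algebra_def)

sublocale kalg \<subseteq> V: Module.module base_field A
  using k_algebra by (simp add: k_algebra_def)

context kalg
begin

lemma smult_closed' [simp, intro]: "x \<in> carrier A \<Longrightarrow> c \<odot> x \<in> carrier A"
  by (rule V.smult_closed) simp_all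

lemma smult_left_add: "x \<in> carrier A \<Longrightarrow> (c + d) \<odot> x = c \<odot> x \<oplus> d \<odot> x"
  using V.smult_l_distr[of c d x] by simp

lemma smult_right_add: "x \<in> carrier A \<Longrightarrow> y \<in> carrier A \<Longrightarrow> c \<odot> (x \<oplus> y) = c \<odot> x \<oplus> c \<odot> y"
  using V.smult_r_distr[of c x y] by simp

lemma smult_smult: "x \<in> carrier A \<Longrightarrow> c \<odot> (d \<odot> x) = (c * d) \<odot> x"
  using V.smult_assoc1[of c d x] by simp

lemma one_smult [simp]: "x \<in> carrier A \<Longrightarrow> 1 \<odot> x = x"
  using V.smult_one[of x] by simp

lemma zero_smult [simp]: "x \<in> carrier A \<Longrightarrow> 0 \<odot> x = \<zero>"
  using V.smult_l_null[of x] by simp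

lemma smult_zero [simp]: "c \<odot> \<zero> = \<zero>"
  using V.smult_r_null[of c] by simp

lemma mult_smult_left [simp]:
  "x \<in> carrier A \<Longrightarrow> y \<in> carrier A \<Longrightarrow> (c \<odot> x) \<otimes> y = c \<odot> (x \<otimes> y)"
  using k_algebra by (simp add: k_algebra_def)

lemma mult_smult_right [simp]:
  "x \<in> carrier A \<Longrightarrow> y \<in> carrier A \<Longrightarrow> x \<otimes> (c \<odot> y) = c \<odot> (x \<otimes> y)"
  using k_algebra by (simp add: k_algebra_def)

lemma minus_eq_smult: "x \<in> carrier A \<Longrightarrow> \<ominus> x = (-1) \<odot> x"
  using smult_left_add[of x "-1" 1] by (simp add: minus_equality)

lemma minus_as_smult: "x \<in> carrier A \<Longrightarrow> y \<in> carrier A \<Longrightarrow> x \<ominus> y = x \<oplus> (-1) \<odot> y"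
  by (simp add: a_minus_def minus_eq_smult)

end

lemma linear_mapI:
  assumes "\<And>x. x \<in> carrier V \<Longrightarrow> f x \<in> carrier W"
    and "\<And>x y. x \<in> carrier V \<Longrightarrow> y \<in> carrier V \<Longrightarrow> f (x \<oplus>\<^bsub>V\<^esub> y) = f x \<oplus>\<^bsub>W\<^esub> f y"
    and "\<And>c x. x \<in> carrier V \<Longrightarrow> f (c \<odot>\<^bsub>V\<^esub> x) = c \<odot>\<^bsub>W\<^esub> f x"
  shows "linear_map V W f"
  using assms by (auto simp: linear_map_def)

lemma
  assumes "linear_map V W f"
  shows linear_map_closed: "x \<in> carrier V \<Longrightarrow> f x \<in> carrier W"
    and linear_map_add: "x \<in> carrier V \<Longrightarrow> y \<in> carrier V \<Longrightarrow> f (x \<oplus>\<^bsub>V\<^esub> y) = f x \<oplus>\<^bsub>W\<^esub> f y"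
    and linear_map_smult: "x \<in> carrier V \<Longrightarrow> f (c \<odot>\<^bsub>V\<^esub> x) = c \<odot>\<^bsub>W\<^esub> f x"
  using assms by (auto simp: linear_map_def)

lemma linear_map_zero:
  assumes "k_algebra V" "k_algebra W" "linear_map V W f"
  shows "f \<zero>\<^bsub>V\<^esub> = \<zero>\<^bsub>W\<^esub>"
proof -
  interpret V: kalg V by (rule kalg.intro) fact
  interpret W: kalg W by (rule kalg.intro) fact
  show ?thesis
    using linear_map_smult[OF assms(3), of "\<zero>\<^bsub>V\<^esub>" 0] linear_map_closed[OF assms(3), of "\<zero>\<^bsub>V\<^esub>"]
    by simp
qed

lemma linear_map_comp:
  assumes "linear_map U V f" "linear_map V W g"
  shows "linear_map U W (\<lambda>x. g (f x))"
  using assms by (auto simp: linear_map_def Pi_iff)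

lemma linear_map_sum:
  assumes "k_algebra W" "linear_map V W f" "linear_map V W g"
  shows "linear_map V W (\<lambda>x. f x \<oplus>\<^bsub>W\<^esub> g x)"
proof -
  interpret W: kalg W by (rule kalg.intro) fact
  show ?thesis
    using assms(2,3) by (auto simp: linear_map_def Pi_iff W.smult_right_add W.a_ac)
qed

lemma linear_map_scaled:
  assumes "k_algebra W" "linear_functional V f" "w \<in> carrier W"
  shows "linear_map V W (\<lambda>x. f x \<odot>\<^bsub>W\<^esub> w)"
proof -
  interpret W: kalg W by (rule kalg.intro) fact
  show ?thesis
    using assms(2,3) by (auto simp: linear_map_def Pi_iff W.smult_left_add W.smult_smult)
qed

lemma linear_map_id: "linear_map V V (\<lambda>x. x)"
  by (simp add: linear_map_def)

lemma linear_map_mult_left: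
  assumes "k_algebra A" "a \<in> carrier A"
  shows "linear_map A A (\<lambda>x. a \<otimes>\<^bsub>A\<^esub> x)"
proof -
  interpret kalg A by (rule kalg.intro) fact
  show ?thesis using assms(2) by (intro linear_mapI) (simp_all add: r_distr)
qed

lemma linear_map_mult_right:
  assumes "k_algebra A" "a \<in> carrier A"
  shows "linear_map A A (\<lambda>x. x \<otimes>\<^bsub>A\<^esub> a)"
proof -
  interpret kalg A by (rule kalg.intro) fact
  show ?thesis using assms(2) by (intro linear_mapI) (simp_all add: l_distr)
qed

lemma linear_map_smult_right:
  assumes "k_algebra A"
  shows "linear_map A A (\<lambda>x. c \<odot>\<^bsub>A\<^esub> x)"
proof -
  interpret kalg A by (rule kalg.intro) fact
  show ?thesis by (intro linear_mapI) (simp_all add: smult_right_add smult_smult mult.commute)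
qed

lemma linear_map_finsum:
  assumes "k_algebra V" "k_algebra W" "linear_map V W f" "finite I" "u \<in> I \<rightarrow> carrier V"
  shows "f (\<Oplus>\<^bsub>V\<^esub>i\<in>I. u i) = (\<Oplus>\<^bsub>W\<^esub>i\<in>I. f (u i))"
proof -
  interpret V: kalg V by (rule kalg.intro) fact
  interpret W: kalg W by (rule kalg.intro) fact
  show ?thesis
    using assms(4,5)
  proof (induction I)
    case empty
    then show ?case using linear_map_zero[OF assms(1-3)] by simp
  next
    case (insert i I)
    then show ?case
      using linear_map_closed[OF assms(3)] linear_map_add[OF assms(3)] by (simp add: Pi_iff)
  qed
qed

section \<open>Monoid algebras\<close>

lemma lookup_pm_scale [simp]:
  "Poly_Mapping.lookup (pm_scale c u) a = c * Poly_Mapping.lookup u a"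
  by (auto simp: Poly_Mapping.map.rep_eq when_def)

lemma pm_scale_single [simp]: "pm_scale c (Poly_Mapping.single a d) = Poly_Mapping.single a (c * d)"
  by (rule poly_mapping_eqI) (simp add: lookup_single when_def)

lemma keys_pm_scale: "Poly_Mapping.keys (pm_scale c u) \<subseteq> Poly_Mapping.keys u"
  by (auto simp: in_keys_iff)

text \<open>\<open>tensor_kernel\<close> is a span in this space of all finitely supported
  functions. The facts about spans and subspaces then apply to it, the carrier of the free space
  being one of the subspaces.\<close>

interpretation pm: vector_space "pm_scale :: 'k::field \<Rightarrow> ('m \<Rightarrow>\<^sub>0 'k) \<Rightarrow> _"
  by unfold_locales (rule poly_mapping_eqI, simp add: lookup_add algebra_simps)+

text \<open>A finitely supported function is the finite sum of its monomials. The partial sums stay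
  supported in \<open>S\<close>, so the induction never leaves the carrier of a monoid
  algebra.\<close>

lemma poly_mapping_induct_keys [consumes 1, case_names zero single add]:
  fixes u :: "'m \<Rightarrow>\<^sub>0 'k::comm_monoid_add"
  assumes "Poly_Mapping.keys u \<subseteq> S"
    and "P 0"
    and "\<And>a c. a \<in> S \<Longrightarrow> P (Poly_Mapping.single a c)"
    and "\<And>v w. Poly_Mapping.keys v \<subseteq> S \<Longrightarrow> Poly_Mapping.keys w \<subseteq> S \<Longrightarrow> P v \<Longrightarrow> P w \<Longrightarrow> P (v + w)"
  shows "P u"
proof -
  have u: "u = (\<Sum>a\<in>Poly_Mapping.keys u. Poly_Mapping.single a (Poly_Mapping.lookup u a))"
    by (rule poly_mapping_eqI) (auto simp: lookup_sum lookup_single when_def in_keys_iff)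
  have "P (\<Sum>a\<in>T. Poly_Mapping.single a (f a)) \<and>
      Poly_Mapping.keys (\<Sum>a\<in>T. Poly_Mapping.single a (f a)) \<subseteq> S"
    if "finite T" "T \<subseteq> S" for T and f :: "'m \<Rightarrow> 'k"
    using that
  proof (induction T)
    case (insert a T)
    have "Poly_Mapping.keys (Poly_Mapping.single a (f a)) \<subseteq> S"
      using insert.prems by (auto split: if_splits)
    moreover have "P (Poly_Mapping.single a (f a))"
      using insert.prems by (intro assms(3)) simp
    moreover have "P (\<Sum>a\<in>T. Poly_Mapping.single a (f a))"
      "Poly_Mapping.keys (\<Sum>a\<in>T. Poly_Mapping.single a (f a)) \<subseteq> S"
      using insert by simp_all
    ultimately show ?case
      unfolding sum.insert[OF insert.hyps] by (intro conjI assms(4) order.trans[OF Poly_Mapping.keys_add] Un_least)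
  qed (simp add: assms(2))
  from this[OF finite_keys assms(1), of "Poly_Mapping.lookup u"] show ?thesis
    unfolding u[symmetric] by (rule conjunct1)
qed

lemma monoid_algebra_simps [simp]:
  "carrier (monoid_algebra M) = {u. Poly_Mapping.keys u \<subseteq> carrier M}"
  "one (monoid_algebra M) = Poly_Mapping.single \<one>\<^bsub>M\<^esub> 1"
  "zero (monoid_algebra M) = 0"
  "add (monoid_algebra M) = (+)"
  "smult (monoid_algebra M) = pm_scale"
  by (simp_all add: monoid_algebra_def)

lemma single_in_monoid_algebra:
  "a \<in> carrier M \<Longrightarrow> Poly_Mapping.single a c \<in> carrier (monoid_algebra M)"
  by simp

text \<open>The defining sum runs over the exact supports, which change under addition and scaling.
  Over common finite supersets the added terms vanish and bilinearity can be read off.\<close>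

lemma monoid_algebra_mult_superset:
  assumes "finite S" "finite T" "Poly_Mapping.keys u \<subseteq> S" "Poly_Mapping.keys v \<subseteq> T"
  shows "u \<otimes>\<^bsub>monoid_algebra M\<^esub> v = (\<Sum>a\<in>S. \<Sum>b\<in>T.
    Poly_Mapping.single (a \<otimes>\<^bsub>M\<^esub> b) (Poly_Mapping.lookup u a * Poly_Mapping.lookup v b))"
proof -
  have "u \<otimes>\<^bsub>monoid_algebra M\<^esub> v = (\<Sum>a\<in>Poly_Mapping.keys u. \<Sum>b\<in>T.
    Poly_Mapping.single (a \<otimes>\<^bsub>M\<^esub> b) (Poly_Mapping.lookup u a * Poly_Mapping.lookup v b))"
    unfolding monoid_algebra_def
    by (simp, intro sum.cong refl sum.mono_neutral_left) (use assms in \<open>auto simp: in_keys_iff\<close>)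
  also have "\<dots> = (\<Sum>a\<in>S. \<Sum>b\<in>T.
    Poly_Mapping.single (a \<otimes>\<^bsub>M\<^esub> b) (Poly_Mapping.lookup u a * Poly_Mapping.lookup v b))"
    by (intro sum.mono_neutral_left) (use assms in \<open>auto simp: in_keys_iff\<close>)
  finally show ?thesis .
qed

lemma monoid_algebra_mult_add_left:
  "(u + v) \<otimes>\<^bsub>monoid_algebra M\<^esub> w
     = u \<otimes>\<^bsub>monoid_algebra M\<^esub> w + v \<otimes>\<^bsub>monoid_algebra M\<^esub> w"
proof -
  let ?S = "Poly_Mapping.keys u \<union> Poly_Mapping.keys v"
  have "finite ?S" by simp
  note superset = monoid_algebra_mult_superset[OF this finite_keys _ order.refl]
  show ?thesis
    unfolding superset[OF Poly_Mapping.keys_add] superset[OF Un_upper1] superset[OF Un_upper2]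
    by (simp add: lookup_add distrib_right single_add sum.distrib)
qed

lemma monoid_algebra_mult_add_right:
  "w \<otimes>\<^bsub>monoid_algebra M\<^esub> (u + v)
     = w \<otimes>\<^bsub>monoid_algebra M\<^esub> u + w \<otimes>\<^bsub>monoid_algebra M\<^esub> v"
proof -
  let ?S = "Poly_Mapping.keys u \<union> Poly_Mapping.keys v"
  have "finite ?S" by simp
  note superset = monoid_algebra_mult_superset[OF finite_keys this order.refl]
  show ?thesis
    unfolding superset[OF Poly_Mapping.keys_add] superset[OF Un_upper1] superset[OF Un_upper2]
    by (simp add: lookup_add distrib_left single_add sum.distrib)
qed

lemma pm_scale_sum: "pm_scale c (\<Sum>a\<in>S. f a) = (\<Sum>a\<in>S. pm_scale c (f a))"
  by (rule pm.scale_sum_right)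

lemma monoid_algebra_mult_scale_left:
  "pm_scale c u \<otimes>\<^bsub>monoid_algebra M\<^esub> v = pm_scale c (u \<otimes>\<^bsub>monoid_algebra M\<^esub> v)"
  unfolding monoid_algebra_mult_superset[OF finite_keys finite_keys keys_pm_scale order.refl]
  by (subst monoid_algebra_mult_superset[OF finite_keys finite_keys order.refl order.refl])
    (simp add: pm_scale_sum mult.assoc)

lemma monoid_algebra_mult_scale_right:
  "u \<otimes>\<^bsub>monoid_algebra M\<^esub> pm_scale c v = pm_scale c (u \<otimes>\<^bsub>monoid_algebra M\<^esub> v)"
  unfolding monoid_algebra_mult_superset[OF finite_keys finite_keys order.refl keys_pm_scale]
  by (subst monoid_algebra_mult_superset[OF finite_keys finite_keys order.refl order.refl])
    (simp add: pm_scale_sum mult.left_commute)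

lemma monoid_algebra_mult_zero [simp]:
  "0 \<otimes>\<^bsub>monoid_algebra M\<^esub> v = 0" "u \<otimes>\<^bsub>monoid_algebra M\<^esub> 0 = 0"
  by (simp_all add: monoid_algebra_def)

lemma monoid_algebra_mult_single [simp]:
  "Poly_Mapping.single a c \<otimes>\<^bsub>monoid_algebra M\<^esub> Poly_Mapping.single b d
     = Poly_Mapping.single (a \<otimes>\<^bsub>M\<^esub> b) (c * d)"
  by (subst monoid_algebra_mult_superset[of "{a}" "{b}"]) simp_all

lemma monoid_algebra_add_closed:
  "u \<in> carrier (monoid_algebra M) \<Longrightarrow> v \<in> carrier (monoid_algebra M) \<Longrightarrow>
   u + v \<in> carrier (monoid_algebra M)"
  using Poly_Mapping.keys_add[of u v] by auto

lemma (in monoid) monoid_algebra_mult_closed: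
  assumes "u \<in> carrier (monoid_algebra G)" "v \<in> carrier (monoid_algebra G)"
  shows "u \<otimes>\<^bsub>monoid_algebra G\<^esub> v \<in> carrier (monoid_algebra G)"
proof -
  have "Poly_Mapping.keys u \<subseteq> carrier G" "Poly_Mapping.keys v \<subseteq> carrier G" using assms by auto
  then show ?thesis
  proof (induction u rule: poly_mapping_induct_keys)
    case (single a c)
    from single(2) show ?case
    proof (induction v rule: poly_mapping_induct_keys)
      case (add v w)
      then show ?case
        unfolding monoid_algebra_mult_add_right by (intro monoid_algebra_add_closed)
    qed (simp_all add: single(1))
  next
    case (add v w)
    then show ?case
      unfolding monoid_algebra_mult_add_left by (intro monoid_algebra_add_closed)
  qed simp
qed

lemma (in monoid) k_algebra_monoid_algebra: "k_algebra (monoid_algebra G :: ('k::field, _) module)"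
proof (rule k_algebraI)
  let ?F = "monoid_algebra G :: ('k, _) module"
  have "abelian_group ?F"
  proof (rule abelian_groupI)
    fix u assume "u \<in> carrier ?F"
    then have "- u \<in> carrier ?F" by (auto simp: in_keys_iff)
    then show "\<exists>v\<in>carrier ?F. v \<oplus>\<^bsub>?F\<^esub> u = \<zero>\<^bsub>?F\<^esub>" by (intro bexI[of _ "- u"]) auto
  qed (auto simp: add_ac dest!: subsetD[OF Poly_Mapping.keys_add])
  moreover have "Group.monoid ?F"
  proof (rule monoidI)
    fix u v w assume "u \<in> carrier ?F" "v \<in> carrier ?F" "w \<in> carrier ?F"
    then have *: "Poly_Mapping.keys u \<subseteq> carrier G" "Poly_Mapping.keys v \<subseteq> carrier G"
      "Poly_Mapping.keys w \<subseteq> carrier G" by auto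
    from *(1) show "u \<otimes>\<^bsub>?F\<^esub> v \<otimes>\<^bsub>?F\<^esub> w = u \<otimes>\<^bsub>?F\<^esub> (v \<otimes>\<^bsub>?F\<^esub> w)"
    proof (induction u rule: poly_mapping_induct_keys)
      case (single a c)
      note a = single
      from *(2) show ?case
      proof (induction v rule: poly_mapping_induct_keys)
        case (single b d)
        note b = single
        from *(3) show ?case
          by (induction w rule: poly_mapping_induct_keys)
            (simp_all add: a b m_assoc mult.assoc monoid_algebra_mult_add_right)
      qed (simp_all add: monoid_algebra_mult_add_right monoid_algebra_mult_add_left)
    qed (simp_all add: monoid_algebra_mult_add_left)
  next
    fix u assume "u \<in> carrier ?F"
    then have "Poly_Mapping.keys u \<subseteq> carrier G" by auto
    then have "\<one>\<^bsub>?F\<^esub> \<otimes>\<^bsub>?F\<^esub> u = u \<and> u \<otimes>\<^bsub>?F\<^esub> \<one>\<^bsub>?F\<^esub> = u"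
      by (induction u rule: poly_mapping_induct_keys)
        (simp_all add: monoid_algebra_mult_add_left monoid_algebra_mult_add_right)
    then show "\<one>\<^bsub>?F\<^esub> \<otimes>\<^bsub>?F\<^esub> u = u" "u \<otimes>\<^bsub>?F\<^esub> \<one>\<^bsub>?F\<^esub> = u" by auto
  next
    show "u \<otimes>\<^bsub>?F\<^esub> v \<in> carrier ?F" if "u \<in> carrier ?F" "v \<in> carrier ?F" for u v
      using that by (rule monoid_algebra_mult_closed)
  qed simp
  ultimately show "ring ?F"
    by (intro ringI) (simp_all add: monoid_algebra_mult_add_left monoid_algebra_mult_add_right)
  show "c \<odot>\<^bsub>?F\<^esub> u \<in> carrier ?F" if "u \<in> carrier ?F" for c u
    using that keys_pm_scale[of c u] by auto
qed (simp_all add: monoid_algebra_mult_scale_left monoid_algebra_mult_scale_right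
  pm.scale_left_distrib pm.scale_right_distrib)

section \<open>Quotient algebras\<close>

text \<open>\<open>quotient_algebra\<close> copies the factor ring into a record with scalars; the
  ring axioms are transported along the equality of the operations.\<close>

lemma ring_cong:
  assumes "ring R" "carrier R' = carrier R" "mult R' = mult R" "one R' = one R"
    "zero R' = zero R" "add R' = add R"
  shows "ring R'"
proof -
  interpret ring R by fact
  show ?thesis
  proof (rule ringI)
    show "abelian_group R'"
      by (rule abelian_groupI) (auto simp: assms(2-) a_ac)
    show "Group.monoid R'"
      by (rule monoidI) (simp_all add: assms(2-) m_assoc)
  qed (simp_all add: assms(2-) l_distr r_distr)
qed

locale kalg_ideal = kalg A + ideal I A for A :: "('k::field, 'a) module" (structure) and I
begin

abbreviation Q where "Q \<equiv> quotient_algebra A I"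

lemma carrier_quotient: "carrier Q = (\<lambda>x. I +> x) ` carrier A"
  by (auto simp: quotient_algebra_def FactRing_simps)

lemma coset_closed [simp]: "x \<in> carrier A \<Longrightarrow> I +> x \<in> carrier Q"
  by (simp add: carrier_quotient)

lemma coset_eq_iff:
  "x \<in> carrier A \<Longrightarrow> y \<in> carrier A \<Longrightarrow> I +> x = I +> y \<longleftrightarrow> x \<ominus> y \<in> I"
  using quotient_eq_iff_same_a_r_cos[OF is_ideal] by simp

lemma smult_in_ideal: "u \<in> I \<Longrightarrow> c \<odot> u \<in> I"
  using I_l_closed[of u "c \<odot> \<one>"] a_Hcarr[of u] by simp

lemma coset_add: "x \<in> carrier A \<Longrightarrow> y \<in> carrier A \<Longrightarrow> (I +> x) \<oplus>\<^bsub>Q\<^esub> (I +> y) = I +> (x \<oplus> y)"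
  by (simp add: quotient_algebra_def FactRing_def a_rcos_sum)

lemma coset_mult: "x \<in> carrier A \<Longrightarrow> y \<in> carrier A \<Longrightarrow> (I +> x) \<otimes>\<^bsub>Q\<^esub> (I +> y) = I +> (x \<otimes> y)"
  by (simp add: quotient_algebra_def FactRing_def rcoset_mult_add)

lemma coset_one: "\<one>\<^bsub>Q\<^esub> = I +> \<one>"
  by (simp add: quotient_algebra_def FactRing_def)

lemma mem_coset_iff: "x \<in> carrier A \<Longrightarrow> y \<in> I +> x \<longleftrightarrow> y \<in> carrier A \<and> I +> y = I +> x"
  using a_rcos_self[of y] a_repr_independence'[of y x] a_r_coset_subset_G[OF a_subset, of x] by blast

text \<open>The scalar multiple is a union over all representatives. As \<open>I\<close> is stable
  under scalars, every member of the union is the same coset.\<close>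

lemma coset_smult:
  assumes "x \<in> carrier A"
  shows "c \<odot>\<^bsub>Q\<^esub> (I +> x) = I +> (c \<odot> x)"
proof -
  have *: "I +> (c \<odot> y) = I +> (c \<odot> x)" if "y \<in> I +> x" for y
  proof -
    have y: "y \<in> carrier A" "y \<ominus> x \<in> I"
      using that assms by (auto simp: mem_coset_iff coset_eq_iff)
    have "c \<odot> y \<ominus> c \<odot> x = c \<odot> (y \<ominus> x)"
      using y(1) assms
      by (simp add: a_minus_def minus_eq_smult smult_right_add smult_smult)
    then show ?thesis using y assms by (simp add: coset_eq_iff smult_in_ideal)
  qed
  have "(\<Union>y\<in>I +> x. I +> (c \<odot> y)) = I +> (c \<odot> x)"
    by (rule UN_constant_eq[OF a_rcos_self[OF assms]]) (use * in blast)
  then show ?thesis by (simp add: quotient_algebra_def)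
qed

lemma k_algebra_quotient: "k_algebra Q"
proof (rule k_algebraI)
  show "ring Q"
    by (rule ring_cong[OF quotient_is_ring]) (simp_all add: quotient_algebra_def)
qed (auto simp: carrier_quotient coset_smult coset_add coset_mult smult_left_add smult_right_add
      smult_smult)

lemma linear_map_coset: "linear_map A Q (\<lambda>x. I +> x)"
  by (rule linear_mapI) (simp_all add: coset_add coset_smult)

end

section \<open>The universal property of the tensor product\<close>

definition bilinear_map ::
    "('k::field, 'a) module \<Rightarrow> ('k, 'b) module \<Rightarrow> ('k, 'u) module \<Rightarrow> ('a \<Rightarrow> 'b \<Rightarrow> 'u) \<Rightarrow> bool" where
  "bilinear_map A B U \<beta> \<longleftrightarrow>
     (\<forall>a\<in>carrier A. linear_map B U (\<beta> a)) \<and> (\<forall>b\<in>carrier B. linear_map A U (\<lambda>a. \<beta> a b))"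

lemma bilinear_mapI:
  assumes "\<And>a. a \<in> carrier A \<Longrightarrow> linear_map B U (\<beta> a)"
    and "\<And>b. b \<in> carrier B \<Longrightarrow> linear_map A U (\<lambda>a. \<beta> a b)"
  shows "bilinear_map A B U \<beta>"
  using assms by (simp add: bilinear_map_def)

lemma
  assumes "bilinear_map A B U \<beta>"
  shows bilinear_map_right: "a \<in> carrier A \<Longrightarrow> linear_map B U (\<beta> a)"
    and bilinear_map_left: "b \<in> carrier B \<Longrightarrow> linear_map A U (\<lambda>a. \<beta> a b)"
    and bilinear_map_closed: "a \<in> carrier A \<Longrightarrow> b \<in> carrier B \<Longrightarrow> \<beta> a b \<in> carrier U"
  using assms linear_map_closed by (force simp: bilinear_map_def)+

lemma bilinear_map_comp:
  "bilinear_map A B U \<beta> \<Longrightarrow> linear_map U V f \<Longrightarrow> bilinear_map A B V (\<lambda>a b. f (\<beta> a b))"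
  by (auto simp: bilinear_map_def intro: linear_map_comp[where g = f])

lemma bilinear_map_comp_args:
  assumes "bilinear_map A B U \<beta>" "linear_map A' A f" "linear_map B' B g"
  shows "bilinear_map A' B' U (\<lambda>a b. \<beta> (f a) (g b))"
proof (rule bilinear_mapI)
  show "linear_map B' U (\<lambda>b. \<beta> (f a) (g b))" if "a \<in> carrier A'" for a
    using linear_map_comp[OF assms(3) bilinear_map_right[OF assms(1) linear_map_closed[OF assms(2) that]]] .
  show "linear_map A' U (\<lambda>a. \<beta> (f a) (g b))" if "b \<in> carrier B'" for b
    using linear_map_comp[OF assms(2) bilinear_map_left[OF assms(1) linear_map_closed[OF assms(3) that]]] .
qed

lemma bilinear_map_flip: "bilinear_map A B U \<beta> \<Longrightarrow> bilinear_map B A U (\<lambda>b a. \<beta> a b)"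
  by (simp add: bilinear_map_def)

lemma bilinear_map_mult:
  assumes "k_algebra A" shows "bilinear_map A A A (mult A)"
  using linear_map_mult_left[OF assms] linear_map_mult_right[OF assms] by (intro bilinear_mapI)

lemma bilinear_map_smult:
  assumes "k_algebra A" shows "bilinear_map base_field A A (smult A)"
proof (intro bilinear_mapI)
  interpret kalg A by (rule kalg.intro) fact
  show "linear_map A A (smult A c)" for c by (rule linear_map_smult_right[OF assms])
  show "linear_map base_field A (\<lambda>c. c \<odot>\<^bsub>A\<^esub> b)" if "b \<in> carrier A" for b
    using that by (intro linear_mapI) (simp_all add: smult_left_add smult_smult)
qed

lemma bilinear_map_functionals:
  "linear_functional A f \<Longrightarrow> linear_functional B g \<Longrightarrow> bilinear_map A B base_field (\<lambda>a b. f a * g b)"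
  using bilinear_map_comp_args[OF bilinear_map_smult[OF k_algebra_base_field]] by simp

text \<open>The value of \<open>sweedler\<close> at a fixed representative. As a function on the
  free space it can be proved linear before any choice is made.\<close>

definition lin_ext :: "('k::field, 'u) module \<Rightarrow> ('a \<Rightarrow> 'b \<Rightarrow> 'u) \<Rightarrow> ('a \<times> 'b \<Rightarrow>\<^sub>0 'k) \<Rightarrow> 'u" where
  "lin_ext U \<beta> u =
     (\<Oplus>\<^bsub>U\<^esub>p\<in>Poly_Mapping.keys u. Poly_Mapping.lookup u p \<odot>\<^bsub>U\<^esub> \<beta> (fst p) (snd p))"

locale kalg_pair = A: kalg A + B: kalg B
  for A :: "('k::field, 'a) module" and B :: "('k, 'b) module"
begin

abbreviation F where "F \<equiv> monoid_algebra (A \<times>\<times> B) :: ('k, 'a \<times> 'b \<Rightarrow>\<^sub>0 'k) module"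

lemma monoid_pair: "Group.monoid (A \<times>\<times> B)"
  by (rule DirProd_monoid) unfold_locales

sublocale F: kalg F
  by (rule kalg.intro) (rule monoid.k_algebra_monoid_algebra[OF monoid_pair])

lemma lin_ext_superset:
  assumes "k_algebra U" "\<beta> \<in> carrier A \<rightarrow> carrier B \<rightarrow> carrier U"
    and "finite S" "Poly_Mapping.keys u \<subseteq> S" "S \<subseteq> carrier A \<times> carrier B"
  shows "lin_ext U \<beta> u = (\<Oplus>\<^bsub>U\<^esub>p\<in>S. Poly_Mapping.lookup u p \<odot>\<^bsub>U\<^esub> \<beta> (fst p) (snd p))"
proof -
  interpret U: kalg U by (rule kalg.intro) fact
  have \<beta>: "\<beta> (fst p) (snd p) \<in> carrier U" if "p \<in> S" for p
    using assms(2,5) that by (cases p) (auto simp: Pi_iff)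
  show ?thesis
    unfolding lin_ext_def using assms(3,4) \<beta>
    by (intro U.add.finprod_mono_neutral_cong_left) (auto simp: in_keys_iff Pi_iff)
qed

lemma linear_map_lin_ext:
  assumes U: "k_algebra U" and \<beta>: "\<beta> \<in> carrier A \<rightarrow> carrier B \<rightarrow> carrier U"
  shows "linear_map F U (lin_ext U \<beta>)"
proof -
  interpret U: kalg U by (rule kalg.intro) fact
  have \<beta>': "\<beta> (fst p) (snd p) \<in> carrier U" if "p \<in> carrier A \<times> carrier B" for p
    using \<beta> that by (cases p) (auto simp: Pi_iff)
  show ?thesis
  proof (rule linear_mapI)
    fix u assume u: "u \<in> carrier F"
    have keys: "\<beta> (fst p) (snd p) \<in> carrier U" if "p \<in> Poly_Mapping.keys u" for p
      using u that by (intro \<beta>') auto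
    show "lin_ext U \<beta> u \<in> carrier U"
      unfolding lin_ext_def by (intro U.finsum_closed) (simp_all add: Pi_iff keys)
    fix c
    have "lin_ext U \<beta> (pm_scale c u) = (\<Oplus>\<^bsub>U\<^esub>p\<in>Poly_Mapping.keys u.
        Poly_Mapping.lookup (pm_scale c u) p \<odot>\<^bsub>U\<^esub> \<beta> (fst p) (snd p))"
      using u keys_pm_scale[of c u] by (intro lin_ext_superset[OF U \<beta>]) auto
    also have "\<dots> = (\<Oplus>\<^bsub>U\<^esub>p\<in>Poly_Mapping.keys u.
        c \<odot>\<^bsub>U\<^esub> (Poly_Mapping.lookup u p \<odot>\<^bsub>U\<^esub> \<beta> (fst p) (snd p)))"
      by (intro U.finsum_cong') (simp_all add: Pi_iff U.smult_smult keys)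
    also have "\<dots> = c \<odot>\<^bsub>U\<^esub> lin_ext U \<beta> u"
      unfolding lin_ext_def
      by (intro linear_map_finsum[OF U U linear_map_smult_right[OF U], symmetric])
        (simp_all add: Pi_iff keys)
    finally show "lin_ext U \<beta> (c \<odot>\<^bsub>F\<^esub> u) = c \<odot>\<^bsub>U\<^esub> lin_ext U \<beta> u" by simp
  next
    fix u v assume uv: "u \<in> carrier F" "v \<in> carrier F"
    let ?S = "Poly_Mapping.keys u \<union> Poly_Mapping.keys v"
    have *: "lin_ext U \<beta> w = (\<Oplus>\<^bsub>U\<^esub>p\<in>?S. Poly_Mapping.lookup w p \<odot>\<^bsub>U\<^esub> \<beta> (fst p) (snd p))"
      if "Poly_Mapping.keys w \<subseteq> ?S" for w
      using uv that by (intro lin_ext_superset[OF U \<beta>]) auto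
    have S: "\<beta> (fst p) (snd p) \<in> carrier U" if "p \<in> ?S" for p
      using uv that by (intro \<beta>') auto
    have "lin_ext U \<beta> (u + v) = (\<Oplus>\<^bsub>U\<^esub>p\<in>?S.
        Poly_Mapping.lookup u p \<odot>\<^bsub>U\<^esub> \<beta> (fst p) (snd p) \<oplus>\<^bsub>U\<^esub>
        Poly_Mapping.lookup v p \<odot>\<^bsub>U\<^esub> \<beta> (fst p) (snd p))"
      unfolding *[OF Poly_Mapping.keys_add] using S
      by (intro U.finsum_cong') (auto simp: Pi_iff lookup_add U.smult_left_add)
    also have "\<dots> = lin_ext U \<beta> u \<oplus>\<^bsub>U\<^esub> lin_ext U \<beta> v"
      unfolding *[OF Un_upper1] *[OF Un_upper2] using S
      by (intro U.finsum_addf) (auto simp: Pi_iff)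
    finally show "lin_ext U \<beta> (u \<oplus>\<^bsub>F\<^esub> v) = lin_ext U \<beta> u \<oplus>\<^bsub>U\<^esub> lin_ext U \<beta> v" by simp
  qed
qed

lemma lin_ext_single:
  assumes U: "k_algebra U" and \<beta>: "\<beta> \<in> carrier A \<rightarrow> carrier B \<rightarrow> carrier U"
    and "a \<in> carrier A" "b \<in> carrier B"
  shows "lin_ext U \<beta> (Poly_Mapping.single (a, b) c) = c \<odot>\<^bsub>U\<^esub> \<beta> a b"
proof -
  interpret U: kalg U by (rule kalg.intro) fact
  have "\<beta> a b \<in> carrier U" using \<beta> assms(3,4) by (auto simp: Pi_iff)
  moreover have "lin_ext U \<beta> (Poly_Mapping.single (a, b) c) = (\<Oplus>\<^bsub>U\<^esub>p\<in>{(a, b)}.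
      Poly_Mapping.lookup (Poly_Mapping.single (a, b) c) p \<odot>\<^bsub>U\<^esub> \<beta> (fst p) (snd p))"
    using assms(3,4) by (intro lin_ext_superset[OF U \<beta>]) auto
  ultimately show ?thesis by simp
qed

end

declare monoid_algebra_simps(1) [simp del] single_in_monoid_algebra [simp]

context kalg_pair
begin

lemma F_diff: "u \<in> carrier F \<Longrightarrow> v \<in> carrier F \<Longrightarrow> u \<ominus>\<^bsub>F\<^esub> v = u - v"
  using F.minus_eq_smult[of v] pm.scale_minus_left[of 1 v] by (simp add: a_minus_def)

lemma subspace_F: "pm.subspace (carrier F)"
  unfolding pm.subspace_def
proof (intro conjI ballI allI)
  show "0 \<in> carrier F" using F.zero_closed by simp
  show "u + v \<in> carrier F" if "u \<in> carrier F" "v \<in> carrier F" for u v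
    using F.a_closed[OF that] by simp
  show "pm_scale c u \<in> carrier F" if "u \<in> carrier F" for c u
    using F.smult_closed'[OF that, of c] by simp
qed

lemma diff_in_F: "u \<in> carrier F \<Longrightarrow> v \<in> carrier F \<Longrightarrow> u - v \<in> carrier F"
  by (rule pm.subspace_diff[OF subspace_F])

lemma relations_in_F: "tensor_relations A B \<subseteq> carrier F"
  unfolding tensor_relations_def
  by (auto intro!: diff_in_F single_in_monoid_algebra)

lemma kernel_in_F: "tensor_kernel A B \<subseteq> carrier F"
  by (rule pm.span_minimal[OF relations_in_F subspace_F])

lemma linear_map_diff:
  assumes "k_algebra U" "linear_map F U f" "u \<in> carrier F" "v \<in> carrier F"
  shows "f (u - v) = f u \<ominus>\<^bsub>U\<^esub> f v"
proof -
  interpret U: kalg U by (rule kalg.intro) fact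
  have "f u = f (u - v) \<oplus>\<^bsub>U\<^esub> f v"
    using linear_map_add[OF assms(2) diff_in_F[OF assms(3,4)] assms(4)] by simp
  then show ?thesis
    using linear_map_closed[OF assms(2)] assms(3,4) diff_in_F[OF assms(3,4)]
    by (simp add: a_minus_def U.a_assoc U.r_neg)
qed

lemma subspace_kernel:
  assumes "k_algebra U" "linear_map F U f"
  shows "pm.subspace {u \<in> carrier F. f u = \<zero>\<^bsub>U\<^esub>}"
proof -
  interpret U: kalg U by (rule kalg.intro) fact
  have "f (u + v) = \<zero>\<^bsub>U\<^esub>"
    if "u \<in> carrier F" "v \<in> carrier F" "f u = \<zero>\<^bsub>U\<^esub>" "f v = \<zero>\<^bsub>U\<^esub>" for u v
    using linear_map_add[OF assms(2) that(1,2)] that(3,4) by simp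
  moreover have "f (pm_scale c u) = \<zero>\<^bsub>U\<^esub>" if "u \<in> carrier F" "f u = \<zero>\<^bsub>U\<^esub>" for c u
    using linear_map_smult[OF assms(2) that(1)] that(2) by simp
  moreover have "f 0 = \<zero>\<^bsub>U\<^esub>"
    using linear_map_zero[OF F.k_algebra assms] by simp
  ultimately show ?thesis
    using subspace_F unfolding pm.subspace_def by blast
qed

text \<open>Each relation expresses one clause of bilinearity and so goes to zero; the zeros of a
  linear map form a subspace, which then contains the whole span.\<close>

lemma lin_ext_kernel:
  assumes U: "k_algebra U" and \<beta>: "bilinear_map A B U \<beta>" and "u \<in> tensor_kernel A B"
  shows "lin_ext U \<beta> u = \<zero>\<^bsub>U\<^esub>"
proof -
  interpret U: kalg U by (rule kalg.intro) fact
  have \<beta>': "\<beta> \<in> carrier A \<rightarrow> carrier B \<rightarrow> carrier U"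
    using bilinear_map_closed[OF \<beta>] by auto
  note lin = linear_map_lin_ext[OF U \<beta>']
  note diff = linear_map_diff[OF U lin]
  note [simp] = lin_ext_single[OF U \<beta>'] bilinear_map_closed[OF \<beta>]
    linear_map_add[OF bilinear_map_right[OF \<beta>]] linear_map_smult[OF bilinear_map_right[OF \<beta>]]
    linear_map_add[OF bilinear_map_left[OF \<beta>]] linear_map_smult[OF bilinear_map_left[OF \<beta>]]
  have cancel: "u \<oplus>\<^bsub>U\<^esub> (v \<oplus>\<^bsub>U\<^esub> (\<ominus>\<^bsub>U\<^esub> u \<oplus>\<^bsub>U\<^esub> \<ominus>\<^bsub>U\<^esub> v)) = \<zero>\<^bsub>U\<^esub>"
    if "u \<in> carrier U" "v \<in> carrier U" for u v
    using that by (simp add: U.a_lcomm[of v "\<ominus>\<^bsub>U\<^esub> u"] U.r_neg)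
  have "lin_ext U \<beta> r = \<zero>\<^bsub>U\<^esub>" if "r \<in> tensor_relations A B" for r
    using that unfolding tensor_relations_def
    by (auto simp: diff diff_in_F single_in_monoid_algebra a_minus_def U.a_assoc U.r_neg cancel)
  then have "tensor_relations A B \<subseteq> {u \<in> carrier F. lin_ext U \<beta> u = \<zero>\<^bsub>U\<^esub>}"
    using relations_in_F by auto
  from pm.span_minimal[OF this subspace_kernel[OF U lin]] assms(3) show ?thesis by auto
qed

text \<open>Multiplying a relation by a pair \<open>(a, b)\<close> gives a relation of the same
  shape with multiplied entries, scaled by \<open>c\<close>. Hence the span is an ideal and products
  of tensors make sense.\<close>

lemma single_mult_kernel:
  assumes "a \<in> carrier A" "b \<in> carrier B" "u \<in> tensor_kernel A B"
  shows "Poly_Mapping.single (a, b) c \<otimes>\<^bsub>F\<^esub> u \<in> tensor_kernel A B"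
    and "u \<otimes>\<^bsub>F\<^esub> Poly_Mapping.single (a, b) c \<in> tensor_kernel A B"
proof -
  let ?K = "tensor_kernel A B" and ?s = "Poly_Mapping.single (a, b) c"
  have rel: "Poly_Mapping.single (a \<oplus>\<^bsub>A\<^esub> a', b) d - Poly_Mapping.single (a, b) d
        - Poly_Mapping.single (a', b) d \<in> ?K"
    if "a \<in> carrier A" "a' \<in> carrier A" "b \<in> carrier B" for a a' b d
  proof -
    have "Poly_Mapping.single (a \<oplus>\<^bsub>A\<^esub> a', b) 1 - Poly_Mapping.single (a, b) 1
        - Poly_Mapping.single (a', b) 1 \<in> ?K"
      using that by (intro pm.span_base) (auto simp: tensor_relations_def)
    from pm.span_scale[OF this, of d] show ?thesis
      by (simp add: pm.scale_right_diff_distrib)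
  qed
  moreover have "Poly_Mapping.single (a, b \<oplus>\<^bsub>B\<^esub> b') d - Poly_Mapping.single (a, b) d
        - Poly_Mapping.single (a, b') d \<in> ?K"
    if "a \<in> carrier A" "b \<in> carrier B" "b' \<in> carrier B" for a b b' d
  proof -
    have "Poly_Mapping.single (a, b \<oplus>\<^bsub>B\<^esub> b') 1 - Poly_Mapping.single (a, b) 1
        - Poly_Mapping.single (a, b') 1 \<in> ?K"
      using that by (intro pm.span_base) (auto simp: tensor_relations_def)
    from pm.span_scale[OF this, of d] show ?thesis
      by (simp add: pm.scale_right_diff_distrib)
  qed
  moreover have "Poly_Mapping.single (e \<odot>\<^bsub>A\<^esub> a, b) d - Poly_Mapping.single (a, b) (d * e) \<in> ?K"
    if "a \<in> carrier A" "b \<in> carrier B" for a b d e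
  proof -
    have "Poly_Mapping.single (e \<odot>\<^bsub>A\<^esub> a, b) 1 - Poly_Mapping.single (a, b) e \<in> ?K"
      using that by (intro pm.span_base) (auto simp: tensor_relations_def)
    from pm.span_scale[OF this, of d] show ?thesis
      by (simp add: pm.scale_right_diff_distrib)
  qed
  moreover have "Poly_Mapping.single (a, e \<odot>\<^bsub>B\<^esub> b) d - Poly_Mapping.single (a, b) (d * e) \<in> ?K"
    if "a \<in> carrier A" "b \<in> carrier B" for a b d e
  proof -
    have "Poly_Mapping.single (a, e \<odot>\<^bsub>B\<^esub> b) 1 - Poly_Mapping.single (a, b) e \<in> ?K"
      using that by (intro pm.span_base) (auto simp: tensor_relations_def)
    from pm.span_scale[OF this, of d] show ?thesis
      by (simp add: pm.scale_right_diff_distrib)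
  qed
  moreover have mult_diff: "w \<otimes>\<^bsub>F\<^esub> (u - v) = w \<otimes>\<^bsub>F\<^esub> u - w \<otimes>\<^bsub>F\<^esub> v"
    "(u - v) \<otimes>\<^bsub>F\<^esub> w = u \<otimes>\<^bsub>F\<^esub> w - v \<otimes>\<^bsub>F\<^esub> w" for u v w
    using monoid_algebra_mult_add_right[of "A \<times>\<times> B" w "u - v" v]
      monoid_algebra_mult_add_left[of "A \<times>\<times> B" "u - v" v w] by (simp_all add: eq_diff_eq)
  ultimately have base: "?s \<otimes>\<^bsub>F\<^esub> r \<in> ?K \<and> r \<otimes>\<^bsub>F\<^esub> ?s \<in> ?K" if "r \<in> tensor_relations A B" for r
    using that assms(1,2) unfolding tensor_relations_def
    by (auto simp: A.r_distr A.l_distr B.r_distr B.l_distr mult.commute[of _ c])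
  have "?s \<otimes>\<^bsub>F\<^esub> u \<in> ?K \<and> u \<otimes>\<^bsub>F\<^esub> ?s \<in> ?K"
    using assms(3)
  proof (induction u rule: pm.span_induct_alt)
    case base
    then show ?case by (simp add: pm.span_zero)
  next
    case (step d r v)
    then show ?case
      using base[of r]
      by (simp add: monoid_algebra_mult_add_left monoid_algebra_mult_add_right
          monoid_algebra_mult_scale_left monoid_algebra_mult_scale_right pm.span_add pm.span_scale)
  qed
  then show "?s \<otimes>\<^bsub>F\<^esub> u \<in> ?K" "u \<otimes>\<^bsub>F\<^esub> ?s \<in> ?K" by auto
qed

lemma F_induct [consumes 1, case_names zero single add]:
  assumes "u \<in> carrier F"
    and "P 0"
    and "\<And>a b c. a \<in> carrier A \<Longrightarrow> b \<in> carrier B \<Longrightarrow> P (Poly_Mapping.single (a, b) c)"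
    and "\<And>v w. v \<in> carrier F \<Longrightarrow> w \<in> carrier F \<Longrightarrow> P v \<Longrightarrow> P w \<Longrightarrow> P (v + w)"
  shows "P u"
proof -
  have "Poly_Mapping.keys u \<subseteq> carrier A \<times> carrier B"
    using assms(1) by (simp add: monoid_algebra_simps(1))
  then show ?thesis
  proof (induction u rule: poly_mapping_induct_keys)
    case (single p c)
    then show ?case using assms(3)[of "fst p" "snd p" c] by (cases p) simp
  next
    case (add v w)
    then show ?case using assms(4) by (simp add: monoid_algebra_simps(1))
  qed (rule assms(2))
qed

lemma ideal_kernel: "ideal (tensor_kernel A B) F"
proof (rule idealI)
  show "subgroup (tensor_kernel A B) (add_monoid F)"
  proof (rule F.add.subgroupI)
    show "tensor_kernel A B \<subseteq> carrier F" by (rule kernel_in_F)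
    show "tensor_kernel A B \<noteq> {}" using pm.span_zero by blast
    show "\<ominus>\<^bsub>F\<^esub> u \<in> tensor_kernel A B" if "u \<in> tensor_kernel A B" for u
      using that kernel_in_F pm.span_scale[OF that, of "-1"] F.minus_eq_smult[of u] by auto
    show "u \<oplus>\<^bsub>F\<^esub> v \<in> tensor_kernel A B" if "u \<in> tensor_kernel A B" "v \<in> tensor_kernel A B" for u v
      using pm.span_add[OF that] by simp
  qed
  fix u v assume u: "u \<in> tensor_kernel A B" and v: "v \<in> carrier F"
  from v have "v \<otimes>\<^bsub>F\<^esub> u \<in> tensor_kernel A B \<and> u \<otimes>\<^bsub>F\<^esub> v \<in> tensor_kernel A B"
    by (induction v rule: F_induct)
      (auto simp: u single_mult_kernel pm.span_zero monoid_algebra_mult_add_left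
        monoid_algebra_mult_add_right intro: pm.span_add)
  then show "v \<otimes>\<^bsub>F\<^esub> u \<in> tensor_kernel A B" "u \<otimes>\<^bsub>F\<^esub> v \<in> tensor_kernel A B" by auto
qed (rule F.ring_axioms)

sublocale T: kalg_ideal F "tensor_kernel A B"
  by (intro kalg_ideal.intro F.kalg_axioms ideal_kernel)

lemma k_algebra_tensor: "k_algebra (tensor A B)"
  unfolding tensor_def by (rule T.k_algebra_quotient)

sublocale AB: kalg "tensor A B"
  by (rule kalg.intro) (rule k_algebra_tensor)

lemma tensor_cases:
  assumes "X \<in> carrier (tensor A B)"
  obtains u where "u \<in> carrier F" "X = tensor_kernel A B +>\<^bsub>F\<^esub> u"
  using assms unfolding tensor_def T.carrier_quotient by blast

lemma pure_tensor_closed [simp]: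
  "a \<in> carrier A \<Longrightarrow> b \<in> carrier B \<Longrightarrow> pure_tensor A B a b \<in> carrier (tensor A B)"
  unfolding pure_tensor_def tensor_def by (intro T.coset_closed single_in_monoid_algebra) simp

lemma coset_single:
  "a \<in> carrier A \<Longrightarrow> b \<in> carrier B \<Longrightarrow>
   tensor_kernel A B +>\<^bsub>F\<^esub> Poly_Mapping.single (a, b) c = c \<odot>\<^bsub>tensor A B\<^esub> pure_tensor A B a b"
  by (simp add: pure_tensor_def tensor_def T.coset_smult)

lemma linear_map_tensor_coset: "linear_map F (tensor A B) (\<lambda>u. tensor_kernel A B +>\<^bsub>F\<^esub> u)"
  unfolding tensor_def by (rule T.linear_map_coset)

text \<open>Pure tensors span. This uniqueness half of the universal property replaces the choice of
  representatives in the later comparisons of linear maps.\<close>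

lemma tensor_ext:
  assumes "k_algebra U" "linear_map (tensor A B) U f" "linear_map (tensor A B) U g"
    and "\<And>a b. a \<in> carrier A \<Longrightarrow> b \<in> carrier B \<Longrightarrow> f (pure_tensor A B a b) = g (pure_tensor A B a b)"
    and "X \<in> carrier (tensor A B)"
  shows "f X = g X"
proof -
  obtain u where u: "u \<in> carrier F" "X = tensor_kernel A B +>\<^bsub>F\<^esub> u"
    using assms(5) by (rule tensor_cases)
  note lin = linear_map_comp[OF linear_map_tensor_coset assms(2)] linear_map_comp[OF linear_map_tensor_coset assms(3)]
  from u(1) have "f (tensor_kernel A B +>\<^bsub>F\<^esub> u) = g (tensor_kernel A B +>\<^bsub>F\<^esub> u)"
  proof (induction u rule: F_induct)
    case zero
    then show ?case using lin[THEN linear_map_zero[OF F.k_algebra assms(1)]] by simp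
  next
    case (single a b c)
    then show ?case
      using assms(4) linear_map_smult[OF assms(2)] linear_map_smult[OF assms(3)]
      by (simp add: coset_single)
  next
    case (add v w)
    then show ?case using lin[THEN linear_map_add, OF add(1,2)] by simp
  qed
  then show ?thesis by (simp add: u(2))
qed

text \<open>Two representatives differ by an element of \<open>tensor_kernel\<close>, where
  \<open>lin_ext\<close> vanishes, so the choice inside \<open>sweedler\<close> does not affect the
  value.\<close>

lemma sweedler_coset:
  assumes U: "k_algebra U" and \<beta>: "bilinear_map A B U \<beta>" and u: "u \<in> carrier F"
  shows "sweedler U \<beta> (tensor_kernel A B +>\<^bsub>F\<^esub> u) = lin_ext U \<beta> u"
proof -
  interpret U: kalg U by (rule kalg.intro) fact
  have "\<beta> \<in> carrier A \<rightarrow> carrier B \<rightarrow> carrier U"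
    using bilinear_map_closed[OF \<beta>] by auto
  note lin = linear_map_lin_ext[OF U this]
  define v where "v = (SOME v. v \<in> tensor_kernel A B +>\<^bsub>F\<^esub> u)"
  have "v \<in> tensor_kernel A B +>\<^bsub>F\<^esub> u"
    unfolding v_def by (rule someI, rule T.a_rcos_self[OF u])
  then have v: "v \<in> carrier F" "v - u \<in> tensor_kernel A B"
    using u by (auto simp: T.mem_coset_iff T.coset_eq_iff F_diff)
  have "lin_ext U \<beta> v = lin_ext U \<beta> (v - u) \<oplus>\<^bsub>U\<^esub> lin_ext U \<beta> u"
    using linear_map_add[OF lin diff_in_F[OF v(1) u] u] by simp
  also have "\<dots> = lin_ext U \<beta> u"
    using linear_map_closed[OF lin u] by (simp add: lin_ext_kernel[OF U \<beta> v(2)])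
  finally have "lin_ext U \<beta> v = lin_ext U \<beta> u" .
  then show ?thesis by (simp add: sweedler_def lin_ext_def v_def)
qed

lemma linear_map_sweedler:
  assumes U: "k_algebra U" and \<beta>: "bilinear_map A B U \<beta>"
  shows "linear_map (tensor A B) U (sweedler U \<beta>)"
proof -
  have "\<beta> \<in> carrier A \<rightarrow> carrier B \<rightarrow> carrier U"
    using bilinear_map_closed[OF \<beta>] by auto
  note lin = linear_map_lin_ext[OF U this]
  show ?thesis
  proof (rule linear_mapI)
    fix X assume "X \<in> carrier (tensor A B)"
    then obtain u where u: "u \<in> carrier F" "X = tensor_kernel A B +>\<^bsub>F\<^esub> u" by (rule tensor_cases)
    then show "sweedler U \<beta> X \<in> carrier U"
      using linear_map_closed[OF lin] by (simp add: sweedler_coset[OF U \<beta>])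
    fix c
    have "c \<odot>\<^bsub>tensor A B\<^esub> X = tensor_kernel A B +>\<^bsub>F\<^esub> (c \<odot>\<^bsub>F\<^esub> u)"
      unfolding tensor_def u(2) by (rule T.coset_smult[OF u(1)])
    then show "sweedler U \<beta> (c \<odot>\<^bsub>tensor A B\<^esub> X) = c \<odot>\<^bsub>U\<^esub> sweedler U \<beta> X"
      using linear_map_smult[OF lin u(1)] F.smult_closed'[OF u(1), of c] u
      by (simp add: sweedler_coset[OF U \<beta>])
  next
    fix X Y assume X: "X \<in> carrier (tensor A B)" and Y: "Y \<in> carrier (tensor A B)"
    obtain u where u: "u \<in> carrier F" "X = tensor_kernel A B +>\<^bsub>F\<^esub> u"
      using X by (rule tensor_cases)
    obtain v where v: "v \<in> carrier F" "Y = tensor_kernel A B +>\<^bsub>F\<^esub> v"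
      using Y by (rule tensor_cases)
    have "X \<oplus>\<^bsub>tensor A B\<^esub> Y = tensor_kernel A B +>\<^bsub>F\<^esub> (u \<oplus>\<^bsub>F\<^esub> v)"
      unfolding tensor_def u(2) v(2) by (rule T.coset_add[OF u(1) v(1)])
    then show "sweedler U \<beta> (X \<oplus>\<^bsub>tensor A B\<^esub> Y) = sweedler U \<beta> X \<oplus>\<^bsub>U\<^esub> sweedler U \<beta> Y"
      using linear_map_add[OF lin u(1) v(1)] F.a_closed[OF u(1) v(1)] u v
      by (simp add: sweedler_coset[OF U \<beta>])
  qed
qed

lemma sweedler_pure:
  assumes U: "k_algebra U" and \<beta>: "bilinear_map A B U \<beta>" and ab: "a \<in> carrier A" "b \<in> carrier B"
  shows "sweedler U \<beta> (pure_tensor A B a b) = \<beta> a b"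
proof -
  interpret U: kalg U by (rule kalg.intro) fact
  have "\<beta> \<in> carrier A \<rightarrow> carrier B \<rightarrow> carrier U"
    using bilinear_map_closed[OF \<beta>] by auto
  from lin_ext_single[OF U this ab, of 1] show ?thesis
    using ab bilinear_map_closed[OF \<beta> ab] by (simp add: pure_tensor_def sweedler_coset[OF U \<beta>])
qed

lemma linear_map_sweedler_comp:
  assumes U: "k_algebra U" and V: "k_algebra V" and \<beta>: "bilinear_map A B U \<beta>" and f: "linear_map U V f"
    and X: "X \<in> carrier (tensor A B)"
  shows "f (sweedler U \<beta> X) = sweedler V (\<lambda>a b. f (\<beta> a b)) X"
proof -
  note \<gamma> = bilinear_map_comp[OF \<beta> f]
  show ?thesis
    using sweedler_pure[OF U \<beta>] sweedler_pure[OF V \<gamma>]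
    by (intro tensor_ext[OF V linear_map_comp[OF linear_map_sweedler[OF U \<beta>] f]
      linear_map_sweedler[OF V \<gamma>] _ X]) simp
qed

text \<open>The integrands agree on the carriers only and need not be equal as functions.
  Bilinearity passes from \<open>\<beta>\<close> to \<open>\<gamma>\<close>, after which both sums
  are linear and are compared on pure tensors.\<close>

lemma sweedler_cong:
  assumes U: "k_algebra U" and \<beta>: "bilinear_map A B U \<beta>"
    and eq: "\<And>a b. a \<in> carrier A \<Longrightarrow> b \<in> carrier B \<Longrightarrow> \<beta> a b = \<gamma> a b"
    and X: "X \<in> carrier (tensor A B)"
  shows "sweedler U \<beta> X = sweedler U \<gamma> X"
proof -
  interpret U: kalg U by (rule kalg.intro) fact
  obtain u where u: "u \<in> carrier F" "X = tensor_kernel A B +>\<^bsub>F\<^esub> u"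
    using X by (rule tensor_cases)
  have \<gamma>: "bilinear_map A B U \<gamma>"
  proof (rule bilinear_mapI)
    fix a assume a: "a \<in> carrier A"
    from bilinear_map_right[OF \<beta> a] a show "linear_map B U (\<gamma> a)"
      by (simp add: linear_map_def eq[OF a, symmetric] Pi_iff)
  next
    fix b assume b: "b \<in> carrier B"
    from bilinear_map_left[OF \<beta> b] b show "linear_map A U (\<lambda>a. \<gamma> a b)"
      by (simp add: linear_map_def eq[OF _ b, symmetric] Pi_iff)
  qed
  show ?thesis
    by (rule tensor_ext[OF U linear_map_sweedler[OF U \<beta>] linear_map_sweedler[OF U \<gamma>] _ X])
      (simp add: sweedler_pure[OF U] \<beta> \<gamma> eq)
qed

text \<open>Contracting the first leg with \<open>f\<close> and testing the rest with
  \<open>h\<close> is pairing with \<open>f \<otimes> h\<close>. This turns equations about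
  \<open>\<Sum> f(t1) t2\<close> into scalar ones.\<close>

lemma functional_slice_left:
  assumes f: "linear_functional A f" and h: "linear_functional B h" and X: "X \<in> carrier (tensor A B)"
  shows "h (sweedler B (\<lambda>a b. f a \<odot>\<^bsub>B\<^esub> b) X) = sweedler base_field (\<lambda>a b. f a * h b) X"
proof -
  have \<beta>: "bilinear_map A B B (\<lambda>a b. f a \<odot>\<^bsub>B\<^esub> b)"
    using bilinear_map_comp_args[OF bilinear_map_smult[OF B.k_algebra] f linear_map_id] .
  have "h (sweedler B (\<lambda>a b. f a \<odot>\<^bsub>B\<^esub> b) X) = sweedler base_field (\<lambda>a b. h (f a \<odot>\<^bsub>B\<^esub> b)) X"
    by (rule linear_map_sweedler_comp[OF B.k_algebra k_algebra_base_field \<beta> h X])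
  also have "\<dots> = sweedler base_field (\<lambda>a b. f a * h b) X"
    by (rule sweedler_cong[OF k_algebra_base_field bilinear_map_comp[OF \<beta> h] _ X])
      (simp add: linear_map_smult[OF h])
  finally show ?thesis .
qed

lemma functional_slice_right:
  assumes f: "linear_functional B f" and h: "linear_functional A h" and X: "X \<in> carrier (tensor A B)"
  shows "h (sweedler A (\<lambda>a b. f b \<odot>\<^bsub>A\<^esub> a) X) = sweedler base_field (\<lambda>a b. h a * f b) X"
proof -
  have \<beta>: "bilinear_map A B A (\<lambda>a b. f b \<odot>\<^bsub>A\<^esub> a)"
    using bilinear_map_flip[OF bilinear_map_comp_args[OF bilinear_map_smult[OF A.k_algebra] f linear_map_id]] .
  have "h (sweedler A (\<lambda>a b. f b \<odot>\<^bsub>A\<^esub> a) X) = sweedler base_field (\<lambda>a b. h (f b \<odot>\<^bsub>A\<^esub> a)) X"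
    by (rule linear_map_sweedler_comp[OF A.k_algebra k_algebra_base_field \<beta> h X])
  also have "\<dots> = sweedler base_field (\<lambda>a b. h a * f b) X"
    by (rule sweedler_cong[OF k_algebra_base_field bilinear_map_comp[OF \<beta> h] _ X])
      (simp add: linear_map_smult[OF h] mult.commute)
  finally show ?thesis .
qed

lemma bilinear_map_pure_tensor: "bilinear_map A B (tensor A B) (pure_tensor A B)"
proof -
  let ?K = "tensor_kernel A B"
  have add: "?K +>\<^bsub>F\<^esub> u = (?K +>\<^bsub>F\<^esub> v) \<oplus>\<^bsub>tensor A B\<^esub> (?K +>\<^bsub>F\<^esub> w)"
    if "u - v - w \<in> tensor_relations A B" "u \<in> carrier F" "v \<in> carrier F" "w \<in> carrier F" for u v w
  proof -
    have "u \<ominus>\<^bsub>F\<^esub> (v \<oplus>\<^bsub>F\<^esub> w) = u - v - w"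
      using that F.a_closed[OF that(3,4)] by (simp add: F_diff)
    then show ?thesis
      unfolding tensor_def using that pm.span_base[OF that(1)] F.a_closed[OF that(3,4)]
      by (subst T.coset_add) (simp_all add: T.coset_eq_iff)
  qed
  have smult: "?K +>\<^bsub>F\<^esub> u = c \<odot>\<^bsub>tensor A B\<^esub> (?K +>\<^bsub>F\<^esub> v)"
    if "u - pm_scale c v \<in> tensor_relations A B" "u \<in> carrier F" "v \<in> carrier F" for u v c
  proof -
    have "u \<ominus>\<^bsub>F\<^esub> (c \<odot>\<^bsub>F\<^esub> v) = u - pm_scale c v"
      using that F.smult_closed'[OF that(3), of c] by (simp add: F_diff)
    then show ?thesis
      unfolding tensor_def using that pm.span_base[OF that(1)] F.smult_closed'[OF that(3), of c]
      by (subst T.coset_smult) (simp_all add: T.coset_eq_iff)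
  qed
  show ?thesis
  proof (intro bilinear_mapI linear_mapI)
    fix a b b' c assume ab: "a \<in> carrier A" "b \<in> carrier B"
    then show "pure_tensor A B a b \<in> carrier (tensor A B)" by simp
    show "pure_tensor A B a (c \<odot>\<^bsub>B\<^esub> b) = c \<odot>\<^bsub>tensor A B\<^esub> pure_tensor A B a b"
      unfolding pure_tensor_def by (rule smult) (use ab in \<open>auto simp: tensor_relations_def\<close>)
    assume "b' \<in> carrier B"
    with ab show "pure_tensor A B a (b \<oplus>\<^bsub>B\<^esub> b') =
        pure_tensor A B a b \<oplus>\<^bsub>tensor A B\<^esub> pure_tensor A B a b'"
      unfolding pure_tensor_def by (intro add) (auto simp: tensor_relations_def)
  next
    fix a b a' c assume ab: "b \<in> carrier B" "a \<in> carrier A"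
    then show "pure_tensor A B a b \<in> carrier (tensor A B)" by simp
    show "pure_tensor A B (c \<odot>\<^bsub>A\<^esub> a) b = c \<odot>\<^bsub>tensor A B\<^esub> pure_tensor A B a b"
      unfolding pure_tensor_def by (rule smult) (use ab in \<open>auto simp: tensor_relations_def\<close>)
    assume "a' \<in> carrier A"
    with ab show "pure_tensor A B (a \<oplus>\<^bsub>A\<^esub> a') b =
        pure_tensor A B a b \<oplus>\<^bsub>tensor A B\<^esub> pure_tensor A B a' b"
      unfolding pure_tensor_def by (intro add) (auto simp: tensor_relations_def)
  qed
qed

lemma pure_tensor_mult:
  assumes "a \<in> carrier A" "b \<in> carrier B" "a' \<in> carrier A" "b' \<in> carrier B"
  shows "pure_tensor A B a b \<otimes>\<^bsub>tensor A B\<^esub> pure_tensor A B a' b' =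
    pure_tensor A B (a \<otimes>\<^bsub>A\<^esub> a') (b \<otimes>\<^bsub>B\<^esub> b')"
  using assms by (simp add: pure_tensor_def tensor_def T.coset_mult)

lemma tensor_one: "\<one>\<^bsub>tensor A B\<^esub> = pure_tensor A B \<one>\<^bsub>A\<^esub> \<one>\<^bsub>B\<^esub>"
  by (simp add: pure_tensor_def tensor_def T.coset_one)

text \<open>A tensor is recovered from its slices,
  \<open>X = \<Sum> e i \<otimes> (c i \<otimes> id) X\<close>, as one sees on pure tensors; slices
  with equal values under the separating family \<open>G\<close> coincide. A basis is asked of the
  left factor alone, so the right one may itself be a tensor product.\<close>

lemma tensor_separated:
  assumes "finite I" "\<And>i. i \<in> I \<Longrightarrow> e i \<in> carrier A" "\<And>i. i \<in> I \<Longrightarrow> linear_functional A (c i)"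
    and basis: "\<And>a. a \<in> carrier A \<Longrightarrow> a = (\<Oplus>\<^bsub>A\<^esub>i\<in>I. c i a \<odot>\<^bsub>A\<^esub> e i)"
    and G: "\<And>g. g \<in> G \<Longrightarrow> linear_functional B g"
    and sep: "\<And>b b'. b \<in> carrier B \<Longrightarrow> b' \<in> carrier B \<Longrightarrow> (\<And>g. g \<in> G \<Longrightarrow> g b = g b') \<Longrightarrow> b = b'"
    and X: "X \<in> carrier (tensor A B)" and Y: "Y \<in> carrier (tensor A B)"
    and eq: "\<And>i g. i \<in> I \<Longrightarrow> g \<in> G \<Longrightarrow>
      sweedler base_field (\<lambda>a b. c i a * g b) X = sweedler base_field (\<lambda>a b. c i a * g b) Y"
  shows "X = Y"
proof -
  note p = bilinear_map_pure_tensor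
  have slice: "bilinear_map A B B (\<lambda>a b. c i a \<odot>\<^bsub>B\<^esub> b)" if "i \<in> I" for i
    using bilinear_map_comp_args[OF bilinear_map_smult[OF B.k_algebra] assms(3)[OF that] linear_map_id] .
  define s where "s = (\<lambda>X i. sweedler B (\<lambda>a b. c i a \<odot>\<^bsub>B\<^esub> b) X)"
  have lin_s: "linear_map (tensor A B) B (\<lambda>X. s X i)" if "i \<in> I" for i
    unfolding s_def using linear_map_sweedler[OF B.k_algebra slice[OF that]] .
  have lin_ps: "linear_map (tensor A B) (tensor A B) (\<lambda>X. pure_tensor A B (e i) (s X i))" if "i \<in> I" for i
    using linear_map_comp[OF lin_s[OF that] bilinear_map_right[OF p assms(2)[OF that]]] .
  have lin_sum: "linear_map (tensor A B) (tensor A B) (\<lambda>X. \<Oplus>\<^bsub>tensor A B\<^esub>i\<in>J. pure_tensor A B (e i) (s X i))"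
    if "finite J" "J \<subseteq> I" for J
    using that
  proof (induction J)
    case empty
    show ?case by (rule linear_mapI) simp_all
  next
    case (insert j J)
    then have "linear_map (tensor A B) (tensor A B)
      (\<lambda>X. pure_tensor A B (e j) (s X j) \<oplus>\<^bsub>tensor A B\<^esub> (\<Oplus>\<^bsub>tensor A B\<^esub>i\<in>J. pure_tensor A B (e i) (s X i)))"
      by (intro linear_map_sum[OF k_algebra_tensor lin_ps]) simp_all
    moreover have "(\<Oplus>\<^bsub>tensor A B\<^esub>i\<in>insert j J. pure_tensor A B (e i) (s X i)) =
      pure_tensor A B (e j) (s X j) \<oplus>\<^bsub>tensor A B\<^esub> (\<Oplus>\<^bsub>tensor A B\<^esub>i\<in>J. pure_tensor A B (e i) (s X i))"
      if "X \<in> carrier (tensor A B)" for X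
      using insert that linear_map_closed[OF lin_ps] by (intro AB.finsum_insert) (auto simp: Pi_iff)
    ultimately show ?case by (simp add: linear_map_def Pi_iff)
  qed
  have expand: "Z = (\<Oplus>\<^bsub>tensor A B\<^esub>i\<in>I. pure_tensor A B (e i) (s Z i))" if "Z \<in> carrier (tensor A B)" for Z
  proof (rule tensor_ext[OF k_algebra_tensor linear_map_id lin_sum[OF assms(1) order.refl] _ that])
    fix a b assume ab: "a \<in> carrier A" "b \<in> carrier B"
    have ca: "c i a \<odot>\<^bsub>A\<^esub> e i \<in> carrier A" if "i \<in> I" for i using assms(2)[OF that] by simp
    have "pure_tensor A B a b = pure_tensor A B (\<Oplus>\<^bsub>A\<^esub>i\<in>I. c i a \<odot>\<^bsub>A\<^esub> e i) b"
      using basis[OF ab(1)] by simp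
    also have "\<dots> = (\<Oplus>\<^bsub>tensor A B\<^esub>i\<in>I. pure_tensor A B (c i a \<odot>\<^bsub>A\<^esub> e i) b)"
      using ca by (intro linear_map_finsum[OF A.k_algebra k_algebra_tensor bilinear_map_left[OF p ab(2)] assms(1)]) auto
    also have "\<dots> = (\<Oplus>\<^bsub>tensor A B\<^esub>i\<in>I. pure_tensor A B (e i) (s (pure_tensor A B a b) i))"
    proof (rule AB.finsum_cong')
      fix i assume i: "i \<in> I"
      show "pure_tensor A B (c i a \<odot>\<^bsub>A\<^esub> e i) b = pure_tensor A B (e i) (s (pure_tensor A B a b) i)"
        unfolding s_def sweedler_pure[OF B.k_algebra slice[OF i] ab]
          linear_map_smult[OF bilinear_map_left[OF p ab(2)] assms(2)[OF i]]
          linear_map_smult[OF bilinear_map_right[OF p assms(2)[OF i]] ab(2)] ..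
    qed (use ab linear_map_closed[OF lin_ps] in auto)
    finally show "pure_tensor A B a b = (\<Oplus>\<^bsub>tensor A B\<^esub>i\<in>I. pure_tensor A B (e i) (s (pure_tensor A B a b) i))" .
  qed
  have g_s: "g (s Z i) = sweedler base_field (\<lambda>a b. c i a * g b) Z"
    if "i \<in> I" "g \<in> G" "Z \<in> carrier (tensor A B)" for i g Z
    unfolding s_def by (rule functional_slice_left[OF assms(3)[OF that(1)] G[OF that(2)] that(3)])
  have "s X i = s Y i" if "i \<in> I" for i
    using linear_map_closed[OF lin_s[OF that]] X Y g_s[OF that] eq[OF that] by (intro sep) simp_all
  then have "(\<Oplus>\<^bsub>tensor A B\<^esub>i\<in>I. pure_tensor A B (e i) (s X i)) = (\<Oplus>\<^bsub>tensor A B\<^esub>i\<in>I. pure_tensor A B (e i) (s Y i))"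
    using linear_map_closed[OF lin_ps Y] by (intro AB.finsum_cong') auto
  then show ?thesis using expand[OF X] expand[OF Y] by simp
qed

text \<open>In an iterated Sweedler sum the inner sum depends on a leg of the outer one; linearity
  in that leg is what makes the outer integrand bilinear.\<close>

lemma linear_map_sweedler_param:
  assumes U: "k_algebra U" and \<gamma>: "\<And>v. v \<in> carrier V \<Longrightarrow> bilinear_map A B U (\<gamma> v)"
    and lin: "\<And>a b. a \<in> carrier A \<Longrightarrow> b \<in> carrier B \<Longrightarrow> linear_map V U (\<lambda>v. \<gamma> v a b)"
    and V: "k_algebra V" and X: "X \<in> carrier (tensor A B)"
  shows "linear_map V U (\<lambda>v. sweedler U (\<gamma> v) X)"
proof -
  interpret V: kalg V by (rule kalg.intro) fact
  note sw = linear_map_sweedler[OF U \<gamma>] and pure = sweedler_pure[OF U \<gamma>]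
  show ?thesis
  proof (rule linear_mapI)
    show "sweedler U (\<gamma> v) X \<in> carrier U" if "v \<in> carrier V" for v
      by (rule linear_map_closed[OF sw[OF that] X])
    show "sweedler U (\<gamma> (v \<oplus>\<^bsub>V\<^esub> w)) X = sweedler U (\<gamma> v) X \<oplus>\<^bsub>U\<^esub> sweedler U (\<gamma> w) X"
      if "v \<in> carrier V" "w \<in> carrier V" for v w
      using that linear_map_add[OF lin]
      by (intro tensor_ext[OF U sw linear_map_sum[OF U sw sw] _ X]) (simp_all add: pure)
    show "sweedler U (\<gamma> (c \<odot>\<^bsub>V\<^esub> v)) X = c \<odot>\<^bsub>U\<^esub> sweedler U (\<gamma> v) X" if "v \<in> carrier V" for c v
      using that linear_map_smult[OF lin]
      by (intro tensor_ext[OF U sw linear_map_comp[OF sw linear_map_smult_right[OF U]] _ X])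
        (simp_all add: pure)
  qed
qed

text \<open>Both sides are linear in \<open>X\<close> and in \<open>Y\<close>, so two passes through
  pure tensors suffice. It expresses multiplicativity of a comultiplication by scalar double
  sums.\<close>

lemma functional_tensor_mult:
  assumes f: "linear_functional A f" and g: "linear_functional B g"
    and X: "X \<in> carrier (tensor A B)" and Y: "Y \<in> carrier (tensor A B)"
  shows "sweedler base_field (\<lambda>a b. f a * g b) (X \<otimes>\<^bsub>tensor A B\<^esub> Y) =
    sweedler base_field (\<lambda>a b. sweedler base_field (\<lambda>a' b'. f (a \<otimes>\<^bsub>A\<^esub> a') * g (b \<otimes>\<^bsub>B\<^esub> b')) Y) X"
proof -
  note k = k_algebra_base_field
  let ?W = "sweedler base_field (\<lambda>a b. f a * g b)"
  note W = linear_map_sweedler[OF k bilinear_map_functionals[OF f g]]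
  have \<beta>: "bilinear_map A B base_field (\<lambda>a b. ?W (pure_tensor A B a b \<otimes>\<^bsub>tensor A B\<^esub> Y))"
    by (rule bilinear_map_comp[OF bilinear_map_pure_tensor
      linear_map_comp[OF linear_map_mult_right[OF k_algebra_tensor Y] W]])
  have inner: "?W (pure_tensor A B a b \<otimes>\<^bsub>tensor A B\<^esub> Y) =
      sweedler base_field (\<lambda>a' b'. f (a \<otimes>\<^bsub>A\<^esub> a') * g (b \<otimes>\<^bsub>B\<^esub> b')) Y"
    if ab: "a \<in> carrier A" "b \<in> carrier B" for a b
  proof -
    have bf: "bilinear_map A B base_field (\<lambda>a' b'. f (a \<otimes>\<^bsub>A\<^esub> a') * g (b \<otimes>\<^bsub>B\<^esub> b'))"
      by (rule bilinear_map_functionals[OF linear_map_comp[OF linear_map_mult_left[OF A.k_algebra ab(1)] f]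
        linear_map_comp[OF linear_map_mult_left[OF B.k_algebra ab(2)] g]])
    show ?thesis
      by (rule tensor_ext[OF k linear_map_comp[OF linear_map_mult_left[OF k_algebra_tensor pure_tensor_closed[OF ab]] W]
          linear_map_sweedler[OF k bf] _ Y])
        (simp add: ab pure_tensor_mult sweedler_pure[OF k bf] sweedler_pure[OF k bilinear_map_functionals[OF f g]])
  qed
  have "?W (X \<otimes>\<^bsub>tensor A B\<^esub> Y) = sweedler base_field (\<lambda>a b. ?W (pure_tensor A B a b \<otimes>\<^bsub>tensor A B\<^esub> Y)) X"
    by (rule tensor_ext[OF k linear_map_comp[OF linear_map_mult_right[OF k_algebra_tensor Y] W]
      linear_map_sweedler[OF k \<beta>] _ X]) (simp add: sweedler_pure[OF k \<beta>])
  also have "\<dots> = sweedler base_field (\<lambda>a b.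
      sweedler base_field (\<lambda>a' b'. f (a \<otimes>\<^bsub>A\<^esub> a') * g (b \<otimes>\<^bsub>B\<^esub> b')) Y) X"
    by (rule sweedler_cong[OF k \<beta> inner X])
  finally show ?thesis .
qed

end

section \<open>A basis of the algebra\<close>

text \<open>\<open>c0\<close>, \<open>c1\<close>, \<open>c2\<close>, \<open>c3\<close> are the coordinates with respect to the basis \<open>1, x, y, x y\<close>.\<close>

locale quantum_exterior = kalg A for A :: "('k::field, 'a) module" (structure) +
  fixes q :: 'k and x y :: 'a and c0 c1 c2 c3 :: "'a \<Rightarrow> 'k"
  assumes q_nonzero: "q \<noteq> 0"
    and gens [simp]: "x \<in> carrier A" "y \<in> carrier A"
    and lin: "linear_functional A c0" "linear_functional A c1"
      "linear_functional A c2" "linear_functional A c3"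
    and coords_one [simp]: "c0 \<one> = 1" "c1 \<one> = 0" "c2 \<one> = 0" "c3 \<one> = 0"
    and coords_x [simp]: "c0 x = 0" "c1 x = 1" "c2 x = 0" "c3 x = 0"
    and coords_y [simp]: "c0 y = 0" "c1 y = 0" "c2 y = 1" "c3 y = 0"
    and coords_mult [simp]: "\<And>a b. a \<in> carrier A \<Longrightarrow> b \<in> carrier A \<Longrightarrow> c0 (a \<otimes> b) = c0 a * c0 b"
      "\<And>a b. a \<in> carrier A \<Longrightarrow> b \<in> carrier A \<Longrightarrow> c1 (a \<otimes> b) = c0 a * c1 b + c1 a * c0 b"
      "\<And>a b. a \<in> carrier A \<Longrightarrow> b \<in> carrier A \<Longrightarrow> c2 (a \<otimes> b) = c0 a * c2 b + c2 a * c0 b"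
      "\<And>a b. a \<in> carrier A \<Longrightarrow> b \<in> carrier A \<Longrightarrow>
         c3 (a \<otimes> b) = c0 a * c3 b + c3 a * c0 b + c1 a * c2 b - c2 a * c1 b / q"
    and coords_ext: "\<And>a b. a \<in> carrier A \<Longrightarrow> b \<in> carrier A \<Longrightarrow>
      c0 a = c0 b \<Longrightarrow> c1 a = c1 b \<Longrightarrow> c2 a = c2 b \<Longrightarrow> c3 a = c3 b \<Longrightarrow> a = b"

section \<open>Coefficients in the free algebra on two letters\<close>

definition words :: "nat list monoid" where
  "words = \<lparr>carrier = lists {1, 2}, mult = (@), one = []\<rparr>"

lemma words_simps [simp]: "carrier words = lists {1, 2}" "mult words = (@)" "one words = []"
  by (simp_all add: words_def)

interpretation words: monoid words
  by (rule monoidI) auto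

abbreviation (input) free2 :: "('k::field, nat list \<Rightarrow>\<^sub>0 'k) module" where
  "free2 \<equiv> monoid_algebra words"

interpretation free2: kalg "free2 :: ('k::field, nat list \<Rightarrow>\<^sub>0 'k) module"
  by (rule kalg.intro) (rule words.k_algebra_monoid_algebra)

lemma free2_induct [consumes 1, case_names zero single add]:
  fixes u :: "nat list \<Rightarrow>\<^sub>0 'k::field"
  assumes "u \<in> carrier free2"
    and "P 0"
    and "\<And>w c. w \<in> lists {1, 2} \<Longrightarrow> P (Poly_Mapping.single w c)"
    and "\<And>v w. v \<in> carrier free2 \<Longrightarrow> w \<in> carrier free2 \<Longrightarrow> P v \<Longrightarrow> P w \<Longrightarrow> P (v + w)"
  shows "P u"
proof -
  have "Poly_Mapping.keys u \<subseteq> lists {1, 2}"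
    using assms(1) by (simp add: monoid_algebra_simps(1))
  then show ?thesis
    by (induction u rule: poly_mapping_induct_keys)
      (use assms(2-4) in \<open>simp_all add: monoid_algebra_simps(1)\<close>)
qed

text \<open>A word of length \<open>n\<close> splits into prefix and suffix in \<open>n + 1\<close>
  ways, which gives the terms. Length two is enough: longer words lie in the ideal of
  relations.\<close>

lemma lookup_free2_mult:
  fixes u v :: "nat list \<Rightarrow>\<^sub>0 'k::field"
  assumes "u \<in> carrier free2" "v \<in> carrier free2"
  shows "Poly_Mapping.lookup (u \<otimes>\<^bsub>free2\<^esub> v) [] = Poly_Mapping.lookup u [] * Poly_Mapping.lookup v []"
    and "Poly_Mapping.lookup (u \<otimes>\<^bsub>free2\<^esub> v) [m] =
      Poly_Mapping.lookup u [] * Poly_Mapping.lookup v [m] + Poly_Mapping.lookup u [m] * Poly_Mapping.lookup v []"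
    and "Poly_Mapping.lookup (u \<otimes>\<^bsub>free2\<^esub> v) [m, n] =
      Poly_Mapping.lookup u [] * Poly_Mapping.lookup v [m, n] + Poly_Mapping.lookup u [m] * Poly_Mapping.lookup v [n]
      + Poly_Mapping.lookup u [m, n] * Poly_Mapping.lookup v []"
proof -
  let ?L = Poly_Mapping.lookup
  have base: "?L (Poly_Mapping.single (a @ b) (c * d)) [] =
      ?L (Poly_Mapping.single a c) [] * ?L (Poly_Mapping.single b d) [] \<and>
    ?L (Poly_Mapping.single (a @ b) (c * d)) [m] =
      ?L (Poly_Mapping.single a c) [] * ?L (Poly_Mapping.single b d) [m]
      + ?L (Poly_Mapping.single a c) [m] * ?L (Poly_Mapping.single b d) [] \<and>
    ?L (Poly_Mapping.single (a @ b) (c * d)) [m, n] =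
      ?L (Poly_Mapping.single a c) [] * ?L (Poly_Mapping.single b d) [m, n]
      + ?L (Poly_Mapping.single a c) [m] * ?L (Poly_Mapping.single b d) [n]
      + ?L (Poly_Mapping.single a c) [m, n] * ?L (Poly_Mapping.single b d) []"
    for a b :: "nat list" and c d :: 'k
    by (cases a; cases "tl a") (auto simp: lookup_single when_def append_eq_Cons_conv)
  have "?L (u \<otimes>\<^bsub>free2\<^esub> v) [] = ?L u [] * ?L v [] \<and>
    ?L (u \<otimes>\<^bsub>free2\<^esub> v) [m] = ?L u [] * ?L v [m] + ?L u [m] * ?L v [] \<and>
    ?L (u \<otimes>\<^bsub>free2\<^esub> v) [m, n] = ?L u [] * ?L v [m, n] + ?L u [m] * ?L v [n] + ?L u [m, n] * ?L v []"
    using assms(1)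
  proof (induction u rule: free2_induct)
    case (single a c)
    from assms(2) show ?case
    proof (induction v rule: free2_induct)
      case (single b d)
      then show ?case using base[of a b c d] by simp
    qed (simp_all add: monoid_algebra_mult_add_right lookup_add algebra_simps)
  qed (simp_all add: monoid_algebra_mult_add_left lookup_add algebra_simps)
  then show "?L (u \<otimes>\<^bsub>free2\<^esub> v) [] = ?L u [] * ?L v []"
    "?L (u \<otimes>\<^bsub>free2\<^esub> v) [m] = ?L u [] * ?L v [m] + ?L u [m] * ?L v []"
    "?L (u \<otimes>\<^bsub>free2\<^esub> v) [m, n] = ?L u [] * ?L v [m, n] + ?L u [m] * ?L v [n] + ?L u [m, n] * ?L v []"
    by blast+
qed

text \<open>In \<open>A\<^sub>q\<close> the word \<open>x\<^sub>2 x\<^sub>1\<close> equals \<open>- x\<^sub>1 x\<^sub>2 / q\<close>.\<close>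

definition xy_coeff :: "'k::field \<Rightarrow> (nat list \<Rightarrow>\<^sub>0 'k) \<Rightarrow> 'k" where
  "xy_coeff q u = Poly_Mapping.lookup u [1, 2] - Poly_Mapping.lookup u [2, 1] / q"

definition normal_form :: "'k::field \<Rightarrow> (nat list \<Rightarrow>\<^sub>0 'k) \<Rightarrow> nat list \<Rightarrow>\<^sub>0 'k" where
  "normal_form q u = Poly_Mapping.single [] (Poly_Mapping.lookup u [])
     + Poly_Mapping.single [1] (Poly_Mapping.lookup u [1])
     + Poly_Mapping.single [2] (Poly_Mapping.lookup u [2]) + Poly_Mapping.single [1, 2] (xy_coeff q u)"

section \<open>Normal forms modulo the relations\<close>

definition relators :: "'k::field \<Rightarrow> (nat list \<Rightarrow>\<^sub>0 'k) set" where
  "relators q = {Poly_Mapping.single [1, 1] 1, Poly_Mapping.single [2, 2] 1,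
     Poly_Mapping.single [1, 2] 1 + Poly_Mapping.single [2, 1] q}"

definition rel_ideal :: "'k::field \<Rightarrow> (nat list \<Rightarrow>\<^sub>0 'k) set" where
  "rel_ideal q = Idl\<^bsub>free2\<^esub> (relators q)"

lemma A_q_eq: "A_q q = quotient_algebra free2 (rel_ideal q)"
  by (simp add: A_q_def free_algebra_def gen_def rel_ideal_def relators_def Let_def words_def)

lemma relators_subset: "relators q \<subseteq> carrier free2"
  using free2.a_closed[of "Poly_Mapping.single [1, 2] 1" "Poly_Mapping.single [2, 1] q"]
  by (simp add: relators_def)

lemma ideal_rel: "ideal (rel_ideal q) free2"
  unfolding rel_ideal_def by (rule free2.genideal_ideal[OF relators_subset])

lemma kalg_ideal_rel: "kalg_ideal free2 (rel_ideal q)"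
  by (intro kalg_ideal.intro free2.kalg_axioms ideal_rel)

lemma rel_diff: "u \<in> carrier free2 \<Longrightarrow> v \<in> carrier free2 \<Longrightarrow> u \<ominus>\<^bsub>free2\<^esub> v = u - v"
  using free2.minus_as_smult[of u v] pm.scale_minus_left[of 1 v] by simp

text \<open>The common zeros of the four coordinates form an ideal by the product formulas, and it
  contains the relators. This is the linear independence of the four normal words in the
  quotient.\<close>

lemma rel_ideal_coords_zero:
  assumes "q \<noteq> 0" "u \<in> rel_ideal q"
  shows "u \<in> carrier free2" "Poly_Mapping.lookup u [] = 0" "Poly_Mapping.lookup u [1] = 0"
    "Poly_Mapping.lookup u [2] = 0" "xy_coeff q u = 0"
proof -
  let ?L = Poly_Mapping.lookup
  define K where "K = {u \<in> carrier free2. ?L u [] = 0 \<and> ?L u [1] = 0 \<and> ?L u [2] = 0 \<and> xy_coeff q u = 0}"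
  have "ideal K free2"
  proof (rule idealI)
    show "subgroup K (add_monoid free2)"
    proof (rule free2.add.subgroupI)
      show "K \<subseteq> carrier free2" by (auto simp: K_def)
      show "K \<noteq> {}" using free2.zero_closed by (auto simp: K_def xy_coeff_def intro!: exI[of _ 0])
      show "\<ominus>\<^bsub>free2\<^esub> u \<in> K" if "u \<in> K" for u
        using that free2.minus_eq_smult[of u] free2.smult_closed'[of u "-1"]
        by (auto simp: K_def xy_coeff_def)
      show "u \<oplus>\<^bsub>free2\<^esub> v \<in> K" if "u \<in> K" "v \<in> K" for u v
        using that free2.a_closed[of u v]
        by (auto simp: K_def xy_coeff_def lookup_add add_divide_distrib)
    qed
  qed (auto simp: K_def xy_coeff_def lookup_free2_mult free2.ring_axioms free2.m_closed)
  moreover have "relators q \<subseteq> K"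
    using relators_subset[of q] assms(1)
    by (auto simp: K_def xy_coeff_def relators_def lookup_add lookup_single)
  ultimately have "rel_ideal q \<subseteq> K"
    unfolding rel_ideal_def by (rule free2.genideal_minimal)
  with assms(2) show "u \<in> carrier free2" "?L u [] = 0" "?L u [1] = 0" "?L u [2] = 0" "xy_coeff q u = 0"
    by (auto simp: K_def)
qed

context
  fixes q :: "'k::field"
  assumes q: "q \<noteq> 0"
begin

interpretation rel: kalg_ideal free2 "rel_ideal q"
  by (rule kalg_ideal_rel)

lemma relators_in_ideal:
  "Poly_Mapping.single [1, 1] 1 \<in> rel_ideal q" "Poly_Mapping.single [2, 2] 1 \<in> rel_ideal q"
  "Poly_Mapping.single [1, 2] 1 + Poly_Mapping.single [2, 1] q \<in> rel_ideal q"
  using free2.genideal_self[OF relators_subset, of q] by (auto simp: rel_ideal_def relators_def)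

lemma ideal_add: "u \<in> rel_ideal q \<Longrightarrow> v \<in> rel_ideal q \<Longrightarrow> u + v \<in> rel_ideal q"
  using rel.a_closed[of u v] by simp

lemma ideal_scale: "u \<in> rel_ideal q \<Longrightarrow> pm_scale c u \<in> rel_ideal q"
  using rel.smult_in_ideal[of u c] by simp

lemma ideal_single: "Poly_Mapping.single w 1 \<in> rel_ideal q \<Longrightarrow> Poly_Mapping.single w c \<in> rel_ideal q"
  using ideal_scale[of "Poly_Mapping.single w 1" c] by simp

lemma ideal_sandwich:
  assumes "Poly_Mapping.single w 1 \<in> rel_ideal q" "v \<in> lists {1, 2}" "v' \<in> lists {1, 2}"
  shows "Poly_Mapping.single (v @ w @ v') c \<in> rel_ideal q"
proof -
  have "Poly_Mapping.single v 1 \<otimes>\<^bsub>free2\<^esub> Poly_Mapping.single w 1 \<otimes>\<^bsub>free2\<^esub> Poly_Mapping.single v' c \<in> rel_ideal q"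
    using assms by (intro rel.I_r_closed rel.I_l_closed) simp_all
  then show ?thesis by simp
qed

text \<open>A word of three letters either has equal neighbours or alternates. In the alternating
  case the mixed relator times a letter trades \<open>121\<close> for \<open>211\<close> and
  \<open>212\<close> for \<open>122\<close>, where equal letters meet; the second trade divides by
  \<open>q\<close>.\<close>

lemma ideal_three:
  assumes "i \<in> {1, 2}" "j \<in> {1, 2}" "k \<in> {1, 2}"
  shows "Poly_Mapping.single [i, j, k] 1 \<in> rel_ideal q"
proof -
  let ?s = Poly_Mapping.single and ?r = "Poly_Mapping.single [1, 2] 1 + Poly_Mapping.single [2, 1] q"
  have sq: "?s [i, i] 1 \<in> rel_ideal q" if "i \<in> {1, 2}" for i
    using relators_in_ideal that by auto
  consider "i = j" | "j = k" | "i = 1" "j = 2" "k = 1" | "i = 2" "j = 1" "k = 2"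
    using assms by auto
  then show ?thesis
  proof cases
    case 1
    then show ?thesis using ideal_sandwich[OF sq[OF assms(1)], of "[]" "[k]" 1] assms by simp
  next
    case 2
    then show ?thesis using ideal_sandwich[OF sq[OF assms(2)], of "[i]" "[]" 1] assms by simp
  next
    case 3
    have "?r \<otimes>\<^bsub>free2\<^esub> ?s [1] 1 \<in> rel_ideal q"
      by (rule rel.I_r_closed[OF relators_in_ideal(3)]) simp
    moreover have "?s [2, 1, 1] (- q) \<in> rel_ideal q"
      using ideal_sandwich[OF sq[of 1], of "[2]" "[]" "- q"] by simp
    ultimately have "?r \<otimes>\<^bsub>free2\<^esub> ?s [1] 1 + ?s [2, 1, 1] (- q) \<in> rel_ideal q" by (rule ideal_add)
    then show ?thesis using 3 by (simp add: monoid_algebra_mult_add_left single_uminus)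
  next
    case 4
    have "?r \<otimes>\<^bsub>free2\<^esub> ?s [2] 1 \<in> rel_ideal q"
      by (rule rel.I_r_closed[OF relators_in_ideal(3)]) simp
    moreover have "?s [1, 2, 2] (- 1) \<in> rel_ideal q"
      using ideal_sandwich[OF sq[of 2], of "[1]" "[]" "- 1"] by simp
    ultimately have "?r \<otimes>\<^bsub>free2\<^esub> ?s [2] 1 + ?s [1, 2, 2] (- 1) \<in> rel_ideal q" by (rule ideal_add)
    then have "?s [2, 1, 2] q \<in> rel_ideal q" by (simp add: monoid_algebra_mult_add_left single_uminus)
    from ideal_scale[OF this, of "inverse q"] show ?thesis using 4 q by simp
  qed
qed

text \<open>This is the spanning half. By additivity one word at a time suffices, and
  \<open>[2, 1]\<close> is the only word that neither is its own normal form nor lies in the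
  ideal.\<close>

lemma minus_normal_form_in_ideal:
  assumes "u \<in> carrier free2"
  shows "u - normal_form q u \<in> rel_ideal q"
  using assms
proof (induction u rule: free2_induct)
  case zero
  show ?case using ideal_scale[OF relators_in_ideal(1), of 0] by (simp add: normal_form_def xy_coeff_def)
next
  case (add v w)
  have "normal_form q (v + w) = normal_form q v + normal_form q w"
    by (simp add: normal_form_def xy_coeff_def lookup_add single_add single_diff add_divide_distrib)
  then show ?case using ideal_add[OF add(3,4)] by (simp add: algebra_simps)
next
  case (single w c)
  let ?s = Poly_Mapping.single
  have in_ideal: "?s w c - normal_form q (?s w c) \<in> rel_ideal q" if "?s w 1 \<in> rel_ideal q"
    "w \<noteq> []" "w \<noteq> [1]" "w \<noteq> [2]" "w \<noteq> [1, 2]" "w \<noteq> [2, 1]"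
    using ideal_single[OF that(1)] that(2-) by (simp add: normal_form_def xy_coeff_def lookup_single)
  consider "w = []" | "w = [1]" | "w = [2]" | "w = [1, 2]" | "w = [2, 1]" | "w = [1, 1]" | "w = [2, 2]"
    | i j k v where "w = i # j # k # v"
    using single by (cases w rule: list.exhaust; cases "tl w" rule: list.exhaust;
      cases "tl (tl w)" rule: list.exhaust) auto
  then show ?case
  proof cases
    case 5
    \<comment> \<open>The normal form of \<open>c\<close> times \<open>[2, 1]\<close> is
      \<open>- c / q\<close> times \<open>[1, 2]\<close>, so the difference is \<open>c / q\<close>
      times the mixed relator.\<close>
    have "?s w c - normal_form q (?s w c) =
        pm_scale (c / q) (?s [1, 2] 1 + ?s [2, 1] q)"
      using 5 q by (simp add: normal_form_def xy_coeff_def lookup_single pm.scale_right_distrib single_uminus)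
    then show ?thesis using ideal_scale[OF relators_in_ideal(3), of "c / q"] by simp
  next
    case 6
    show ?thesis by (rule in_ideal) (use 6 relators_in_ideal in auto)
  next
    case 7
    show ?thesis by (rule in_ideal) (use 7 relators_in_ideal in auto)
  next
    case (8 i j k v)
    then have "?s w 1 \<in> rel_ideal q"
      using single ideal_sandwich[OF ideal_three[of i j k], of "[]" v 1] by simp
    then show ?thesis by (rule in_ideal) (simp_all add: 8)
  qed (use ideal_scale[OF relators_in_ideal(1), of 0] in
    \<open>simp_all add: normal_form_def xy_coeff_def lookup_single\<close>)
qed

abbreviation coset :: "(nat list \<Rightarrow>\<^sub>0 'k) \<Rightarrow> (nat list \<Rightarrow>\<^sub>0 'k) set" where
  "coset u \<equiv> rel_ideal q +>\<^bsub>free2\<^esub> u"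

text \<open>The coordinates descend to cosets because they vanish on the ideal, and are jointly
  injective because an element is congruent to its normal form, which they determine.\<close>

lemma quantum_exterior_A_q:
  "\<exists>x y c0 c1 c2 c3. quantum_exterior (A_q q) q x y c0 c1 c2 c3"
proof (intro exI)
  let ?L = Poly_Mapping.lookup and ?s = Poly_Mapping.single
  \<comment> \<open>Evaluation at a chosen representative; the choice is immaterial for additive
    functions that vanish on the ideal.\<close>
  define lift where "lift = (\<lambda>(f :: (nat list \<Rightarrow>\<^sub>0 'k) \<Rightarrow> 'k) X. f (SOME u. u \<in> X))"
  have lift: "lift f (coset u) = f u"
    if "\<And>u. u \<in> rel_ideal q \<Longrightarrow> f u = 0" "\<And>u v. f (u - v) = f u - f v" "u \<in> carrier free2" for f u
  proof -
    define v where "v = (SOME v. v \<in> coset u)"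
    have "v \<in> coset u"
      unfolding v_def by (rule someI, rule rel.a_rcos_self[OF that(3)])
    then have "v - u \<in> rel_ideal q"
      using that(3) by (auto simp: rel.mem_coset_iff rel.coset_eq_iff rel_diff)
    then have "f v - f u = 0" using that(1,2) by metis
    then show ?thesis by (simp add: lift_def v_def[symmetric])
  qed
  note zero = rel_ideal_coords_zero(2-)[OF q]
  have lifts: "lift (\<lambda>u. ?L u []) (coset u) = ?L u []" "lift (\<lambda>u. ?L u [1]) (coset u) = ?L u [1]"
    "lift (\<lambda>u. ?L u [2]) (coset u) = ?L u [2]" "lift (xy_coeff q) (coset u) = xy_coeff q u"
    if "u \<in> carrier free2" for u
    using that zero by (intro lift; simp add: lookup_minus xy_coeff_def diff_divide_distrib)+
  have L1: "?L (u \<otimes>\<^bsub>free2\<^esub> v) [Suc 0] = ?L u [] * ?L v [Suc 0] + ?L u [Suc 0] * ?L v []"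
    if "u \<in> carrier free2" "v \<in> carrier free2" for u v :: "nat list \<Rightarrow>\<^sub>0 'k"
    using that by (rule lookup_free2_mult)
  note closed = free2.a_closed[simplified] free2.smult_closed'[simplified]
  show "quantum_exterior (A_q q) q (coset (?s [1] 1)) (coset (?s [2] 1)) (lift (\<lambda>u. ?L u []))
    (lift (\<lambda>u. ?L u [1])) (lift (\<lambda>u. ?L u [2])) (lift (xy_coeff q))"
    unfolding A_q_eq
  proof (intro quantum_exterior.intro quantum_exterior_axioms.intro linear_mapI)
    show "kalg rel.Q" by (rule kalg.intro) (rule rel.k_algebra_quotient)
  next
    fix X Y assume "X \<in> carrier rel.Q" "Y \<in> carrier rel.Q"
    then obtain u v where u: "u \<in> carrier free2" "X = coset u" and v: "v \<in> carrier free2" "Y = coset v"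
      unfolding rel.carrier_quotient by blast
    assume eq: "lift (\<lambda>u. ?L u []) X = lift (\<lambda>u. ?L u []) Y" "lift (\<lambda>u. ?L u [1]) X = lift (\<lambda>u. ?L u [1]) Y"
      "lift (\<lambda>u. ?L u [2]) X = lift (\<lambda>u. ?L u [2]) Y" "lift (xy_coeff q) X = lift (xy_coeff q) Y"
    have "normal_form q u = normal_form q v"
      using eq u v by (simp add: lifts[simplified] normal_form_def)
    moreover have "(u - normal_form q u) + pm_scale (-1) (v - normal_form q v) \<in> rel_ideal q"
      using u v by (intro ideal_add ideal_scale minus_normal_form_in_ideal)
    ultimately have "u - v \<in> rel_ideal q" by (simp add: algebra_simps pm.scale_right_diff_distrib)
    then show "X = Y" using u v by (simp add: rel.coset_eq_iff rel_diff)
  qed (auto simp: q rel.carrier_quotient rel.coset_one rel.coset_mult rel.coset_add rel.coset_smult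
      lifts[simplified] closed free2.m_closed lookup_free2_mult L1 lookup_add lookup_single xy_coeff_def
      diff_divide_distrib add_divide_distrib algebra_simps)
qed

end

section \<open>The Nakayama automorphism of a bi-Frobenius algebra\<close>

lemma kalg_pair_self: "k_algebra A \<Longrightarrow> kalg_pair A A"
  by (simp add: kalg_pair_def kalg_def)

text \<open>Every functional has the form \<open>\<phi> (- a)\<close>, so the bilinear form of
  \<open>\<phi>\<close> separates whatever functionals separate.\<close>

lemma frobenius_nondegenerate:
  assumes "frobenius_algebra A \<phi>"
    and sep: "\<And>u v. u \<in> carrier A \<Longrightarrow> v \<in> carrier A \<Longrightarrow> (\<And>f. linear_functional A f \<Longrightarrow> f u = f v) \<Longrightarrow> u = v"
    and "u \<in> carrier A" "v \<in> carrier A" "\<And>a. a \<in> carrier A \<Longrightarrow> \<phi> (u \<otimes>\<^bsub>A\<^esub> a) = \<phi> (v \<otimes>\<^bsub>A\<^esub> a)"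
  shows "u = v"
proof (rule sep[OF assms(3,4)])
  fix f assume "linear_functional A f"
  then obtain a where "a \<in> carrier A" "\<forall>x\<in>carrier A. f x = \<phi> (x \<otimes>\<^bsub>A\<^esub> a)"
    using assms(1) by (auto simp: frobenius_algebra_def)
  then show "f u = f v" using assms(3-5) by simp
qed

locale bi_frobenius = kalg A for A :: "('k::field, 'a) module" (structure) +
  fixes \<Delta> \<epsilon> \<phi> t S
  assumes bi_frobenius: "bi_frobenius_algebra A \<Delta> \<epsilon> \<phi> t S"
begin

sublocale P: kalg_pair A A
  by (rule kalg_pair_self[OF k_algebra])

lemma frobenius: "frobenius_algebra A \<phi>" "frobenius_coalgebra A \<Delta> t"
  and antihom: "algebra_antihom A S" "coalgebra_antihom A \<Delta> \<epsilon> S"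
  and coalg: "coalgebra A \<Delta> \<epsilon>"
  and counit_hom: "algebra_hom A base_field \<epsilon>"
  using bi_frobenius by (simp_all add: bi_frobenius_algebra_def)

lemma t_closed [simp]: "t \<in> carrier A"
  using frobenius(2) by (simp add: frobenius_coalgebra_def)

lemma linear_\<phi>: "linear_functional A \<phi>"
  using frobenius(1) by (simp add: frobenius_algebra_def)

lemma linear_S: "linear_map A A S"
  using antihom(1) by (simp add: algebra_antihom_def)

lemma S_closed [simp]: "a \<in> carrier A \<Longrightarrow> S a \<in> carrier A"
  by (rule linear_map_closed[OF linear_S])

lemma S_mult: "a \<in> carrier A \<Longrightarrow> b \<in> carrier A \<Longrightarrow> S (a \<otimes> b) = S b \<otimes> S a"
  and S_one: "S \<one> = \<one>"
  using antihom(1) by (simp_all add: algebra_antihom_def)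

lemma linear_\<Delta>: "linear_map A (tensor A A) \<Delta>"
  using coalg by (simp add: coalgebra_def)

lemma linear_\<epsilon>: "linear_functional A \<epsilon>"
  using coalg by (simp add: coalgebra_def)

lemma \<Delta>_closed [simp]: "a \<in> carrier A \<Longrightarrow> \<Delta> a \<in> carrier (tensor A A)"
  by (rule linear_map_closed[OF linear_\<Delta>])

lemma linear_\<phi>_mult_right: "a \<in> carrier A \<Longrightarrow> linear_functional A (\<lambda>u. \<phi> (u \<otimes> a))"
  using linear_map_comp[OF linear_map_mult_right[OF k_algebra] linear_\<phi>] .

lemma functional_S:
  assumes g: "linear_functional A g" and a: "a \<in> carrier A"
  shows "g (S a) = sweedler base_field (\<lambda>u v. \<phi> (u \<otimes> a) * g v) (\<Delta> t)"
proof -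
  have "S a = sweedler A (\<lambda>u v. \<phi> (u \<otimes> a) \<odot> v) (\<Delta> t)"
    using bi_frobenius a by (simp add: bi_frobenius_algebra_def)
  then show ?thesis
    using P.functional_slice_left[OF linear_\<phi>_mult_right[OF a] g] by simp
qed

text \<open>The counit applied to \<open>S a = \<Sum> \<phi> (t1 a) t2\<close> gives
  \<open>\<phi> (t a)\<close> by the counit axiom and \<open>\<epsilon> a\<close> because
  \<open>S\<close> preserves the counit. Together with nondegeneracy this makes \<open>t\<close> an
  integral: \<open>t a\<close> is \<open>\<epsilon> a\<close> times \<open>t\<close>.\<close>

lemma functional_t_mult:
  assumes a: "a \<in> carrier A"
  shows "\<phi> (t \<otimes> a) = \<epsilon> a"
proof -
  have "sweedler A (\<lambda>u v. \<epsilon> v \<odot> u) (\<Delta> t) = t"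
    using coalg by (simp add: coalgebra_def)
  then have "\<phi> (t \<otimes> a) = sweedler base_field (\<lambda>u v. \<phi> (u \<otimes> a) * \<epsilon> v) (\<Delta> t)"
    using P.functional_slice_right[OF linear_\<epsilon> linear_\<phi>_mult_right[OF a] \<Delta>_closed[OF t_closed]] by simp
  also have "\<dots> = \<epsilon> (S a)" by (rule functional_S[OF linear_\<epsilon> a, symmetric])
  also have "\<dots> = \<epsilon> a" using antihom(2) a by (simp add: coalgebra_antihom_def)
  finally show ?thesis .
qed

text \<open>Both Frobenius conditions combine: \<open>a\<close> is \<open>\<Sum> f(t1) t2\<close>
  for some functional \<open>f\<close>, and \<open>f\<close> is \<open>\<phi> (- b)\<close> for some
  \<open>b\<close>, which makes the sum \<open>S b\<close>.\<close>

lemma S_surj: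
  assumes "a \<in> carrier A"
  obtains b where "b \<in> carrier A" "S b = a"
proof -
  obtain f where f: "linear_functional A f" "a = sweedler A (\<lambda>u v. f u \<odot> v) (\<Delta> t)"
    using frobenius(2) assms by (auto simp: frobenius_coalgebra_def)
  obtain b where b: "b \<in> carrier A" "\<forall>u\<in>carrier A. f u = \<phi> (u \<otimes> b)"
    using frobenius(1) f(1) by (auto simp: frobenius_algebra_def)
  have "bilinear_map A A A (\<lambda>u v. f u \<odot> v)"
    using bilinear_map_comp_args[OF bilinear_map_smult[OF k_algebra] f(1) linear_map_id] .
  then have "a = sweedler A (\<lambda>u v. \<phi> (u \<otimes> b) \<odot> v) (\<Delta> t)"
    unfolding f(2) using b by (intro P.sweedler_cong[OF k_algebra]) simp_all
  then have "S b = a" using bi_frobenius b(1) by (simp add: bi_frobenius_algebra_def)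
  with b(1) show thesis by (rule that)
qed

text \<open>The relation \<open>t\<^sub>1 b \<otimes> t\<^sub>2 = t\<^sub>1 \<otimes> t\<^sub>2 S(b)\<close>, tested against a pair of functionals.\<close>

lemma frobenius_element_shift:
  assumes f: "linear_functional A f" and g: "linear_functional A g" and b: "b \<in> carrier A"
  shows "sweedler base_field (\<lambda>u v. f (u \<otimes> b) * g v) (\<Delta> t) =
    sweedler base_field (\<lambda>u v. f u * g (v \<otimes> S b)) (\<Delta> t)"
proof -
  \<comment> \<open>With \<open>f = \<phi> (- a)\<close> the two sides are
    \<open>g (S (b a))\<close> and \<open>g (S a S b)\<close>, so the claim is the
    antimultiplicativity of \<open>S\<close>.\<close>
  obtain a where a: "a \<in> carrier A" "\<forall>u\<in>carrier A. f u = \<phi> (u \<otimes> a)"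
    using frobenius(1) f by (auto simp: frobenius_algebra_def)
  have g': "linear_functional A (\<lambda>v. g (v \<otimes> S b))"
    using linear_map_comp[OF linear_map_mult_right[OF k_algebra] g] b by simp
  have "sweedler base_field (\<lambda>u v. f (u \<otimes> b) * g v) (\<Delta> t) =
    sweedler base_field (\<lambda>u v. \<phi> (u \<otimes> (b \<otimes> a)) * g v) (\<Delta> t)"
    using a b linear_map_comp[OF linear_map_mult_right[OF k_algebra b] f]
    by (intro P.sweedler_cong[OF k_algebra_base_field bilinear_map_functionals[OF _ g]])
      (simp_all add: m_assoc)
  also have "\<dots> = g (S (b \<otimes> a))" using a b by (intro functional_S[OF g, symmetric]) simp
  also have "\<dots> = g (S a \<otimes> S b)" using a b by (simp add: S_mult)
  also have "\<dots> = sweedler base_field (\<lambda>u v. \<phi> (u \<otimes> a) * g (v \<otimes> S b)) (\<Delta> t)"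
    by (rule functional_S[OF g' a(1)])
  also have "\<dots> = sweedler base_field (\<lambda>u v. f u * g (v \<otimes> S b)) (\<Delta> t)"
    using a by (intro P.sweedler_cong[OF k_algebra_base_field bilinear_map_functionals[OF linear_\<phi>_mult_right g']])
      simp_all
  finally show ?thesis .
qed

text \<open>Anticomultiplicativity at \<open>t\<close> reads
  \<open>\<Sum> S t2 \<otimes> S t1 = \<Delta> (S t) = c \<Delta> t\<close>; the map induced by
  \<open>\<beta>\<close> is applied to both ends.\<close>

lemma frobenius_element_flip:
  assumes \<beta>: "bilinear_map A A base_field \<beta>" and t: "S t = c \<odot> t"
  shows "sweedler base_field (\<lambda>u v. \<beta> (S v) (S u)) (\<Delta> t) = c * sweedler base_field \<beta> (\<Delta> t)"
proof -
  have pS: "bilinear_map A A (tensor A A) (\<lambda>u v. pure_tensor A A (S v) (S u))"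
    using bilinear_map_flip[OF bilinear_map_comp_args[OF P.bilinear_map_pure_tensor linear_S linear_S]] .
  note lin = P.linear_map_sweedler[OF k_algebra_base_field \<beta>]
  have "c * sweedler base_field \<beta> (\<Delta> t) = sweedler base_field \<beta> (\<Delta> (S t))"
    using linear_map_smult[OF linear_\<Delta> t_closed, of c] linear_map_smult[OF lin \<Delta>_closed[OF t_closed], of c]
    by (simp add: t)
  also have "\<dots> = sweedler base_field \<beta> (sweedler (tensor A A) (\<lambda>u v. pure_tensor A A (S v) (S u)) (\<Delta> t))"
    using antihom(2) by (simp add: coalgebra_antihom_def)
  also have "\<dots> = sweedler base_field (\<lambda>u v. sweedler base_field \<beta> (pure_tensor A A (S v) (S u))) (\<Delta> t)"
    by (rule P.linear_map_sweedler_comp[OF P.k_algebra_tensor k_algebra_base_field pS lin]) simp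
  also have "\<dots> = sweedler base_field (\<lambda>u v. \<beta> (S v) (S u)) (\<Delta> t)"
    by (rule P.sweedler_cong[OF k_algebra_base_field bilinear_map_comp[OF pS lin]])
      (simp_all add: P.sweedler_pure[OF k_algebra_base_field \<beta>])
  finally show ?thesis ..
qed

text \<open>The Nakayama automorphism is the inverse of \<open>S\<^sup>2\<close>.\<close>

lemma nakayama:
  assumes t: "S t = c \<odot> t" and "c \<noteq> 0" and inj: "inj_on S (carrier A)"
    and sep: "\<And>u v. u \<in> carrier A \<Longrightarrow> v \<in> carrier A \<Longrightarrow> (\<And>f. linear_functional A f \<Longrightarrow> f u = f v) \<Longrightarrow> u = v"
    and b: "b \<in> carrier A" and d: "d \<in> carrier A"
  shows "\<phi> (S (S b) \<otimes> d) = \<phi> (d \<otimes> b)"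
proof -
  let ?W = "\<lambda>\<beta>. sweedler base_field \<beta> (\<Delta> t)"
  note k = k_algebra_base_field
  have l: "linear_functional A (\<lambda>u. \<phi> (S (S b) \<otimes> u))"
    using linear_map_comp[OF linear_map_mult_left[OF k_algebra] linear_\<phi>] b by simp
  \<comment> \<open>The functional \<open>\<phi> (S (S b) -)\<close> is represented by some
    \<open>a\<close>. The goal is \<open>a = b\<close>, and by injectivity \<open>S a = S b\<close>
    is enough.\<close>
  then obtain a where a: "a \<in> carrier A" "\<forall>u\<in>carrier A. \<phi> (S (S b) \<otimes> u) = \<phi> (u \<otimes> a)"
    using frobenius(1) by (auto simp: frobenius_algebra_def)
  have "S a = S b"
  proof (rule sep)
    fix g assume g: "linear_functional A g"
    have gb: "linear_functional A (\<lambda>v. g (S b \<otimes> v))"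
      using linear_map_comp[OF linear_map_mult_left[OF k_algebra] g] b by simp
    have \<phi>S: "linear_functional A (\<lambda>v. \<phi> (S v))" and gS: "linear_functional A (\<lambda>u. g (S u))"
      using linear_map_comp[OF linear_S linear_\<phi>] linear_map_comp[OF linear_S g] .
    note \<phi>Sb = linear_map_comp[OF linear_map_mult_right[OF k_algebra S_closed[OF b]] \<phi>S]
    \<comment> \<open>The factor \<open>c\<close> pays for the flip. After it \<open>S (S b)\<close>
      meets \<open>S v\<close> and merges to \<open>S (v S b)\<close>; the shift trades this for
      \<open>S (u b) = S b S u\<close>, and flipping back leaves \<open>S b\<close> beside the
      second leg.\<close>
    have "c * g (S a) = c * ?W (\<lambda>u v. \<phi> (S (S b) \<otimes> u) * g v)"
      unfolding functional_S[OF g a(1)]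
      using a by (intro arg_cong[where f = "(*) c"] P.sweedler_cong[OF k bilinear_map_functionals[OF linear_\<phi>_mult_right g]])
        simp_all
    also have "\<dots> = ?W (\<lambda>u v. \<phi> (S (S b) \<otimes> S v) * g (S u))"
      by (rule frobenius_element_flip[OF bilinear_map_functionals[OF l g] t, symmetric])
    also have "\<dots> = ?W (\<lambda>u v. g (S u) * \<phi> (S (v \<otimes> S b)))"
      using b by (intro P.sweedler_cong[OF k, symmetric] bilinear_map_functionals[OF gS \<phi>Sb])
        (simp_all add: S_mult)
    also have "\<dots> = ?W (\<lambda>u v. g (S (u \<otimes> b)) * \<phi> (S v))"
      by (rule frobenius_element_shift[OF gS \<phi>S b, symmetric])
    also have "\<dots> = ?W (\<lambda>u v. \<phi> (S v) * g (S b \<otimes> S u))"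
      using b by (intro P.sweedler_cong[OF k] bilinear_map_functionals[OF
          linear_map_comp[OF linear_map_mult_right[OF k_algebra b] gS] \<phi>S]) (simp_all add: S_mult)
    also have "\<dots> = c * ?W (\<lambda>u v. \<phi> u * g (S b \<otimes> v))"
      by (rule frobenius_element_flip[OF bilinear_map_functionals[OF linear_\<phi> gb] t])
    \<comment> \<open>The inserted factor \<open>1\<close> makes the sum an instance of the formula
      for \<open>S 1 = 1\<close>, so that only \<open>S b\<close> remains.\<close>
    also have "?W (\<lambda>u v. \<phi> u * g (S b \<otimes> v)) = ?W (\<lambda>u v. \<phi> (u \<otimes> \<one>) * g (S b \<otimes> v))"
      by (intro P.sweedler_cong[OF k bilinear_map_functionals[OF linear_\<phi> gb]]) simp_all
    also have "\<dots> = g (S b)"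
      using functional_S[OF gb one_closed] b by (simp add: S_one)
    finally show "g (S a) = g (S b)" using \<open>c \<noteq> 0\<close> by simp
  qed (use a b in simp_all)
  then have "a = b" using inj a(1) b by (auto dest: inj_onD)
  then show ?thesis using a(2) d by simp
qed

end

section \<open>Necessary conditions\<close>

context quantum_exterior
begin

sublocale P: kalg_pair A A
  by (rule kalg_pair_self[OF k_algebra])

lemma coords_add [simp]:
  assumes "a \<in> carrier A" "b \<in> carrier A"
  shows "c0 (a \<oplus> b) = c0 a + c0 b" "c1 (a \<oplus> b) = c1 a + c1 b"
    "c2 (a \<oplus> b) = c2 a + c2 b" "c3 (a \<oplus> b) = c3 a + c3 b"
  using lin[THEN linear_map_add, OF assms] by simp_all

lemma coords_smult [simp]:
  assumes "a \<in> carrier A"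
  shows "c0 (r \<odot> a) = r * c0 a" "c1 (r \<odot> a) = r * c1 a"
    "c2 (r \<odot> a) = r * c2 a" "c3 (r \<odot> a) = r * c3 a"
  using lin[THEN linear_map_smult, OF assms] by simp_all

lemma coords_zero [simp]: "c0 \<zero> = 0" "c1 \<zero> = 0" "c2 \<zero> = 0" "c3 \<zero> = 0"
  using lin[THEN linear_map_zero[OF k_algebra k_algebra_base_field]] by simp_all

lemma expand:
  "a \<in> carrier A \<Longrightarrow> a = c0 a \<odot> \<one> \<oplus> c1 a \<odot> x \<oplus> c2 a \<odot> y \<oplus> c3 a \<odot> (x \<otimes> y)"
  by (rule coords_ext) simp_all

lemma linear_map_expand:
  assumes U: "k_algebra U" and f: "linear_map A U f" and a: "a \<in> carrier A"
  shows "f a = c0 a \<odot>\<^bsub>U\<^esub> f \<one> \<oplus>\<^bsub>U\<^esub> c1 a \<odot>\<^bsub>U\<^esub> f x \<oplus>\<^bsub>U\<^esub> c2 a \<odot>\<^bsub>U\<^esub> f y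
    \<oplus>\<^bsub>U\<^esub> c3 a \<odot>\<^bsub>U\<^esub> f (x \<otimes> y)"
proof -
  have "f a = f (c0 a \<odot> \<one> \<oplus> c1 a \<odot> x \<oplus> c2 a \<odot> y \<oplus> c3 a \<odot> (x \<otimes> y))"
    using expand[OF a] by simp
  then show ?thesis by (simp add: linear_map_add[OF f] linear_map_smult[OF f])
qed

lemma functional_expand:
  assumes f: "linear_functional A f" and a: "a \<in> carrier A"
  shows "f a = c0 a * f \<one> + c1 a * f x + c2 a * f y + c3 a * f (x \<otimes> y)"
  using linear_map_expand[OF k_algebra_base_field f a] by simp

lemma functionals_separate:
  "a \<in> carrier A \<Longrightarrow> b \<in> carrier A \<Longrightarrow> (\<And>f. linear_functional A f \<Longrightarrow> f a = f b) \<Longrightarrow> a = b"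
  using lin by (intro coords_ext)

lemma squares_zero [simp]: "x \<otimes> x = \<zero>" "y \<otimes> y = \<zero>"
  and yx: "y \<otimes> x = (- 1 / q) \<odot> (x \<otimes> y)"
  by (rule coords_ext; simp)+

text \<open>A homomorphism to a field kills the nilpotent generators.\<close>

lemma augmentation_unique:
  assumes "algebra_hom A base_field \<epsilon>" "a \<in> carrier A"
  shows "\<epsilon> a = c0 a"
proof -
  have lin: "linear_functional A \<epsilon>" and hom: "\<epsilon> \<in> ring_hom A base_field"
    using assms(1) by (simp_all add: algebra_hom_def)
  have "\<epsilon> x * \<epsilon> x = 0" "\<epsilon> y * \<epsilon> y = 0"
    using ring_hom_mult[OF hom, of x x] ring_hom_mult[OF hom, of y y]
      linear_map_zero[OF k_algebra k_algebra_base_field lin] by simp_all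
  then show ?thesis
    using functional_expand[OF lin assms(2)] ring_hom_mult[OF hom, of x y] ring_hom_one[OF hom]
    by simp
qed

section \<open>Bi-Frobenius structures force \<open>q\<^sup>2 = 1\<close>\<close>

lemma bi_frobenius_imp_parameter:
  assumes "bi_frobenius_algebra A \<Delta> \<epsilon> \<phi> t S"
  shows "q\<^sup>2 = 1"
proof (rule ccontr)
  assume q2: "q\<^sup>2 \<noteq> 1"
  interpret B: bi_frobenius A \<Delta> \<epsilon> \<phi> t S
    using assms by unfold_locales
  note \<epsilon> = augmentation_unique[OF B.counit_hom]
  have nondeg: "a = \<zero>" if "a \<in> carrier A" "\<And>b. b \<in> carrier A \<Longrightarrow> \<phi> (a \<otimes> b) = 0" for a
    using that linear_map_zero[OF k_algebra k_algebra_base_field B.linear_\<phi>]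
    by (intro frobenius_nondegenerate[OF B.frobenius(1) functionals_separate]) simp_all
  \<comment> \<open>\<open>\<phi> (t x b) = \<epsilon> (x b) = 0\<close> for every \<open>b\<close>,
    so nondegeneracy applies. The vanishing coordinates of \<open>t x\<close> and \<open>t y\<close>
    then leave only the \<open>x y\<close> part of \<open>t\<close>.\<close>
  have "t \<otimes> x = \<zero>" "t \<otimes> y = \<zero>"
    by (rule nondeg; simp add: m_assoc B.functional_t_mult \<epsilon>)+
  then have "c1 (t \<otimes> x) = 0" "c3 (t \<otimes> x) = 0" "c3 (t \<otimes> y) = 0" by simp_all
  then have t: "c0 t = 0" "c1 t = 0" "c2 t = 0" using q_nonzero by simp_all
  have t_eq: "t = c3 t \<odot> (x \<otimes> y)" by (rule coords_ext) (simp_all add: t)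
  have "c3 t * \<phi> (x \<otimes> y) = 1"
    using B.functional_t_mult[of \<one>] functional_expand[OF B.linear_\<phi>, of t] t \<epsilon> by simp
  then have \<phi>: "\<phi> (x \<otimes> y) \<noteq> 0" by auto
  have \<epsilon>S: "c0 (S a) = c0 a" if "a \<in> carrier A" for a
    using B.antihom(2) that \<epsilon> by (simp add: coalgebra_antihom_def)
  \<comment> \<open>The \<open>x y\<close> coordinate of \<open>S y S x\<close>; constant terms do
    not enter because \<open>S\<close> preserves the augmentation.\<close>
  define D where "D = c1 (S y) * c2 (S x) - c2 (S y) * c1 (S x) / q"
  have Sz: "S (x \<otimes> y) = D \<odot> (x \<otimes> y)"
    by (rule coords_ext) (simp_all add: B.S_mult \<epsilon>S D_def)
  have St: "S t = D \<odot> t"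
  proof -
    have "S t = c3 t \<odot> S (x \<otimes> y)"
      using linear_map_smult[OF B.linear_S, of "x \<otimes> y" "c3 t"] t_eq by simp
    also have "\<dots> = D \<odot> t" by (subst t_eq) (simp add: Sz smult_smult mult.commute)
    finally show ?thesis .
  qed
  have S_expand: "S a = c0 a \<odot> \<one> \<oplus> c1 a \<odot> S x \<oplus> c2 a \<odot> S y \<oplus> (c3 a * D) \<odot> (x \<otimes> y)"
    if "a \<in> carrier A" for a
    using linear_map_expand[OF k_algebra B.linear_S that] by (simp add: Sz B.S_one smult_smult)
  have c1S: "c1 (S a) = c1 a * c1 (S x) + c2 a * c1 (S y)"
    and c2S: "c2 (S a) = c1 a * c2 (S x) + c2 a * c2 (S y)"
    and c3S: "c3 (S a) = c1 a * c3 (S x) + c2 a * c3 (S y) + c3 a * D"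
    if "a \<in> carrier A" for a
    using S_expand[OF that] that by simp_all
  \<comment> \<open>Preimages of \<open>x\<close> and \<open>y\<close> under \<open>S\<close> invert
    the matrix of \<open>S\<close> on the generators modulo \<open>x y\<close>; the identity used is
    the multiplicativity of determinants.\<close>
  have det: "c1 (S x) * c2 (S y) - c2 (S x) * c1 (S y) \<noteq> 0"
  proof -
    obtain u where u: "u \<in> carrier A" "S u = x" using B.S_surj[of x] by auto
    obtain v where v: "v \<in> carrier A" "S v = y" using B.S_surj[of y] by auto
    have "(c1 u * c1 (S x) + c2 u * c1 (S y)) * (c1 v * c2 (S x) + c2 v * c2 (S y)) -
      (c1 u * c2 (S x) + c2 u * c2 (S y)) * (c1 v * c1 (S x) + c2 v * c1 (S y)) = 1"
      using c1S[OF u(1)] c2S[OF u(1)] c1S[OF v(1)] c2S[OF v(1)] u v by simp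
    moreover have "(c1 u * c1 (S x) + c2 u * c1 (S y)) * (c1 v * c2 (S x) + c2 v * c2 (S y)) -
      (c1 u * c2 (S x) + c2 u * c2 (S y)) * (c1 v * c1 (S x) + c2 v * c1 (S y)) =
      (c1 (S x) * c2 (S y) - c2 (S x) * c1 (S y)) * (c1 u * c2 v - c2 u * c1 v)"
      by (simp add: algebra_simps)
    ultimately show ?thesis by auto
  qed
  have q1: "1 - 1 / q \<noteq> 0" and q3: "1 - 1 / q\<^sup>2 \<noteq> 0"
    using q_nonzero q2 by auto
  \<comment> \<open>\<open>S x\<close> and \<open>S y\<close> square to zero, while the square of an
    element without constant term has \<open>x y\<close> coordinate
    \<open>c1 * c2 * (1 - 1 / q)\<close>.\<close>
  have "S x \<otimes> S x = \<zero>" "S y \<otimes> S y = \<zero>"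
    using B.S_mult[of x x] B.S_mult[of y y] linear_map_zero[OF k_algebra k_algebra B.linear_S]
    by simp_all
  then have "c3 (S x \<otimes> S x) = 0" "c3 (S y \<otimes> S y) = 0" by simp_all
  then have "c1 (S x) * c2 (S x) * (1 - 1 / q) = 0" "c1 (S y) * c2 (S y) * (1 - 1 / q) = 0"
    by (simp_all add: \<epsilon>S algebra_simps)
  then have offdiag: "c1 (S x) * c2 (S x) = 0" "c1 (S y) * c2 (S y) = 0"
    using q1 unfolding mult_eq_0_iff by blast+
  \<comment> \<open>This is \<open>S\<close> applied to \<open>y x = - x y / q\<close>. In the
    \<open>x y\<close> coordinate the off-diagonal terms cancel and the diagonal product is left
    with the factor \<open>1 - 1 / q\<^sup>2\<close>.\<close>
  have "S x \<otimes> S y = (- 1 / q) \<odot> (S y \<otimes> S x)"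
    using B.S_mult[of y x] B.S_mult[of x y] linear_map_smult[OF B.linear_S, of "x \<otimes> y"] yx by simp
  then have "c3 (S x \<otimes> S y) = (- 1 / q) * c3 (S y \<otimes> S x)" by simp
  then have "c1 (S x) * c2 (S y) * (1 - 1 / q\<^sup>2) = 0"
    by (simp add: \<epsilon>S algebra_simps power2_eq_square)
  then have diag: "c1 (S x) * c2 (S y) = 0"
    using q3 unfolding mult_eq_0_iff by blast
  \<comment> \<open>With zero diagonal product the determinant is minus the off-diagonal product, so
    both off-diagonal entries are nonzero; the square conditions then kill the diagonal.\<close>
  then have anti: "c2 (S x) \<noteq> 0" "c1 (S y) \<noteq> 0" using det by auto
  then have diag0: "c1 (S x) = 0" "c2 (S y) = 0" using offdiag by auto
  then have D: "D = c1 (S y) * c2 (S x)" by (simp add: D_def)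
  then have "D \<noteq> 0" using anti by simp
  have inj: "inj_on S (carrier A)"
  proof (rule inj_onI)
    fix u v assume uv: "u \<in> carrier A" "v \<in> carrier A" "S u = S v"
    have "c2 u = c2 v" using c1S[OF uv(1)] c1S[OF uv(2)] uv(3) anti diag0 by simp
    moreover have "c1 u = c1 v" using c2S[OF uv(1)] c2S[OF uv(2)] uv(3) anti diag0 by simp
    ultimately show "u = v"
      using c3S[OF uv(1)] c3S[OF uv(2)] \<epsilon>S[OF uv(1)] \<epsilon>S[OF uv(2)] uv \<open>D \<noteq> 0\<close>
      by (intro coords_ext) simp_all
  qed
  have nakayama: "\<phi> (S (S b) \<otimes> d) = \<phi> (d \<otimes> b)" if "b \<in> carrier A" "d \<in> carrier A" for b d
    by (rule B.nakayama[OF St \<open>D \<noteq> 0\<close> inj _ that]) (rule functionals_separate)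
  \<comment> \<open>\<open>S (S x)\<close> and \<open>S (S y)\<close> are \<open>D x\<close> and
    \<open>D y\<close> up to multiples of \<open>x y\<close>, which the second factor
    annihilates.\<close>
  have \<phi>_values: "\<phi> (S (S x) \<otimes> y) = D * \<phi> (x \<otimes> y)" "\<phi> (S (S y) \<otimes> x) = - (D / q) * \<phi> (x \<otimes> y)"
    "\<phi> (y \<otimes> x) = - (1 / q) * \<phi> (x \<otimes> y)"
    by (subst functional_expand[OF B.linear_\<phi>];
      simp add: \<epsilon>S c1S[of "S x"] c2S[of "S x"] c1S[of "S y"] c2S[of "S y"] diag0 D)+
  have "D * \<phi> (x \<otimes> y) = - (1 / q) * \<phi> (x \<otimes> y)"
    using nakayama[OF gens] unfolding \<phi>_values .
  moreover have "- (D / q) * \<phi> (x \<otimes> y) = 1 * \<phi> (x \<otimes> y)"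
    using nakayama[OF gens(2,1)] unfolding \<phi>_values by simp
  ultimately have "D = - (1 / q)" "- (D / q) = 1"
    using \<phi> by (simp_all only: mult_right_cancel not_False_eq_True)
  then have "1 / q\<^sup>2 = 1" by (simp add: power2_eq_square)
  with q3 show False by simp
qed

section \<open>Hopf structures force characteristic two\<close>

lemma hopf_imp_char_two:
  assumes "hopf_algebra A \<Delta> \<epsilon> S"
  shows "CHAR('k) = 2"
proof -
  note k = k_algebra_base_field
  let ?W = "\<lambda>f g. sweedler base_field (\<lambda>u v. f u * g v)"
  have coalg: "coalgebra A \<Delta> \<epsilon>" and \<Delta>: "algebra_hom A (tensor A A) \<Delta>" and "algebra_hom A base_field \<epsilon>"
    using assms by (simp_all add: hopf_algebra_def)
  note \<epsilon> = augmentation_unique[OF this(3)]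
  have lin_\<Delta>: "linear_map A (tensor A A) \<Delta>" and hom_\<Delta>: "\<Delta> \<in> ring_hom A (tensor A A)"
    using \<Delta> by (simp_all add: algebra_hom_def)
  note \<Delta>_closed = linear_map_closed[OF lin_\<Delta>]
  have lin_\<epsilon>: "linear_functional A \<epsilon>" using coalg by (simp add: coalgebra_def)
  have lin_W: "linear_map (tensor A A) base_field (\<lambda>X. r * ?W f g X)"
    if "linear_functional A f" "linear_functional A g" for f g r
    using linear_map_comp[OF P.linear_map_sweedler[OF k bilinear_map_functionals[OF that]]
      linear_map_smult_right[OF k, of r]] by simp
  then have lin_W': "linear_map (tensor A A) base_field (\<lambda>X. ?W f g X * r)"
    if "linear_functional A f" "linear_functional A g" for f g r
    using that by (simp add: mult.commute)
  note lin_W1 = lin_W[of _ _ 1, simplified]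
  note sum = linear_map_sum[OF k, simplified]
  have W_pure: "?W f g (pure_tensor A A a b) = f a * g b"
    if "linear_functional A f" "linear_functional A g" "a \<in> carrier A" "b \<in> carrier A" for f g a b
    by (rule P.sweedler_pure[OF k bilinear_map_functionals[OF that(1,2)] that(3,4)])
  let ?R = "\<lambda>X Y. ?W c0 c0 Y * ?W c1 c1 X + ?W c0 c1 Y * ?W c1 c0 X + ?W c1 c0 Y * ?W c0 c1 X
    + ?W c1 c1 Y * ?W c0 c0 X"
  text \<open>\<open>c1\<close> is a derivation along the augmentation \<open>c0\<close>.\<close>
  have W_mult: "?W c1 c1 (X \<otimes>\<^bsub>tensor A A\<^esub> Y) = ?R X Y"
    if X: "X \<in> carrier (tensor A A)" and Y: "Y \<in> carrier (tensor A A)" for X Y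
  proof (rule P.tensor_ext[OF k _ _ _ X])
    show "linear_functional (tensor A A) (\<lambda>X. ?W c1 c1 (X \<otimes>\<^bsub>tensor A A\<^esub> Y))"
      by (rule linear_map_comp[OF linear_map_mult_right[OF P.k_algebra_tensor Y] lin_W1[OF lin(2,2)]])
    show "linear_functional (tensor A A) (\<lambda>X. ?R X Y)"
      by (intro sum lin_W lin)
    fix a b assume ab: "a \<in> carrier A" "b \<in> carrier A"
    have L: "linear_functional (tensor A A) (\<lambda>Y. ?W c1 c1 (pure_tensor A A a b \<otimes>\<^bsub>tensor A A\<^esub> Y))"
      using ab by (intro linear_map_comp[OF linear_map_mult_left[OF P.k_algebra_tensor] lin_W1[OF lin(2,2)]]) simp
    have R: "linear_functional (tensor A A) (\<lambda>Y. ?R (pure_tensor A A a b) Y)"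
      by (intro sum lin_W' lin)
    show "?W c1 c1 (pure_tensor A A a b \<otimes>\<^bsub>tensor A A\<^esub> Y) = ?R (pure_tensor A A a b) Y"
      by (rule P.tensor_ext[OF k L R _ Y])
        (simp add: ab P.pure_tensor_mult W_pure lin, simp add: algebra_simps)
  qed
  have counit: "?W f \<epsilon> (\<Delta> a) = f a" "?W \<epsilon> f (\<Delta> a) = f a"
    if f: "linear_functional A f" and a: "a \<in> carrier A" for f a
  proof -
    have "sweedler A (\<lambda>u v. \<epsilon> u \<odot> v) (\<Delta> a) = a" "sweedler A (\<lambda>u v. \<epsilon> v \<odot> u) (\<Delta> a) = a"
      using coalg a by (simp_all add: coalgebra_def)
    then show "?W f \<epsilon> (\<Delta> a) = f a" "?W \<epsilon> f (\<Delta> a) = f a"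
      using P.functional_slice_left[OF lin_\<epsilon> f \<Delta>_closed[OF a]]
        P.functional_slice_right[OF lin_\<epsilon> f \<Delta>_closed[OF a]] by simp_all
  qed
  have counit_c0: "?W f c0 (\<Delta> a) = f a" "?W c0 f (\<Delta> a) = f a"
    if f: "linear_functional A f" and a: "a \<in> carrier A" for f a
    using counit[OF that] \<epsilon>
      P.sweedler_cong[OF k bilinear_map_functionals[OF f lin_\<epsilon>] _ \<Delta>_closed[OF a], of "\<lambda>u v. f u * c0 v"]
      P.sweedler_cong[OF k bilinear_map_functionals[OF lin_\<epsilon> f] _ \<Delta>_closed[OF a], of "\<lambda>u v. c0 u * f v"]
    by simp_all
  \<comment> \<open>The counit axioms fix the pairings of \<open>\<Delta> x\<close> that matter:
    \<open>1\<close> with \<open>c0 \<otimes> c1\<close> and with \<open>c1 \<otimes> c0\<close>,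
    and \<open>0\<close> with \<open>c0 \<otimes> c0\<close>. The unknown pairing with
    \<open>c1 \<otimes> c1\<close> is multiplied by the latter, so the value is
    \<open>1 + 1\<close>.\<close>
  have "?W c1 c1 (\<Delta> (x \<otimes> x)) = 2"
    using W_mult[OF \<Delta>_closed[OF gens(1)] \<Delta>_closed[OF gens(1)]] ring_hom_mult[OF hom_\<Delta>, of x x]
    by (simp add: counit_c0 lin)
  moreover have "?W c1 c1 (\<Delta> (x \<otimes> x)) = 0"
    using linear_map_zero[OF k_algebra k linear_map_comp[OF lin_\<Delta> lin_W1[OF lin(2,2)]]] by simp
  ultimately have "of_nat 2 = (0 :: 'k)" by simp
  then have "CHAR('k) dvd 2" by (simp only: of_nat_eq_0_iff_char_dvd)
  moreover have "CHAR('k) \<noteq> 1" by simp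
  ultimately show ?thesis using dvd_imp_le[of "CHAR('k)" 2] by (cases "CHAR('k)"; force)
qed

section \<open>Testing equality in tensor powers on functionals\<close>

lemma basis_expand:
  assumes "a \<in> carrier A"
  shows "a = (\<Oplus>i\<in>{0, 1, 2, 3 :: nat}. ([c0, c1, c2, c3] ! i) a \<odot> ([\<one>, x, y, x \<otimes> y] ! i))"
  using expand[OF assms] assms by (simp add: a_ac numeral_eq_Suc)

text \<open>The slicing argument with the basis \<open>1, x, y, x y\<close> on the left.
  \<open>B\<close> is kept general because the tensor square and the tensor cube take
  \<open>A\<close> and \<open>A \<otimes> A\<close> there.\<close>

lemma tensor_eqI:
  assumes B: "k_algebra B" and X: "X \<in> carrier (tensor A B)" and Y: "Y \<in> carrier (tensor A B)"
    and G: "\<And>g. g \<in> G \<Longrightarrow> linear_functional B g"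
    and sep: "\<And>b b'. b \<in> carrier B \<Longrightarrow> b' \<in> carrier B \<Longrightarrow> (\<And>g. g \<in> G \<Longrightarrow> g b = g b') \<Longrightarrow> b = b'"
    and eq: "\<And>f g. linear_functional A f \<Longrightarrow> g \<in> G \<Longrightarrow>
      sweedler base_field (\<lambda>a b. f a * g b) X = sweedler base_field (\<lambda>a b. f a * g b) Y"
  shows "X = Y"
proof -
  interpret AB: kalg_pair A B
    using B by unfold_locales
  have c: "linear_functional A ([c0, c1, c2, c3] ! i)" if "i \<in> {0, 1, 2, 3}" for i
    using that lin by (auto simp: numeral_eq_Suc)
  show ?thesis
    by (rule AB.tensor_separated[OF _ _ c basis_expand G sep X Y eq])
      (auto simp: numeral_eq_Suc intro: c)
qed

lemma tensor_square_eqI: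
  assumes "X \<in> carrier (tensor A A)" "Y \<in> carrier (tensor A A)"
    and "\<And>f g. linear_functional A f \<Longrightarrow> linear_functional A g \<Longrightarrow>
      sweedler base_field (\<lambda>a b. f a * g b) X = sweedler base_field (\<lambda>a b. f a * g b) Y"
  shows "X = Y"
  by (rule tensor_eqI[OF k_algebra assms(1,2), of "Collect (linear_functional A)"])
    (use assms(3) functionals_separate in auto)

text \<open>The right factor is \<open>A \<otimes> A\<close>, whose elements are separated by the
  functionals \<open>g \<otimes> h\<close> according to the square case.\<close>

lemma tensor_cube_eqI:
  assumes X: "X \<in> carrier (tensor A (tensor A A))" and Y: "Y \<in> carrier (tensor A (tensor A A))"
    and eq: "\<And>f g h. linear_functional A f \<Longrightarrow> linear_functional A g \<Longrightarrow> linear_functional A h \<Longrightarrow>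
      sweedler base_field (\<lambda>a Z. f a * sweedler base_field (\<lambda>b c. g b * h c) Z) X =
      sweedler base_field (\<lambda>a Z. f a * sweedler base_field (\<lambda>b c. g b * h c) Z) Y"
  shows "X = Y"
proof (rule tensor_eqI[OF P.k_algebra_tensor X Y])
  let ?G = "{sweedler base_field (\<lambda>b c. g b * h c) | g h. linear_functional A g \<and> linear_functional A h}"
  show "linear_functional (tensor A A) w" if "w \<in> ?G" for w
    using that P.linear_map_sweedler[OF k_algebra_base_field bilinear_map_functionals] by auto
  show "Z = Z'" if "Z \<in> carrier (tensor A A)" "Z' \<in> carrier (tensor A A)" "\<And>w. w \<in> ?G \<Longrightarrow> w Z = w Z'" for Z Z'
    by (rule tensor_square_eqI[OF that(1,2)]) (use that(3) in blast)
  show "sweedler base_field (\<lambda>a b. f a * w b) X = sweedler base_field (\<lambda>a b. f a * w b) Y"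
    if "linear_functional A f" "w \<in> ?G" for f w
    using that eq by auto
qed

section \<open>The coalgebra structures\<close>

abbreviation (input) tens (infixr "\<^bold>\<otimes>" 75) where "a \<^bold>\<otimes> b \<equiv> pure_tensor A A a b"

text \<open>
  \<open>x\<close> and \<open>y\<close> are primitive, so any \<open>s\<close>, \<open>r\<close> give a coassociative map.  The antihomomorphism
  conditions on the map \<open>S\<close> attached to \<open>t = x y\<close> force \<open>s\<^sup>2 = - q\<close> and \<open>r = - q s\<close>.
\<close>

definition coproduct :: "'k \<Rightarrow> 'k \<Rightarrow> 'a \<Rightarrow> ('a \<times> 'a \<Rightarrow>\<^sub>0 'k) set" where
  "coproduct s r a = c0 a \<odot>\<^bsub>tensor A A\<^esub> (\<one> \<^bold>\<otimes> \<one>)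
     \<oplus>\<^bsub>tensor A A\<^esub> c1 a \<odot>\<^bsub>tensor A A\<^esub> (x \<^bold>\<otimes> \<one> \<oplus>\<^bsub>tensor A A\<^esub> \<one> \<^bold>\<otimes> x)
     \<oplus>\<^bsub>tensor A A\<^esub> c2 a \<odot>\<^bsub>tensor A A\<^esub> (y \<^bold>\<otimes> \<one> \<oplus>\<^bsub>tensor A A\<^esub> \<one> \<^bold>\<otimes> y)
     \<oplus>\<^bsub>tensor A A\<^esub> c3 a \<odot>\<^bsub>tensor A A\<^esub> ((x \<otimes> y) \<^bold>\<otimes> \<one> \<oplus>\<^bsub>tensor A A\<^esub> \<one> \<^bold>\<otimes> (x \<otimes> y)
       \<oplus>\<^bsub>tensor A A\<^esub> s \<odot>\<^bsub>tensor A A\<^esub> (x \<^bold>\<otimes> y) \<oplus>\<^bsub>tensor A A\<^esub> r \<odot>\<^bsub>tensor A A\<^esub> (y \<^bold>\<otimes> x))"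

lemma linear_map_coproduct: "linear_map A (tensor A A) (coproduct s r)"
  unfolding coproduct_def
  by (intro linear_map_sum[OF P.k_algebra_tensor] linear_map_scaled[OF P.k_algebra_tensor] lin) simp_all

lemma coproduct_closed [simp]: "a \<in> carrier A \<Longrightarrow> coproduct s r a \<in> carrier (tensor A A)"
  by (rule linear_map_closed[OF linear_map_coproduct])

text \<open>All later Sweedler sums over \<open>coproduct\<close> are evaluated here; sums with
  values in \<open>A\<close> or in a tensor product are first tested with functionals to become
  scalar.\<close>

lemma sweedler_coproduct:
  assumes \<beta>: "bilinear_map A A base_field \<beta>"
  shows "sweedler base_field \<beta> (coproduct s r a) = c0 a * \<beta> \<one> \<one> + c1 a * (\<beta> x \<one> + \<beta> \<one> x)
    + c2 a * (\<beta> y \<one> + \<beta> \<one> y)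
    + c3 a * (\<beta> (x \<otimes> y) \<one> + \<beta> \<one> (x \<otimes> y) + s * \<beta> x y + r * \<beta> y x)"
proof -
  note lin = P.linear_map_sweedler[OF k_algebra_base_field \<beta>]
  note simps = linear_map_add[OF lin] linear_map_smult[OF lin] P.sweedler_pure[OF k_algebra_base_field \<beta>]
  show ?thesis unfolding coproduct_def by (simp add: simps)
qed

lemmas sweedler_coproduct_functionals = sweedler_coproduct[OF bilinear_map_functionals]

lemma coalgebra_coproduct: "coalgebra A (coproduct s r) c0"
  unfolding coalgebra_def
proof (intro conjI ballI)
  note k = k_algebra_base_field and T = P.k_algebra_tensor
  let ?\<Delta> = "coproduct s r" and ?T3 = "tensor A (tensor A A)"
  interpret P3: kalg_pair A "tensor A A"
    by unfold_locales
  fix a assume a: "a \<in> carrier A"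
  show "sweedler A (\<lambda>x y. c0 x \<odot> y) (?\<Delta> a) = a" "sweedler A (\<lambda>x y. c0 y \<odot> x) (?\<Delta> a) = a"
  proof -
    have closed: "sweedler A (\<lambda>x y. c0 x \<odot> y) (?\<Delta> a) \<in> carrier A"
      "sweedler A (\<lambda>x y. c0 y \<odot> x) (?\<Delta> a) \<in> carrier A"
      using bilinear_map_comp_args[OF bilinear_map_smult[OF k_algebra] lin(1) linear_map_id]
      by (auto intro!: linear_map_closed[OF P.linear_map_sweedler[OF k_algebra]] coproduct_closed a
          dest: bilinear_map_flip)
    have "f (sweedler A (\<lambda>x y. c0 x \<odot> y) (?\<Delta> a)) = f a"
      "f (sweedler A (\<lambda>x y. c0 y \<odot> x) (?\<Delta> a)) = f a" if f: "linear_functional A f" for f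
      unfolding P.functional_slice_left[OF lin(1) f coproduct_closed[OF a]]
        P.functional_slice_right[OF lin(1) f coproduct_closed[OF a]]
        sweedler_coproduct_functionals[OF lin(1) f] sweedler_coproduct_functionals[OF f lin(1)]
        functional_expand[OF f a] by simp_all
    then show "sweedler A (\<lambda>x y. c0 x \<odot> y) (?\<Delta> a) = a" "sweedler A (\<lambda>x y. c0 y \<odot> x) (?\<Delta> a) = a"
      by (auto intro: functionals_separate[OF _ a] closed)
  qed
  have pure3: "bilinear_map A (tensor A A) ?T3 (pure_tensor A (tensor A A))"
    by (rule P3.bilinear_map_pure_tensor)
  \<comment> \<open>The integrand of \<open>(\<Delta> \<otimes> id) \<Delta>\<close> with the outer
    second leg \<open>v\<close> as a parameter, so that linearity in \<open>v\<close> can be treated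
    on its own.\<close>
  define \<gamma> where "\<gamma> = (\<lambda>v u1 u2. pure_tensor A (tensor A A) u1 (u2 \<^bold>\<otimes> v))"
  have \<gamma>: "bilinear_map A A ?T3 (\<gamma> v)" if "v \<in> carrier A" for v
    unfolding \<gamma>_def
    by (rule bilinear_map_comp_args[OF pure3 linear_map_id bilinear_map_left[OF P.bilinear_map_pure_tensor that]])
  have \<gamma>_lin: "linear_map A ?T3 (\<lambda>v. \<gamma> v u1 u2)" if "u1 \<in> carrier A" "u2 \<in> carrier A" for u1 u2
    unfolding \<gamma>_def
    by (rule linear_map_comp[OF bilinear_map_right[OF P.bilinear_map_pure_tensor that(2)] bilinear_map_right[OF pure3 that(1)]])
  have L: "bilinear_map A A ?T3 (\<lambda>u v. sweedler ?T3 (\<gamma> v) (?\<Delta> u))"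
  proof (rule bilinear_mapI)
    show "linear_map A ?T3 (\<lambda>v. sweedler ?T3 (\<gamma> v) (?\<Delta> u))" if "u \<in> carrier A" for u
      by (rule P.linear_map_sweedler_param[OF P3.k_algebra_tensor \<gamma> \<gamma>_lin k_algebra]) (simp_all add: that)
    show "linear_map A ?T3 (\<lambda>u. sweedler ?T3 (\<gamma> v) (?\<Delta> u))" if "v \<in> carrier A" for v
      by (rule linear_map_comp[OF linear_map_coproduct P.linear_map_sweedler[OF P3.k_algebra_tensor \<gamma>[OF that]]])
  qed
  have R: "bilinear_map A A ?T3 (\<lambda>u v. pure_tensor A (tensor A A) u (?\<Delta> v))"
    by (rule bilinear_map_comp_args[OF pure3 linear_map_id linear_map_coproduct])
  have "sweedler ?T3 (\<lambda>u v. sweedler ?T3 (\<gamma> v) (?\<Delta> u)) (?\<Delta> a) =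
    sweedler ?T3 (\<lambda>u v. pure_tensor A (tensor A A) u (?\<Delta> v)) (?\<Delta> a)"
  proof (rule tensor_cube_eqI)
    show "sweedler ?T3 (\<lambda>u v. sweedler ?T3 (\<gamma> v) (?\<Delta> u)) (?\<Delta> a) \<in> carrier ?T3"
      by (rule linear_map_closed[OF P.linear_map_sweedler[OF P3.k_algebra_tensor L] coproduct_closed[OF a]])
    show "sweedler ?T3 (\<lambda>u v. pure_tensor A (tensor A A) u (?\<Delta> v)) (?\<Delta> a) \<in> carrier ?T3"
      by (rule linear_map_closed[OF P.linear_map_sweedler[OF P3.k_algebra_tensor R] coproduct_closed[OF a]])
    fix f g h assume fgh: "linear_functional A f" "linear_functional A g" "linear_functional A h"
    let ?W = "sweedler base_field (\<lambda>b c. g b * h c)"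
    let ?D = "sweedler base_field (\<lambda>a Z. f a * ?W Z)"
    note W = P.linear_map_sweedler[OF k bilinear_map_functionals[OF fgh(2,3)]]
    note \<beta> = bilinear_map_functionals[OF fgh(1) W]
    note D = P3.linear_map_sweedler[OF k \<beta>] and D_pure = P3.sweedler_pure[OF k \<beta>]
    have W_pure: "?W (b \<^bold>\<otimes> c) = g b * h c" if "b \<in> carrier A" "c \<in> carrier A" for b c
      by (rule P.sweedler_pure[OF k bilinear_map_functionals[OF fgh(2,3)] that])
    have inner: "?D (sweedler ?T3 (\<gamma> v) (?\<Delta> u)) = c0 u * (f \<one> * g \<one> * h v)
        + c1 u * (f x * g \<one> * h v + f \<one> * g x * h v) + c2 u * (f y * g \<one> * h v + f \<one> * g y * h v)
        + c3 u * (f (x \<otimes> y) * g \<one> * h v + f \<one> * g (x \<otimes> y) * h v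
          + s * (f x * g y * h v) + r * (f y * g x * h v))"
      if "u \<in> carrier A" "v \<in> carrier A" for u v
      using P.linear_map_sweedler_comp[OF P3.k_algebra_tensor k \<gamma>[OF that(2)] D coproduct_closed[OF that(1)]] that(2)
      by (simp add: sweedler_coproduct[OF bilinear_map_comp[OF \<gamma>[OF that(2)] D]])
        (simp add: \<gamma>_def D_pure W_pure mult.assoc)
    have "?D (sweedler ?T3 (\<lambda>u v. sweedler ?T3 (\<gamma> v) (?\<Delta> u)) (?\<Delta> a)) =
        sweedler base_field (\<lambda>u v. ?D (sweedler ?T3 (\<gamma> v) (?\<Delta> u))) (?\<Delta> a)"
      by (rule P.linear_map_sweedler_comp[OF P3.k_algebra_tensor k L D coproduct_closed[OF a]])
    moreover have "?D (sweedler ?T3 (\<lambda>u v. pure_tensor A (tensor A A) u (?\<Delta> v)) (?\<Delta> a)) =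
        sweedler base_field (\<lambda>u v. ?D (pure_tensor A (tensor A A) u (?\<Delta> v))) (?\<Delta> a)"
      by (rule P.linear_map_sweedler_comp[OF P3.k_algebra_tensor k R D coproduct_closed[OF a]])
    ultimately show "?D (sweedler ?T3 (\<lambda>u v. sweedler ?T3 (\<gamma> v) (?\<Delta> u)) (?\<Delta> a)) =
        ?D (sweedler ?T3 (\<lambda>u v. pure_tensor A (tensor A A) u (?\<Delta> v)) (?\<Delta> a))"
      by (simp add: sweedler_coproduct[OF bilinear_map_comp[OF L D]] sweedler_coproduct[OF bilinear_map_comp[OF R D]])
        (simp add: inner D_pure sweedler_coproduct_functionals[OF fgh(2,3)], simp add: algebra_simps)
  qed
  then show "sweedler ?T3 (\<lambda>u v. sweedler ?T3
      (\<lambda>u1 u2. pure_tensor A (tensor A A) u1 (u2 \<^bold>\<otimes> v)) (?\<Delta> u)) (?\<Delta> a) =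
    sweedler ?T3 (\<lambda>u v. pure_tensor A (tensor A A) u (?\<Delta> v)) (?\<Delta> a)"
    by (simp add: \<gamma>_def)
qed (simp_all add: linear_map_coproduct lin)

lemma counit_hom: "algebra_hom A base_field c0"
  by (simp add: algebra_hom_def lin ring_hom_def)

lemma coproduct_one: "coproduct s r \<one> = \<one> \<^bold>\<otimes> \<one>"
  by (simp add: coproduct_def)

lemma group_like_one: "group_like A (coproduct s r) c0 \<one>"
  by (simp add: group_like_def coproduct_one)

section \<open>The bi-Frobenius structure for \<open>q\<^sup>2 = 1\<close>\<close>

lemma frobenius_algebra_c3: "frobenius_algebra A c3"
  unfolding frobenius_algebra_def
proof (intro conjI allI impI)
  fix f assume f: "linear_functional A f"
  \<comment> \<open>For \<open>a = 1, x, y, x y\<close> the functional \<open>c3 (u a)\<close> is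
    \<open>c3 u\<close>, \<open>- c2 u / q\<close>, \<open>c1 u\<close>, \<open>c0 u\<close>; the
    coefficients of the dual basis are read off from this.\<close>
  let ?a = "f (x \<otimes> y) \<odot> \<one> \<oplus> (- q * f y) \<odot> x \<oplus> f x \<odot> y \<oplus> f \<one> \<odot> (x \<otimes> y)"
  show "\<exists>a\<in>carrier A. \<forall>u\<in>carrier A. f u = c3 (u \<otimes> a)"
  proof (intro bexI[of _ ?a] ballI)
    show "f u = c3 (u \<otimes> ?a)" if "u \<in> carrier A" for u
      using that functional_expand[OF f that] q_nonzero by simp
  qed simp
qed (rule lin)

lemma frobenius_coalgebra_xy:
  assumes "s \<noteq> 0" "r \<noteq> 0"
  shows "frobenius_coalgebra A (coproduct s r) (x \<otimes> y)"
  unfolding frobenius_coalgebra_def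
proof (intro conjI ballI)
  fix a assume a: "a \<in> carrier A"
  \<comment> \<open>Contracting \<open>\<Delta> (x y)\<close> with \<open>f\<close> gives
    \<open>f (x y) 1 + f 1 (x y) + s (f x) y + r (f y) x\<close>; matching this with
    \<open>a\<close> determines \<open>f\<close> on the basis.\<close>
  let ?f = "\<lambda>u. c3 a * c0 u + c0 a * c3 u + (c2 a / s) * c1 u + (c1 a / r) * c2 u"
  have f: "linear_functional A ?f"
    by (rule linear_mapI) (simp_all add: algebra_simps)
  have "a = sweedler A (\<lambda>u v. ?f u \<odot> v) (coproduct s r (x \<otimes> y))"
  proof (rule functionals_separate[OF a])
    show "sweedler A (\<lambda>u v. ?f u \<odot> v) (coproduct s r (x \<otimes> y)) \<in> carrier A"
      using linear_map_closed[OF P.linear_map_sweedler[OF k_algebra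
        bilinear_map_comp_args[OF bilinear_map_smult[OF k_algebra] f linear_map_id]] coproduct_closed] by simp
    fix h assume h: "linear_functional A h"
    show "h a = h (sweedler A (\<lambda>u v. ?f u \<odot> v) (coproduct s r (x \<otimes> y)))"
      using assms unfolding P.functional_slice_left[OF f h coproduct_closed[OF m_closed[OF gens]]]
        sweedler_coproduct_functionals[OF f h] functional_expand[OF h a] by simp
  qed
  with f show "\<exists>f. linear_functional A f \<and> a = sweedler A (\<lambda>u v. f u \<odot> v) (coproduct s r (x \<otimes> y))" by blast
qed simp

lemma finite_dimensional: "finite_dimensional A"
  unfolding finite_dimensional_def
proof (intro exI[of _ "{\<one>, x, y, x \<otimes> y}"] conjI ballI)
  have coords_xy: "c0 (x \<otimes> y) = 0" "c1 (x \<otimes> y) = 0" "c2 (x \<otimes> y) = 0" by simp_all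
  \<comment> \<open>The spanning sum is indexed by a set and its coefficients are given by function
    updates, so the four elements must be distinct.\<close>
  have "\<one> \<noteq> x" "\<one> \<noteq> y" "\<one> \<noteq> x \<otimes> y" "x \<noteq> y" "x \<noteq> x \<otimes> y" "y \<noteq> x \<otimes> y"
    using coords_one coords_x coords_y coords_xy by (metis zero_neq_one)+
  note distinct = this this[symmetric]
  fix a assume a: "a \<in> carrier A"
  let ?c = "(\<lambda>_. 0)(\<one> := c0 a, x := c1 a, y := c2 a, x \<otimes> y := c3 a)"
  have "a = (\<Oplus>b\<in>{\<one>, x, y, x \<otimes> y}. ?c b \<odot> b)"
    using expand[OF a] distinct a by (simp add: a_ac)
  then show "\<exists>c. a = (\<Oplus>b\<in>{\<one>, x, y, x \<otimes> y}. c b \<odot> b)" by blast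
qed auto

text \<open>The coordinate form of \<open>\<Sum> \<phi> (t1 a) t2\<close> for
  \<open>\<phi> = c3\<close>, \<open>t = x y\<close> and \<open>r = - q s\<close>: the term
  \<open>s (x \<otimes> y)\<close> contributes \<open>s c3(x a) y = s c2(a) y\<close>, and
  \<open>r (y \<otimes> x)\<close> contributes \<open>r c3(y a) x = s c1(a) x\<close>.\<close>

definition antipode :: "'k \<Rightarrow> 'a \<Rightarrow> 'a" where
  "antipode s a = c0 a \<odot> \<one> \<oplus> (s * c1 a) \<odot> x \<oplus> (s * c2 a) \<odot> y \<oplus> c3 a \<odot> (x \<otimes> y)"

lemma antipode_closed [simp]: "antipode s a \<in> carrier A"
  by (simp add: antipode_def)

lemma coords_antipode [simp]:
  "c0 (antipode s a) = c0 a" "c1 (antipode s a) = s * c1 a" "c2 (antipode s a) = s * c2 a"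
  "c3 (antipode s a) = c3 a"
  by (simp_all add: antipode_def)

lemma linear_map_antipode: "linear_map A A (antipode s)"
  by (intro linear_mapI coords_ext) (simp_all add: algebra_simps)

text \<open>Antimultiplicativity compares \<open>S (x y) = x y\<close> with
  \<open>S y S x = s\<^sup>2 y x = - (s\<^sup>2 / q) x y\<close>, whence
  \<open>s\<^sup>2 = - q\<close>. Anticomultiplicativity at \<open>x y\<close> swaps the mixed terms
  at the cost of \<open>s\<^sup>2\<close>: it needs \<open>s = s\<^sup>2 r\<close> and
  \<open>r = s\<^sup>2 s\<close>, which hold for \<open>r = - q s\<close> when
  \<open>q\<^sup>2 = 1\<close>.\<close>

lemma bi_frobenius_coproduct:
  assumes q2: "q\<^sup>2 = 1" and s: "s\<^sup>2 = - q"
  shows "bi_frobenius_algebra A (coproduct s (- q * s)) c0 c3 (x \<otimes> y) (antipode s)"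
proof -
  have s0: "s \<noteq> 0" using s q_nonzero by auto
  \<comment> \<open>Since \<open>q\<close> is its own inverse, these rules and those for
    \<open>s\<close> bring every scalar to a combination of \<open>1, q, s, q s\<close>.\<close>
  have qq: "q * q = 1" "q * (q * u) = u" "inverse q = q" "u / q = u * q" for u
  proof -
    show qq: "q * q = 1" using q2 by (simp add: power2_eq_square)
    then show "q * (q * u) = u" by (simp flip: mult.assoc)
    show "inverse q = q" using qq by (rule inverse_unique)
    then show "u / q = u * q" by (simp add: divide_inverse)
  qed
  have ss: "s * s = - q" "s * (s * u) = - (q * u)" for u
    using s by (simp_all add: power2_eq_square flip: mult.assoc)
  let ?\<Delta> = "coproduct s (- q * s)"
  have S: "antipode s a = sweedler A (\<lambda>u v. c3 (u \<otimes> a) \<odot> v) (?\<Delta> (x \<otimes> y))" if a: "a \<in> carrier A" for a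
  proof (rule functionals_separate[OF antipode_closed])
    note f = linear_map_comp[OF linear_map_mult_right[OF k_algebra a] lin(4)]
    show "sweedler A (\<lambda>u v. c3 (u \<otimes> a) \<odot> v) (?\<Delta> (x \<otimes> y)) \<in> carrier A"
      using linear_map_closed[OF P.linear_map_sweedler[OF k_algebra
        bilinear_map_comp_args[OF bilinear_map_smult[OF k_algebra] f linear_map_id]] coproduct_closed] by simp
    fix h assume h: "linear_functional A h"
    show "h (antipode s a) = h (sweedler A (\<lambda>u v. c3 (u \<otimes> a) \<odot> v) (?\<Delta> (x \<otimes> y)))"
      unfolding P.functional_slice_left[OF f h coproduct_closed[OF m_closed[OF gens]]]
        sweedler_coproduct_functionals[OF f h] functional_expand[OF h antipode_closed]
      using a by (simp add: qq)
  qed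
  have antialg: "algebra_antihom A (antipode s)"
    unfolding algebra_antihom_def
  proof (intro conjI ballI)
    show "antipode s \<one> = \<one>" by (rule coords_ext) simp_all
    show "antipode s (a \<otimes> b) = antipode s b \<otimes> antipode s a" if "a \<in> carrier A" "b \<in> carrier A" for a b
      using that by (intro coords_ext) (simp_all add: algebra_simps qq ss)
  qed (rule linear_map_antipode)
  have anticoalg: "coalgebra_antihom A ?\<Delta> c0 (antipode s)"
    unfolding coalgebra_antihom_def
  proof (intro conjI ballI)
    fix a assume a: "a \<in> carrier A"
    have p: "bilinear_map A A (tensor A A) (\<lambda>u v. antipode s v \<^bold>\<otimes> antipode s u)"
      using bilinear_map_flip[OF bilinear_map_comp_args[OF P.bilinear_map_pure_tensor
        linear_map_antipode linear_map_antipode]] .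
    show "?\<Delta> (antipode s a) = sweedler (tensor A A) (\<lambda>u v. antipode s v \<^bold>\<otimes> antipode s u) (?\<Delta> a)"
    proof (rule tensor_square_eqI)
      show "sweedler (tensor A A) (\<lambda>u v. antipode s v \<^bold>\<otimes> antipode s u) (?\<Delta> a) \<in> carrier (tensor A A)"
        by (rule linear_map_closed[OF P.linear_map_sweedler[OF P.k_algebra_tensor p] coproduct_closed[OF a]])
      fix f g assume fg: "linear_functional A f" "linear_functional A g"
      note k = k_algebra_base_field
      note W = P.linear_map_sweedler[OF k bilinear_map_functionals[OF fg]]
      show "sweedler base_field (\<lambda>a b. f a * g b) (?\<Delta> (antipode s a)) =
        sweedler base_field (\<lambda>a b. f a * g b)
          (sweedler (tensor A A) (\<lambda>u v. antipode s v \<^bold>\<otimes> antipode s u) (?\<Delta> a))"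
        unfolding trans[OF P.linear_map_sweedler_comp[OF P.k_algebra_tensor k p W coproduct_closed[OF a]]
            sweedler_coproduct[OF bilinear_map_comp[OF p W]]]
        unfolding sweedler_coproduct_functionals[OF fg]
          P.sweedler_pure[OF k bilinear_map_functionals[OF fg] antipode_closed antipode_closed]
          functional_expand[OF fg(1) antipode_closed] functional_expand[OF fg(2) antipode_closed]
        by (simp add: algebra_simps ss qq)
    qed simp
  qed (simp_all add: linear_map_antipode)
  show ?thesis
    unfolding bi_frobenius_algebra_def
    by (intro conjI ballI k_algebra finite_dimensional coalgebra_coproduct counit_hom group_like_one
        frobenius_algebra_c3 frobenius_coalgebra_xy S antialg anticoalg s0)
      (use s0 q_nonzero in simp_all)
qed

section \<open>The Hopf structure in characteristic two\<close>

lemma hopf_coproduct: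
  assumes "q = 1" "CHAR('k) = 2"
  shows "hopf_algebra A (coproduct 1 1) c0 (\<lambda>a. a)"
proof -
  note k = k_algebra_base_field
  \<comment> \<open>Multiplicativity dictates \<open>s = r = 1\<close>, since \<open>(x \<otimes> 1
    + 1 \<otimes> x) (y \<otimes> 1 + 1 \<otimes> y) = x y \<otimes> 1 + x \<otimes> y + y \<otimes>
    x + 1 \<otimes> x y\<close>. With \<open>q = 1\<close> and \<open>2 = 0\<close> this agrees with
    \<open>s\<^sup>2 = - q\<close> and \<open>r = - q s\<close>.\<close>
  let ?\<Delta> = "coproduct 1 1"
  have two: "(2 :: 'k) = 0" using of_nat_CHAR[where 'a = 'k] assms(2) by simp
  have four: "(4 :: 'k) = 2 * 2" by simp
  have double: "u + u = 0" "u + (u + v) = v" "- u = u" for u v :: 'k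
  proof -
    show uu: "u + u = 0" using two by (simp flip: mult_2)
    then show "u + (u + v) = v" by (simp flip: add.assoc)
    show "- u = u" using uu by (simp add: add_eq_0_iff)
  qed
  note [simp] = assms(1) yx
  have mult: "?\<Delta> (a \<otimes> b) = ?\<Delta> a \<otimes>\<^bsub>tensor A A\<^esub> ?\<Delta> b" if a: "a \<in> carrier A" and b: "b \<in> carrier A" for a b
  proof (rule tensor_square_eqI)
    fix f g assume f: "linear_functional A f" and g: "linear_functional A g"
    let ?W = "sweedler base_field (\<lambda>u v. f u * g v)"
    let ?\<beta> = "\<lambda>u v. sweedler base_field (\<lambda>u' v'. f (u \<otimes> u') * g (v \<otimes> v')) (?\<Delta> b)"
    have inner: "bilinear_map A A base_field (\<lambda>u' v'. f (u \<otimes> u') * g (v \<otimes> v'))"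
      if "u \<in> carrier A" "v \<in> carrier A" for u v
      by (rule bilinear_map_functionals[OF linear_map_comp[OF linear_map_mult_left[OF k_algebra that(1)] f]
        linear_map_comp[OF linear_map_mult_left[OF k_algebra that(2)] g]])
    note expand_inner = sweedler_coproduct[OF inner]
    have \<beta>: "bilinear_map A A base_field ?\<beta>"
    proof (rule bilinear_mapI)
      fix u assume u: "u \<in> carrier A"
      show "linear_functional A (\<lambda>v. ?\<beta> u v)"
        using inner[OF u] bilinear_map_functionals[OF f g]
        by (intro P.linear_map_sweedler_param[OF k _ _ k_algebra coproduct_closed[OF b]])
          (auto intro!: linear_mapI simp: l_distr linear_map_add[OF g] linear_map_smult[OF g] algebra_simps)
      show "linear_functional A (\<lambda>v. ?\<beta> v u)"
        using inner[OF _ u] bilinear_map_functionals[OF f g] u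
        by (intro P.linear_map_sweedler_param[OF k _ _ k_algebra coproduct_closed[OF b]])
          (auto intro!: linear_mapI simp: l_distr linear_map_add[OF f] linear_map_smult[OF f] algebra_simps)
    qed
    have zero: "f \<zero> = 0" "g \<zero> = 0"
      using linear_map_zero[OF k_algebra k f] linear_map_zero[OF k_algebra k g] by simp_all
    have table: "x \<otimes> (x \<otimes> y) = \<zero>" "y \<otimes> (x \<otimes> y) = \<zero>" "x \<otimes> y \<otimes> x = \<zero>"
      "x \<otimes> y \<otimes> y = \<zero>" "x \<otimes> y \<otimes> (x \<otimes> y) = \<zero>"
      by (rule coords_ext; simp)+
    show "?W (?\<Delta> (a \<otimes> b)) = ?W (?\<Delta> a \<otimes>\<^bsub>tensor A A\<^esub> ?\<Delta> b)"
      unfolding P.functional_tensor_mult[OF f g coproduct_closed[OF a] coproduct_closed[OF b]]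
        sweedler_coproduct[OF \<beta>] sweedler_coproduct_functionals[OF f g]
      by (simp add: expand_inner a b table zero linear_map_smult[OF f] linear_map_smult[OF g] double)
        (simp add: algebra_simps double two four del: mult_numeral_left mult_2 mult_2_right)
  qed (use a b in simp_all)
  have "algebra_hom A (tensor A A) ?\<Delta>"
    unfolding algebra_hom_def
    by (intro conjI linear_map_coproduct ring_hom_memI mult)
      (simp_all add: P.tensor_one coproduct_one linear_map_add[OF linear_map_coproduct])
  \<comment> \<open>The antipode negates primitive elements, which here is the identity. Both
    antipode laws thus become \<open>\<Sum> a1 a2 = \<epsilon> a\<close>, and at \<open>x y\<close>
    the four terms cancel because \<open>y x = x y\<close> and \<open>2 = 0\<close>.\<close>
  moreover have "sweedler A (mult A) (?\<Delta> a) = c0 a \<odot> \<one>" if a: "a \<in> carrier A" for a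
  proof (rule functionals_separate)
    note b = bilinear_map_mult[OF k_algebra]
    show "sweedler A (mult A) (?\<Delta> a) \<in> carrier A"
      by (rule linear_map_closed[OF P.linear_map_sweedler[OF k_algebra b] coproduct_closed[OF a]])
    fix f assume f: "linear_functional A f"
    show "f (sweedler A (mult A) (?\<Delta> a)) = f (c0 a \<odot> \<one>)"
      unfolding trans[OF P.linear_map_sweedler_comp[OF k_algebra k b f coproduct_closed[OF a]]
        sweedler_coproduct[OF bilinear_map_comp[OF b f]]]
      using linear_map_zero[OF k_algebra k f] by (simp add: linear_map_smult[OF f] double)
  qed simp
  ultimately show ?thesis
    by (simp add: hopf_algebra_def k_algebra coalgebra_coproduct counit_hom linear_map_id)
qed

end

text \<open>A finite-dimensional Hopf algebra is bi-Frobenius, so by (a) a Hopf structure can exist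
  for \<open>q = 1\<close> or \<open>q = -1\<close> only; this is why the equivalence in (c) is
  stated for these values.\<close>

theorem theorem5p1:
  fixes q :: "'k::field"
  assumes "q \<noteq> 0"
  shows "(admits_bi_frobenius (A_q q) \<longrightarrow> q = 1 \<or> q = -1) \<and>
         ((\<exists>i::'k. i\<^sup>2 = -1) \<and> (q = 1 \<or> q = -1) \<longrightarrow> admits_bi_frobenius (A_q q)) \<and>
         (admits_hopf (A_q q) \<longrightarrow> CHAR('k) = 2) \<and>
         (q = 1 \<or> q = -1 \<longrightarrow> (admits_hopf (A_q q) \<longleftrightarrow> CHAR('k) = 2))"
proof -
  obtain x y c0 c1 c2 c3 where "quantum_exterior (A_q q) q x y c0 c1 c2 c3"
    using quantum_exterior_A_q[OF assms] by blast
  then interpret quantum_exterior "A_q q" q x y c0 c1 c2 c3 .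
  have a: "q = 1 \<or> q = -1" if "admits_bi_frobenius (A_q q)"
    using that bi_frobenius_imp_parameter by (auto simp: admits_bi_frobenius_def power2_eq_1_iff)
  have b: "admits_bi_frobenius (A_q q)" if i: "i\<^sup>2 = -1" and q: "q = 1 \<or> q = -1" for i :: 'k
  proof -
    \<comment> \<open>The square root of \<open>- q\<close> required for \<open>s\<close>: it is
      \<open>i\<close> for \<open>q = 1\<close>, and \<open>1\<close> serves for
      \<open>q = -1\<close>.\<close>
    have "q\<^sup>2 = 1" "(if q = 1 then i else 1)\<^sup>2 = - q" using i q by auto
    then show ?thesis unfolding admits_bi_frobenius_def by (blast intro: bi_frobenius_coproduct)
  qed
  have c: "CHAR('k) = 2" if "admits_hopf (A_q q)"
    using that hopf_imp_char_two by (auto simp: admits_hopf_def)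
  have d: "admits_hopf (A_q q)" if char: "CHAR('k) = 2" and q: "q = 1 \<or> q = -1"
  proof -
    \<comment> \<open>In characteristic two the signs coincide, so both values of \<open>q\<close>
      reduce to \<open>1\<close>.\<close>
    have "(1 :: 'k) + 1 = 0" using of_nat_CHAR[where 'a = 'k] char by simp
    then have "(-1 :: 'k) = 1" by (simp add: add_eq_0_iff)
    then have "q = 1" using q by auto
    from hopf_coproduct[OF this char] show ?thesis unfolding admits_hopf_def by blast
  qed
  show ?thesis using a b c d by blast
qed

end
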